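(* Let $p=p_n$ with $p/n\to0$, and suppose the parameter space condition (A) and the wedge condition (B) of the context hold. Let $(\hat\alpha^k,\hat\beta^k,\hat d^k)$ be the two-step estimator defined in the context. For every fixed $0\le k<\infty$, $$\Big(\sqrt n\wedge\frac np\Big(\log\frac np\Big)^{-1}\Big)(\hat\alpha^k-\alpha_0)=O_p(1),\qquad \Big(\sqrt n\wedge\frac np\Big(\log\frac np\Big)^{-1}\Big)(\hat\beta^k-\beta_0)=O_p(1),$$ $$\frac np\Big(\log\frac np\Big)^{-1}\mathbb P\big(\operatorname{sign}(X^\top\hat d^k)\ne\operatorname{sign}(X^\top d_0)\big)=O_p(1),\qquad \frac np\Big(\log\frac np\Big)^{-1}\big\|\hat d^k-d_0\big\|_2=O_p(1).$$ For $k=\infty$ (squared error loss), writing $(\hat\alpha^{\ell_2},\hat\beta^{\ell_2},\hat d^{\ell_2})$ for the estimator, $\|\xi\|_{n,L_1}=\mathbb E[\max_{1\le i\le n}|\xi_i|]$ and $$r_n=\frac{n}{p\|\xi\|_{n,L_1}}\Big(\log\frac{n}{p\|\xi\|_{n,L_1}}\Big)^{-1},$$ one has $$(\sqrt n\wedge r_n)(\hat\alpha^{\ell_2}-\alpha_0)=O_p(1),\qquad(\sqrt n\wedge r_n)(\hat\beta^{\ell_2}-\beta_0)=O_p(1),\qquad r_n\big\|\hat d^{\ell_2}-d_0\big\|_2=O_p(1).$$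
   Context: Model: $(X_i,\xi_i)_{1\le i\le n}$ i.i.d. copies of $(X,\xi)$ with $X\in\mathbb R^p$ (law depending on $p=p_n$), $\xi$ real, independent of $X$, symmetric about $0$, with continuous density $f_\xi$, $f_\xi(0)>0$; for the squared error case, also $\mathbb E[\xi^2]<\infty$. One observes $(X_i,Y_i)$ with $Y_i=\alpha_0\mathbf 1_{X_i^\top d_0\le0}+\beta_0\mathbf 1_{X_i^\top d_0>0}+\xi_i$. Convention: $\operatorname{sign}(x)=1$ if $x>0$ and $-1$ if $x\le0$. The probability $\mathbb P(\operatorname{sign}(X^\top\hat d)\neq\operatorname{sign}(X^\top d_0))$ is over a fresh $X$ with $\hat d$ held fixed. (A) $(\alpha_0,\beta_0)\in\Omega$, where $\Omega\subset\mathbb R^2$ is compact and $\alpha>\beta$ for every $(\alpha,\beta)\in\Omega$; and $d_0\in S^{p-1}$ (unit sphere). (B) There is $\delta>0$ such that for all $d\in S^{p-1}$ with $\|d-d_0\|_2\le\delta$: $\mathbb P(\operatorname{sign}(X^\top d)\ne\operatorname{sign}(X^\top d_0))\ge c\|d-d_0\|_2$, $\mathbb P(X^\top d\wedge X^\top d_0\ge0)\ge C_1$, and $\mathbb P(X^\top d\vee X^\top d_0\le0)\ge C_2$, where the positive constants $c,C_1,C_2,\delta$ do not depend on $n$. Scaled Huber function: for $0<k<\infty$, $\tilde H_k=\frac{k+1}kH_k$ with $H_k(x)=x^2/2$ if $|x|\le k$, $H_k(x)=k(|x|-k/2)$ if $|x|>k$; $\tilde H_0(x)=|x|$ and $\tilde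 H_\infty(x)=x^2/2$. Two-step estimator ($0\le k\le\infty$): Step 1: $(\hat\alpha^k_{\rm init},\hat\beta^k_{\rm init},\hat d^k)$ minimizes $\sum_i\tilde H_k(Y_i-\alpha\mathbf 1_{X_i^\top d\le0}-\beta\mathbf 1_{X_i^\top d>0})$ over $(\alpha,\beta)\in\Omega$, $d\in S^{p-1}$. Step 2: $(\hat\alpha^k,\hat\beta^k)$ minimizes $\sum_i\tilde H_k(Y_i-\alpha\mathbf 1_{X_i^\top\hat d^k\le0}-\beta\mathbf 1_{X_i^\top\hat d^k>0})$ over $(\alpha,\beta)\in\Omega$.
   Formalization: Two provisos are added: P(X^T d_0 > 0) is bounded below by a positive constant not depending on n (automatic from (B) if X^T d_0 has no atom at 0); and, for k=∞ only, |log(n/(p‖ξ‖_{n,L1}))| stays bounded away from 0 for large n. *)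

theory Defs
  imports "HOL-Probability.Probability"
begin

text \<open>
  The dimension varies with the sample size, so a vector of dimension \<open>p\<close> is a function
  on \<open>{..<p}\<close> (extensional, i.e. an element of the product space below); observations are
  indexed by \<open>{1..n}\<close>.
\<close>

abbreviation vec_space :: "nat \<Rightarrow> (nat \<Rightarrow> real) measure" where
  "vec_space p \<equiv> Pi\<^sub>M {..<p} (\<lambda>_. borel)"

definition dot :: "nat \<Rightarrow> (nat \<Rightarrow> real) \<Rightarrow> (nat \<Rightarrow> real) \<Rightarrow> real" where
  "dot p x d = (\<Sum>j<p. x j * d j)"

definition l2_dist :: "nat \<Rightarrow> (nat \<Rightarrow> real) \<Rightarrow> (nat \<Rightarrow> real) \<Rightarrow> real" where
  "l2_dist p d e = L2_set (\<lambda>j. d j - e j) {..<p}"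

definition unit_sphere :: "nat \<Rightarrow> (nat \<Rightarrow> real) set" where
  "unit_sphere p = {d \<in> space (vec_space p). L2_set d {..<p} = 1}"

text \<open>Unlike \<^const>\<open>sgn\<close>, the sign used here is \<open>-1\<close> at \<open>0\<close>.\<close>

definition csign :: "real \<Rightarrow> real" where
  "csign t = (if t > 0 then 1 else - 1)"

definition step_value :: "real \<Rightarrow> real \<Rightarrow> real \<Rightarrow> real" where
  "step_value \<alpha> \<beta> t = \<alpha> * indicator {..0} t + \<beta> * indicator {0<..} t"

definition huber :: "real \<Rightarrow> real \<Rightarrow> real" where
  "huber k x = (if \<bar>x\<bar> \<le> k then x\<^sup>2 / 2 else k * (\<bar>x\<bar> - k / 2))"

definition scaled_huber :: "ennreal \<Rightarrow> real \<Rightarrow> real" where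
  "scaled_huber k x =
     (if k = 0 then \<bar>x\<bar>
      else if k = \<infinity> then x\<^sup>2 / 2
      else (enn2real k + 1) / enn2real k * huber (enn2real k) x)"

definition empirical_loss ::
  "ennreal \<Rightarrow> nat \<Rightarrow> nat \<Rightarrow> (nat \<Rightarrow> nat \<Rightarrow> real) \<Rightarrow> (nat \<Rightarrow> real) \<Rightarrow>
   real \<Rightarrow> real \<Rightarrow> (nat \<Rightarrow> real) \<Rightarrow> real" where
  "empirical_loss k p n x y \<alpha> \<beta> d =
     (\<Sum>i=1..n. scaled_huber k (y i - step_value \<alpha> \<beta> (dot p (x i) d)))"

definition two_step_estimate ::
  "ennreal \<Rightarrow> (real \<times> real) set \<Rightarrow> nat \<Rightarrow> nat \<Rightarrow> (nat \<Rightarrow> nat \<Rightarrow> real) \<Rightarrow> (nat \<Rightarrow> real) \<Rightarrow>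
   real \<Rightarrow> real \<Rightarrow> (nat \<Rightarrow> real) \<Rightarrow> real \<Rightarrow> real \<Rightarrow> bool" where
  "two_step_estimate k \<Omega> p n x y a_init b_init d a b \<longleftrightarrow>
     is_arg_min (\<lambda>(\<alpha>, \<beta>, e). empirical_loss k p n x y \<alpha> \<beta> e)
       (\<lambda>(\<alpha>, \<beta>, e). (\<alpha>, \<beta>) \<in> \<Omega> \<and> e \<in> unit_sphere p) (a_init, b_init, d) \<and>
     is_arg_min (\<lambda>(\<alpha>, \<beta>). empirical_loss k p n x y \<alpha> \<beta> d) (\<lambda>\<theta>. \<theta> \<in> \<Omega>) (a, b)"

text \<open>
  Minimizers need not be unique: the predicate below describes any measurable selection.  The
  first-step values \<open>a_init\<close>, \<open>b_init\<close> are not required to be measurable.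
\<close>

definition two_step_estimator ::
  "ennreal \<Rightarrow> (real \<times> real) set \<Rightarrow> nat \<Rightarrow> nat \<Rightarrow> 'a measure \<Rightarrow>
   (nat \<Rightarrow> 'a \<Rightarrow> nat \<Rightarrow> real) \<Rightarrow> (nat \<Rightarrow> 'a \<Rightarrow> real) \<Rightarrow>
   ('a \<Rightarrow> real) \<Rightarrow> ('a \<Rightarrow> real) \<Rightarrow> ('a \<Rightarrow> nat \<Rightarrow> real) \<Rightarrow> ('a \<Rightarrow> real) \<Rightarrow> ('a \<Rightarrow> real) \<Rightarrow> bool" where
  "two_step_estimator k \<Omega> p n M X Y a_init b_init d a b \<longleftrightarrow>
     d \<in> measurable M (vec_space p) \<and> a \<in> borel_measurable M \<and> b \<in> borel_measurable M \<and>
     (\<forall>\<omega>\<in>space M. two_step_estimate k \<Omega> p n (\<lambda>i. X i \<omega>) (\<lambda>i. Y i \<omega>)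
        (a_init \<omega>) (b_init \<omega>) (d \<omega>) (a \<omega>) (b \<omega>))"

text \<open>
  The first \<open>n\<close> pairs are i.i.d. copies of \<open>(X, \<xi>)\<close>, where \<open>X\<close> has law \<open>PX\<close>, \<open>\<xi>\<close> has law \<open>P\<xi>\<close>,
  and \<open>X\<close> and \<open>\<xi>\<close> are independent.  The latter is the product form of the joint law, since
  \<^const>\<open>prob_space.indep_var\<close> only relates random variables of the same type.
\<close>

definition iid_sample ::
  "nat \<Rightarrow> nat \<Rightarrow> 'a measure \<Rightarrow> (nat \<Rightarrow> 'a \<Rightarrow> nat \<Rightarrow> real) \<Rightarrow> (nat \<Rightarrow> 'a \<Rightarrow> real) \<Rightarrow>
   (nat \<Rightarrow> real) measure \<Rightarrow> real measure \<Rightarrow> bool" where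
  "iid_sample p n M X \<xi> PX P\<xi> \<longleftrightarrow>
     prob_space M \<and>
     prob_space PX \<and> sets PX = sets (vec_space p) \<and>
     prob_space P\<xi> \<and> sets P\<xi> = sets borel \<and>
     prob_space.indep_vars M (\<lambda>_. vec_space p \<Otimes>\<^sub>M borel) (\<lambda>i \<omega>. (X i \<omega>, \<xi> i \<omega>)) {1..n} \<and>
     (\<forall>i\<in>{1..n}. distr M (vec_space p \<Otimes>\<^sub>M borel) (\<lambda>\<omega>. (X i \<omega>, \<xi> i \<omega>)) = PX \<Otimes>\<^sub>M P\<xi>)"

definition response ::
  "nat \<Rightarrow> real \<Rightarrow> real \<Rightarrow> (nat \<Rightarrow> real) \<Rightarrow> (nat \<Rightarrow> 'a \<Rightarrow> nat \<Rightarrow> real) \<Rightarrow>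
   (nat \<Rightarrow> 'a \<Rightarrow> real) \<Rightarrow> nat \<Rightarrow> 'a \<Rightarrow> real" where
  "response p \<alpha>\<^sub>0 \<beta>\<^sub>0 d\<^sub>0 X \<xi> i \<omega> = step_value \<alpha>\<^sub>0 \<beta>\<^sub>0 (dot p (X i \<omega>) d\<^sub>0) + \<xi> i \<omega>"

definition mismatch_prob ::
  "nat \<Rightarrow> (nat \<Rightarrow> real) measure \<Rightarrow> (nat \<Rightarrow> real) \<Rightarrow> (nat \<Rightarrow> real) \<Rightarrow> real" where
  "mismatch_prob p PX d e = measure PX {x \<in> space PX. csign (dot p x d) \<noteq> csign (dot p x e)}"

definition wedge_condition ::
  "nat \<Rightarrow> (nat \<Rightarrow> real) measure \<Rightarrow> (nat \<Rightarrow> real) \<Rightarrow> real \<Rightarrow> real \<Rightarrow> real \<Rightarrow> real \<Rightarrow> bool" where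
  "wedge_condition p PX d\<^sub>0 \<delta> c C1 C2 \<longleftrightarrow>
     (\<forall>d\<in>unit_sphere p. l2_dist p d d\<^sub>0 \<le> \<delta> \<longrightarrow>
        mismatch_prob p PX d d\<^sub>0 \<ge> c * l2_dist p d d\<^sub>0 \<and>
        measure PX {x \<in> space PX. min (dot p x d) (dot p x d\<^sub>0) \<ge> 0} \<ge> C1 \<and>
        measure PX {x \<in> space PX. max (dot p x d) (dot p x d\<^sub>0) \<le> 0} \<ge> C2)"

definition max_abs_mean :: "nat \<Rightarrow> 'a measure \<Rightarrow> (nat \<Rightarrow> 'a \<Rightarrow> real) \<Rightarrow> real" where
  "max_abs_mean n M \<xi> = (\<integral>\<omega>. (MAX i\<in>{1..n}. \<bar>\<xi> i \<omega>\<bar>) \<partial>M)"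

definition log_rate :: "real \<Rightarrow> real" where
  "log_rate x = x * inverse (ln x)"

text \<open>\<open>Z n = O\<^sub>p(1)\<close>, where \<open>Z n\<close> is a random variable on its own probability space \<open>M n\<close>.\<close>

definition bounded_in_prob :: "(nat \<Rightarrow> 'a measure) \<Rightarrow> (nat \<Rightarrow> 'a \<Rightarrow> real) \<Rightarrow> bool" where
  "bounded_in_prob M Z \<longleftrightarrow>
     (\<forall>\<epsilon>>0. \<exists>K. \<forall>\<^sub>F n in sequentially. measure (M n) {\<omega> \<in> space (M n). \<bar>Z n \<omega>\<bar> > K} \<le> \<epsilon>)"

end

theory Submission
  imports Defs
begin

text \<open>
  Write \<open>score\<close> for a subgradient of the loss and split every loss increment into its linear part and
  a nonnegative Bregman remainder.  Comparing the first-step minimizer with the truth bounds the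
  remainders on the four cells cut out by the true and the estimated hyperplane by sums of scores.
  This gives consistency of the levels, the condition \<open>\<alpha> > \<beta>\<close> excluding the solution with
  exchanged sides.  Comparing it next with the same levels at the true direction leaves only the misclassified
  cells, on which the remainders are of the order of their cardinality; hence their mass is
  of the order \<open>V / n\<close>, where \<open>V\<close> bounds the score sums over misclassified cells.  In the second step
  the linear terms are of the order \<open>\<surd>n + V\<close> and the convex remainder is quadratic.

  All uniform bounds come from one exponential inequality.  Jensen's inequality introduces a ghost sample, the
  supremum over directions becomes a sum over the traces of half-spaces on \<open>2n\<close> points, and
  averaging over exchanges with the ghosts and sign flips of the noise makes each summand at most one.  It remains to
  count traces (Sauer--Shelah).  For the squared loss the noise is cut into dyadic levels: at level \<open>w\<close>
  only about \<open>n / w\<close> points are active, and summing the entropies yields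
  \<open>V = p \<mu> ln (n / (p \<mu>))\<close> with \<open>\<mu>\<close> the mean of the largest noise.
\<close>

section \<open>Traces of half-spaces on finite samples\<close>

text \<open>On a misclassified cell of mass \<open>P\<close> the score sums must be controlled up to
  \<open>s * n * P\<close>, with \<open>s\<close> as small as desired, plus a multiple of
  \<open>V\<close>. An error of order \<open>sqrt n\<close> would cap the rate of the direction at
  \<open>1 / sqrt n\<close>, whereas \<open>s * n * P\<close> is absorbed by the curvature of the
  loss, itself of order \<open>n * P\<close>.

  The absolute loss bends at the origin only. The lower bound on the remainders therefore counts
  points whose small noise is opposite to the shift, which carries them across zero; symmetry makes
  both signs equally frequent.

  Measurability shapes the statements: the bounds hold for uncountably many directions at once, and
  the first-step levels are arbitrary functions. The sum over traces becomes measurable by recasting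
  the existence of a direction as a rational feasibility problem, and later bounds hold for all
  points outside a measurable exceptional set.

  Under the squared loss \<open>n / (p \<mu>)\<close> need not diverge. Where it stays bounded, so
  does the rate as long as the logarithm stays away from zero, and compactness of
  \<open>\<Omega>\<close> settles the claim.\<close>

definition shatters :: "'a set set \<Rightarrow> 'a set \<Rightarrow> bool" where
  "shatters F K \<longleftrightarrow> (\<forall>B. B \<subseteq> K \<longrightarrow> (\<exists>A\<in>F. A \<inter> K = B))"

text \<open>Pajor's form of the Sauer--Shelah lemma. Split \<open>F\<close> by membership of
  \<open>u\<close>. A member counted twice after deleting \<open>u\<close> lies in
  \<open>F0 \<inter> F1\<close>, and if that family shatters \<open>K\<close> then \<open>F\<close>
  shatters both \<open>K\<close> and \<open>Set.insert u K\<close>.\<close>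

lemma card_le_card_shattered:
  assumes "finite U" "F \<subseteq> Pow U"
  shows "card F \<le> card {K\<in>Pow U. shatters F K}"
  using assms
proof (induction U arbitrary: F rule: finite_induct)
  case empty
  then consider "F = {}" | "F = {{}}" by auto
  then show ?case
  proof cases
    case 2
    have "{K \<in> Pow {}. shatters {{}} K} = {{}}" by (auto simp: shatters_def)
    then show ?thesis unfolding 2 by (metis order_refl)
  qed simp
next
  case (insert u U)
  define F0 where "F0 = {A \<in> F. u \<notin> A}"
  define F1 where "F1 = {A - {u} | A. A \<in> F \<and> u \<in> A}"
  have finF: "finite F"
    using insert.prems insert.hyps(1) finite_subset[of F "Pow (Set.insert u U)"] by simp
  have sub: "F0 \<subseteq> Pow U" "F1 \<subseteq> Pow U"
    using insert.prems unfolding F0_def F1_def by auto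
  have fin: "finite F0" "finite F1"
    using finF by (auto simp: F0_def F1_def)
  have F: "F = F0 \<union> {A \<in> F. u \<in> A}" by (auto simp: F0_def)
  have "bij_betw (\<lambda>A. A - {u}) {A \<in> F. u \<in> A} F1"
    unfolding bij_betw_def inj_on_def F1_def by auto
  then have c1: "card {A \<in> F. u \<in> A} = card F1" by (rule bij_betw_same_card)
  have "card F = card F0 + card {A \<in> F. u \<in> A}"
    using finF by (subst F, subst card_Un_disjoint) (auto simp: F0_def)
  also have "\<dots> = card (F0 \<union> F1) + card (F0 \<inter> F1)"
    using c1 card_Un_Int[OF fin] by simp
  also have "\<dots> \<le> card {K\<in>Pow U. shatters (F0 \<union> F1) K} + card {K\<in>Pow U. shatters (F0 \<inter> F1) K}"
    using insert.IH[of "F0 \<union> F1"] insert.IH[of "F0 \<inter> F1"] sub by (intro add_mono) auto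
  also have "card {K\<in>Pow U. shatters (F0 \<inter> F1) K}
      = card (Set.insert u ` {K\<in>Pow U. shatters (F0 \<inter> F1) K})"
    using insert.hyps by (intro card_image[symmetric]) (auto simp: inj_on_def)
  also have "card {K\<in>Pow U. shatters (F0 \<union> F1) K} + \<dots>
      = card ({K\<in>Pow U. shatters (F0 \<union> F1) K} \<union> Set.insert u ` {K\<in>Pow U. shatters (F0 \<inter> F1) K})"
    using insert.hyps by (intro card_Un_disjoint[symmetric]) auto
  also have "\<dots> \<le> card {K\<in>Pow (Set.insert u U). shatters F K}"
  proof (rule card_mono)
    show "finite {K\<in>Pow (Set.insert u U). shatters F K}" using insert.hyps by simp
    have "shatters F K" if K: "K \<subseteq> U" "shatters (F0 \<union> F1) K" for K
      unfolding shatters_def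
    proof (intro allI impI)
      fix B assume "B \<subseteq> K"
      then obtain A where A: "A \<in> F0 \<union> F1" "A \<inter> K = B"
        using K unfolding shatters_def by blast
      from A(1) show "\<exists>A\<in>F. A \<inter> K = B"
      proof
        assume "A \<in> F1"
        then obtain A' where "A' \<in> F" "A = A' - {u}" unfolding F1_def by auto
        then have "A' \<inter> K = B" using A K insert.hyps by auto
        then show ?thesis using \<open>A' \<in> F\<close> by auto
      qed (use A(2) in \<open>auto simp: F0_def\<close>)
    qed
    moreover have "shatters F (Set.insert u K)" if K: "K \<subseteq> U" "shatters (F0 \<inter> F1) K" for K
      unfolding shatters_def
    proof (intro allI impI)
      fix B assume B: "B \<subseteq> Set.insert u K"
      then have "B - {u} \<subseteq> K" by auto
      then obtain A where A: "A \<in> F0" "A \<in> F1" "A \<inter> K = B - {u}"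
        using K unfolding shatters_def by blast
      have uK: "u \<notin> K" using K insert.hyps by auto
      show "\<exists>A\<in>F. A \<inter> Set.insert u K = B"
      proof (cases "u \<in> B")
        case True
        obtain A' where "A' \<in> F" "u \<in> A'" "A = A' - {u}" using A(2) unfolding F1_def by auto
        then have "A' \<inter> Set.insert u K = B" using A True uK by auto
        then show ?thesis using \<open>A' \<in> F\<close> by auto
      next
        case False
        then have "A \<inter> Set.insert u K = B" using A(1,3) by (auto simp: F0_def)
        then show ?thesis using A(1) by (auto simp: F0_def)
      qed
    qed
    ultimately show "{K\<in>Pow U. shatters (F0 \<union> F1) K} \<union> Set.insert u ` {K\<in>Pow U. shatters (F0 \<inter> F1) K}
        \<subseteq> {K\<in>Pow (Set.insert u U). shatters F K}"
      by auto
  qed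
  finally show ?case .
qed

lemma nontrivial_linear_relation:
  fixes x :: "'a \<Rightarrow> nat \<Rightarrow> real"
  assumes "finite I" "card I > p"
  shows "\<exists>w. (\<exists>i\<in>I. w i \<noteq> 0) \<and> (\<forall>j<p. (\<Sum>i\<in>I. w i * x i j) = 0)"
  using assms
proof (induction p arbitrary: I x)
  case 0
  then have "I \<noteq> {}" by auto
  then show ?case by (intro exI[of _ "\<lambda>_. 1"]) auto
next
  case (Suc p)
  show ?case
  proof (cases "\<forall>i\<in>I. x i p = 0")
    case True
    obtain w where "\<exists>i\<in>I. w i \<noteq> 0" "\<forall>j<p. (\<Sum>i\<in>I. w i * x i j) = 0"
      using Suc.IH[of I x] Suc.prems by auto
    with True show ?thesis by (intro exI[of _ w]) (auto simp: less_Suc_eq)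
  next
    case False
    then obtain k where k: "k \<in> I" "x k p \<noteq> 0" by auto
    \<comment> \<open>The pivot \<open>k\<close> eliminates coordinate \<open>p\<close>; its
      coefficient in \<open>w'\<close> is then dictated by that coordinate.\<close>
    define y where "y i j = x i j - x i p / x k p * x k j" for i j
    have "card (I - {k}) > p" using Suc.prems k by auto
    then obtain w where w: "\<exists>i\<in>I-{k}. w i \<noteq> 0" "\<forall>j<p. (\<Sum>i\<in>I-{k}. w i * y i j) = 0"
      using Suc.IH[of "I - {k}" y] Suc.prems by auto
    define w' where "w' i = (if i = k then - (\<Sum>i\<in>I-{k}. w i * x i p) / x k p else w i)" for i
    have sum: "(\<Sum>i\<in>I. w' i * x i j) = (\<Sum>i\<in>I-{k}. w i * y i j)" for j
    proof -
      have "(\<Sum>i\<in>I. w' i * x i j) = w' k * x k j + (\<Sum>i\<in>I-{k}. w i * x i j)"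
        using Suc.prems k by (subst sum.remove[of I k]) (auto simp: w'_def intro!: sum.cong)
      also have "\<dots> = (\<Sum>i\<in>I-{k}. w i * y i j)"
        by (simp add: w'_def y_def right_diff_distrib sum_subtractf sum_distrib_right sum_distrib_left
            sum_divide_distrib mult_ac)
      finally show ?thesis .
    qed
    have "(\<Sum>i\<in>I-{k}. w i * y i p) = 0"
      using k by (intro sum.neutral) (simp add: y_def)
    then have "\<forall>j<Suc p. (\<Sum>i\<in>I. w' i * x i j) = 0"
      using w(2) by (auto simp: sum less_Suc_eq)
    moreover have "\<exists>i\<in>I. w' i \<noteq> 0" using w(1) by (auto simp: w'_def)
    ultimately show ?thesis by blast
  qed
qed

text \<open>The VC dimension of homogeneous half-spaces in dimension \<open>p\<close> is at most \<open>p\<close>.\<close>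

lemma card_shattered_by_halfspaces:
  fixes x :: "'a \<Rightarrow> nat \<Rightarrow> real"
  assumes "finite K" "shatters {{i\<in>U. 0 < dot p (x i) d} | d. True} K" "K \<subseteq> U"
  shows "card K \<le> p"
proof (rule ccontr)
  assume "\<not> card K \<le> p"
  then obtain w where w: "\<exists>i\<in>K. w i \<noteq> 0" "\<forall>j<p. (\<Sum>i\<in>K. w i * x i j) = 0"
    using nontrivial_linear_relation[of K p x] assms(1) by auto
  \<comment> \<open>After a change of sign some coefficient is positive, so the subset to be cut out
    below is nonempty.\<close>
  obtain w where pos: "\<exists>i\<in>K. w i > 0" and rel: "\<forall>j<p. (\<Sum>i\<in>K. w i * x i j) = 0"
  proof (cases "\<exists>i\<in>K. w i > 0")
    case False
    then have "\<exists>i\<in>K. - w i > 0" using w(1) by force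
    moreover have "\<forall>j<p. (\<Sum>i\<in>K. - w i * x i j) = 0" using w(2) by (simp add: sum_negf)
    ultimately show ?thesis by (rule that)
  qed (use w that in blast)
  have "{i\<in>K. w i > 0} \<subseteq> K" by auto
  then obtain d where d: "{i\<in>U. 0 < dot p (x i) d} \<inter> K = {i\<in>K. w i > 0}"
    using assms(2) unfolding shatters_def by blast
  then have iff: "0 < dot p (x i) d \<longleftrightarrow> w i > 0" if "i \<in> K" for i
    using that assms(3) by blast
  \<comment> \<open>Linearity makes this sum vanish, while the choice of \<open>d\<close> makes
    every term nonnegative and one of them positive.\<close>
  have "(\<Sum>i\<in>K. w i * dot p (x i) d) = (\<Sum>i\<in>K. \<Sum>j<p. w i * x i j * d j)"
    by (simp add: dot_def sum_distrib_left mult.assoc)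
  also have "\<dots> = (\<Sum>j<p. (\<Sum>i\<in>K. w i * x i j) * d j)"
    by (subst sum.swap) (simp add: sum_distrib_right)
  also have "\<dots> = 0" using rel by simp
  finally have "(\<Sum>i\<in>K. w i * dot p (x i) d) = 0" .
  moreover have "(\<Sum>i\<in>K. w i * dot p (x i) d) > 0"
  proof -
    obtain k where k: "k \<in> K" "w k > 0" using pos by auto
    show ?thesis
    proof (rule sum_pos2[OF assms(1) k(1)])
      show "0 < w k * dot p (x k) d" using k iff by simp
      show "0 \<le> w i * dot p (x i) d" if "i \<in> K" for i
        using iff[OF that] by (cases "w i > 0") (auto simp: mult_nonpos_nonpos)
    qed
  qed
  ultimately show False by simp
qed

text \<open>Shattered sets have at most \<open>p\<close> points, so each contributes at least
  \<open>r ^ p\<close> to the sum of \<open>r ^ card K\<close> over all subsets, which is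
  \<open>(1 + r) ^ card U\<close>. Keeping \<open>r\<close> free instead of optimizing it leaves a
  product over the points, whose expectation factorizes when the set of active points is
  random.\<close>

lemma card_halfspace_traces:
  fixes x :: "'a \<Rightarrow> nat \<Rightarrow> real" and r :: real
  assumes "finite U" "0 < r" "r \<le> 1"
  shows "real (card {{i\<in>U. 0 < dot p (x i) d} | d. True}) \<le> (1 + r) ^ card U / r ^ p"
proof -
  let ?F = "{{i\<in>U. 0 < dot p (x i) d} | d. True}"
  have "card ?F \<le> card {K\<in>Pow U. shatters ?F K}"
    using assms(1) by (intro card_le_card_shattered) auto
  then have "real (card ?F) \<le> (\<Sum>K\<in>{K\<in>Pow U. shatters ?F K}. 1)" by simp
  also have "\<dots> \<le> (\<Sum>K\<in>{K\<in>Pow U. shatters ?F K}. r ^ card K / r ^ p)"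
  proof (rule sum_mono)
    fix K assume K: "K \<in> {K\<in>Pow U. shatters ?F K}"
    then have "card K \<le> p"
      using card_shattered_by_halfspaces[of K U p x] finite_subset[OF _ assms(1)] by auto
    then have "r ^ p \<le> r ^ card K" using assms by (intro power_decreasing) auto
    then show "1 \<le> r ^ card K / r ^ p" using assms by simp
  qed
  also have "\<dots> \<le> (\<Sum>K\<in>Pow U. r ^ card K / r ^ p)"
    using assms by (intro sum_mono2) auto
  also have "\<dots> = (\<Sum>K\<in>Pow U. (\<Prod>i\<in>K. r) * (\<Prod>i\<in>U-K. 1)) / r ^ p"
    by (simp add: sum_divide_distrib)
  also have "\<dots> = (\<Prod>i\<in>U. r + 1) / r ^ p" using assms(1) by (subst prod_add) auto
  finally show ?thesis by (simp add: add.commute)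
qed

section \<open>Measurability of linear feasibility\<close>

lemma dot_scale: "dot p x (\<lambda>j. t * d j) = t * dot p x d"
  by (simp add: dot_def sum_distrib_left mult_ac)

lemma dot_approx:
  assumes "\<And>j. j < p \<Longrightarrow> \<bar>e j - d j\<bar> \<le> \<eta>"
  shows "\<bar>dot p x e - dot p x d\<bar> \<le> \<eta> * (\<Sum>j<p. \<bar>x j\<bar>)"
proof -
  have "\<bar>dot p x e - dot p x d\<bar> = \<bar>\<Sum>j<p. x j * (e j - d j)\<bar>"
    by (simp add: dot_def sum_subtractf right_diff_distrib)
  also have "\<dots> \<le> (\<Sum>j<p. \<bar>x j * (e j - d j)\<bar>)" by (rule sum_abs)
  also have "\<dots> \<le> (\<Sum>j<p. \<eta> * \<bar>x j\<bar>)"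
    using assms by (intro sum_mono) (simp add: abs_mult mult.commute[of "\<bar>x _\<bar>"] mult_right_mono)
  finally show ?thesis by (simp add: sum_distrib_left)
qed

text \<open>Feasibility of a homogeneous system of linear inequalities, rewritten with countable
  quantifiers only: scaling makes the strict inequalities uniform, and compactness of a box
  recovers an exact solution from approximate rational ones.\<close>

lemma feasible_iff_rational:
  fixes y :: "'i \<Rightarrow> nat \<Rightarrow> real"
  assumes fin: "finite K" "finite L"
  shows "(\<exists>d. (\<forall>i\<in>K. 0 < dot p (y i) d) \<and> (\<forall>i\<in>L. dot p (y i) d \<le> 0)) \<longleftrightarrow>
    (\<exists>R::nat. \<forall>m::nat. \<exists>d\<in>PiE {..<p} (\<lambda>_. \<rat>). (\<forall>j<p. \<bar>d j\<bar> \<le> real R) \<and>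
       (\<forall>i\<in>K. 1 - 1 / Suc m < dot p (y i) d) \<and> (\<forall>i\<in>L. dot p (y i) d < 1 / Suc m))"
    (is "?lhs \<longleftrightarrow> ?rhs")
proof
  assume ?lhs
  then obtain d0 where d0: "\<forall>i\<in>K. 0 < dot p (y i) d0" "\<forall>i\<in>L. dot p (y i) d0 \<le> 0" by blast
  obtain e where e: "e > 0" "\<forall>i\<in>K. e \<le> dot p (y i) d0"
  proof (cases "K = {}")
    case False
    then have "Min ((\<lambda>i. dot p (y i) d0) ` K) > 0" using fin d0 by (subst Min_gr_iff) auto
    then show ?thesis using fin by (intro that[of "Min ((\<lambda>i. dot p (y i) d0) ` K)"]) auto
  qed (rule that[of 1], auto)
  \<comment> \<open>Homogeneity: dividing by the positive lower bound \<open>e\<close> makes the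
    strict inequalities hold with value at least one.\<close>
  define d where "d j = 1 / e * d0 j" for j
  have dot_d: "dot p x d = dot p x d0 / e" for x
    unfolding d_def using dot_scale[of p x "1 / e" d0] by simp
  have d: "\<forall>i\<in>K. 1 \<le> dot p (y i) d" "\<forall>i\<in>L. dot p (y i) d \<le> 0"
    using d0 e by (auto simp: dot_d divide_nonpos_pos)
  define R where "R = nat \<lceil>(\<Sum>j<p. \<bar>d j\<bar>) + 1\<rceil>"
  have R: "\<bar>d j\<bar> + 1 \<le> R" if "j < p" for j
  proof -
    have "\<bar>d j\<bar> \<le> (\<Sum>j<p. \<bar>d j\<bar>)" using that by (intro member_le_sum) auto
    then show ?thesis unfolding R_def by linarith
  qed
  show ?rhs
  proof (intro exI[of _ R] allI)
    fix m :: nat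
    define S where "S = (\<Sum>i\<in>K\<union>L. \<Sum>j<p. \<bar>y i j\<bar>) + 1"
    have S: "S \<ge> 1" by (simp add: S_def sum_nonneg)
    \<comment> \<open>\<open>S\<close> exceeds the sum of the absolute coordinates of every vector
      involved, so moving each coordinate of \<open>d\<close> by \<open>\<eta>\<close> changes every
      value by less than \<open>1 / Suc m\<close>. The bound \<open>\<eta> \<le> 1\<close> is what
      the extra one in \<open>R\<close> pays for.\<close>
    define \<eta> where "\<eta> = 1 / (Suc m * (S + 1))"
    have "1 * 1 \<le> real (Suc m) * (S + 1)" using S by (intro mult_mono) auto
    then have \<eta>: "0 < \<eta>" "\<eta> \<le> 1" using S by (auto simp: \<eta>_def divide_le_eq)
    have "\<exists>q\<in>\<rat>. \<bar>q - d j\<bar> \<le> \<eta>" for j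
    proof -
      obtain q where "q \<in> \<rat>" "d j - \<eta> < q" "q < d j + \<eta>"
        using \<eta> Rats_dense_in_real[of "d j - \<eta>" "d j + \<eta>"] by auto
      then show ?thesis by (intro bexI[of _ q]) auto
    qed
    then obtain q where q: "\<And>j. q j \<in> \<rat>" "\<And>j. \<bar>q j - d j\<bar> \<le> \<eta>"
      by metis
    have close: "\<bar>dot p (y i) q - dot p (y i) d\<bar> < 1 / Suc m" if "i \<in> K \<union> L" for i
    proof -
      have "(\<Sum>j<p. \<bar>y i j\<bar>) \<le> (\<Sum>i\<in>K\<union>L. \<Sum>j<p. \<bar>y i j\<bar>)"
        using that fin by (intro member_le_sum) (auto intro: sum_nonneg)
      then have "\<eta> * (\<Sum>j<p. \<bar>y i j\<bar>) \<le> \<eta> * S" using \<eta> unfolding S_def by (intro mult_left_mono) auto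
      also have "\<dots> < \<eta> * (S + 1)" using \<eta> by simp
      also have "\<dots> = 1 / Suc m" using S by (simp add: \<eta>_def del: of_nat_Suc)
      finally show ?thesis using dot_approx[of p q d \<eta> "y i"] q by simp
    qed
    define q' where "q' = restrict q {..<p}"
    have "dot p x q' = dot p x q" for x by (simp add: dot_def q'_def)
    then have close': "\<bar>dot p (y i) q' - dot p (y i) d\<bar> < 1 / Suc m" if "i \<in> K \<union> L" for i
      using close[OF that] by simp
    show "\<exists>d\<in>PiE {..<p} (\<lambda>_. \<rat>). (\<forall>j<p. \<bar>d j\<bar> \<le> real R) \<and>
       (\<forall>i\<in>K. 1 - 1 / Suc m < dot p (y i) d) \<and> (\<forall>i\<in>L. dot p (y i) d < 1 / Suc m)"
    proof (intro bexI[of _ q'] conjI allI impI ballI)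
      show "q' \<in> PiE {..<p} (\<lambda>_. \<rat>)" using q by (auto simp: q'_def)
      fix j assume "j < p"
      then show "\<bar>q' j\<bar> \<le> R" using R[of j] q(2)[of j] \<eta>(2) by (simp add: q'_def)
    next
      fix i assume "i \<in> K"
      then show "1 - 1 / Suc m < dot p (y i) q'" using close'[of i] d(1) by fastforce
    next
      fix i assume "i \<in> L"
      then show "dot p (y i) q' < 1 / Suc m" using close'[of i] d(2) by fastforce
    qed
  qed
next
  assume ?rhs
  then obtain R :: nat and d where d: "\<And>m j. j < p \<Longrightarrow> \<bar>d m j\<bar> \<le> real R"
    "\<And>m i. i \<in> K \<Longrightarrow> 1 - 1 / Suc m < dot p (y i) (d m)"
    "\<And>m i. i \<in> L \<Longrightarrow> dot p (y i) (d m) < 1 / Suc m"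
    by metis
  \<comment> \<open>Setting the coordinates from \<open>p\<close> on to zero puts the sequence into
    a product of compact intervals, from which a convergent subsequence is taken.\<close>
  define e where "e m j = (if j < p then d m j else 0)" for m j
  have dot_e: "dot p x (e m) = dot p x (d m)" for x m by (simp add: dot_def e_def)
  define C :: "(nat \<Rightarrow> real) set" where "C = PiE UNIV (\<lambda>_. {-real R..real R})"
  have "compactin (product_topology (\<lambda>_. euclidean) UNIV) C"
    unfolding C_def by (subst compactin_PiE) auto
  then have "compact C" by (simp add: euclidean_product_topology flip: compactin_euclidean_iff)
  moreover have "e m \<in> C" for m
    using d(1)[of _ m] by (auto simp: C_def e_def abs_le_iff minus_le_iff)
  ultimately obtain l s where s: "strict_mono s" "(e \<circ> s) \<longlonglongrightarrow> l"
    using compact_imp_seq_compact[of C] unfolding seq_compact_def by metis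
  have "(\<lambda>m. e (s m) j) \<longlonglongrightarrow> l j" for j
    using continuous_on_tendsto_compose[OF continuous_on_product_coordinates[of j] s(2)]
    by (simp add: o_def)
  then have lim: "(\<lambda>m. dot p x (e (s m))) \<longlonglongrightarrow> dot p x l" for x
    unfolding dot_def by (intro tendsto_intros)
  have inv: "(\<lambda>m. 1 / real (Suc (s m))) \<longlonglongrightarrow> 0"
    using LIMSEQ_subseq_LIMSEQ[OF LIMSEQ_inverse_real_of_nat s(1)]
    by (simp add: o_def inverse_eq_divide)
  show ?lhs
  proof (intro exI[of _ l] conjI ballI)
    fix i assume "i \<in> K"
    have "1 - 0 \<le> dot p (y i) l"
      using d(2)[OF \<open>i \<in> K\<close>]
      by (intro tendsto_le[OF _ lim tendsto_diff[OF tendsto_const inv]]) (auto simp: dot_e less_imp_le)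
    then show "0 < dot p (y i) l" by simp
  next
    fix i assume "i \<in> L"
    show "dot p (y i) l \<le> 0"
      using d(3)[OF \<open>i \<in> L\<close>]
      by (intro tendsto_le[OF _ inv lim]) (auto simp: dot_e less_imp_le)
  qed
qed

text \<open>The quantifier over real directions is uncountable. The rational form leaves countable
  unions and intersections of events about finitely many linear forms.\<close>

lemma measurable_feasible:
  fixes x :: "'i \<Rightarrow> 'w \<Rightarrow> nat \<Rightarrow> real"
  assumes fin: "finite K" "finite L"
    and meas: "\<And>i d. i \<in> K \<union> L \<Longrightarrow> (\<lambda>w. dot p (x i w) d) \<in> borel_measurable W"
  shows "{w\<in>space W. \<exists>d. (\<forall>i\<in>K. 0 < dot p (x i w) d) \<and> (\<forall>i\<in>L. dot p (x i w) d \<le> 0)} \<in> sets W"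
proof -
  have cnt: "countable (PiE {..<p} (\<lambda>_. \<rat> :: real set))"
    by (intro countable_PiE) (auto simp: countable_rat)
  have *: "{w\<in>space W. c < dot p (x i w) d} \<in> sets W" "{w\<in>space W. dot p (x i w) d < c} \<in> sets W"
    if "i \<in> K \<union> L" for c d i
    using meas[OF that, of d] by measurable
  have Bex: "{w\<in>space W. \<exists>d\<in>PiE {..<p} (\<lambda>_. \<rat> :: real set). P d w} \<in> sets W"
    if "\<And>d. {w\<in>space W. P d w} \<in> sets W" for P
  proof -
    have "{w\<in>space W. \<exists>d\<in>PiE {..<p} (\<lambda>_. \<rat> :: real set). P d w}
        = (\<Union>d\<in>PiE {..<p} (\<lambda>_. \<rat>). {w\<in>space W. P d w})" by auto
    also have "\<dots> \<in> sets W" using that cnt by (intro sets.countable_UN'') auto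
    finally show ?thesis .
  qed
  show ?thesis
    unfolding feasible_iff_rational[OF fin]
    using fin by (intro sets.sets_Collect_countable_Ex sets.sets_Collect_countable_All
        Bex sets.sets_Collect_conj sets.sets_Collect_const
        sets.sets_Collect_finite_All *) auto
qed

section \<open>Uniform exponential tails by ghost samples and noise flips\<close>

lemma (in prob_space) distr_PiM_componentwise:
  assumes fin: "finite I" and T [measurable]: "\<And>i. i \<in> I \<Longrightarrow> T i \<in> measurable M M"
    and pres: "\<And>i. i \<in> I \<Longrightarrow> distr M M (T i) = M"
  shows "distr (PiM I (\<lambda>_. M)) (PiM I (\<lambda>_. M)) (\<lambda>z. \<lambda>i\<in>I. T i (z i)) = PiM I (\<lambda>_. M)"
proof -
  interpret product_prob_space "\<lambda>_. M" I by unfold_locales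
  have [measurable]: "(\<lambda>z. \<lambda>i\<in>I. T i (z i)) \<in> measurable (PiM I (\<lambda>_. M)) (PiM I (\<lambda>_. M))"
    by (intro measurable_restrict) measurable
  show ?thesis
  proof (rule PiM_eqI[OF fin])
    fix A assume A: "\<And>i. i \<in> I \<Longrightarrow> A i \<in> sets M"
    have "(\<lambda>z. \<lambda>i\<in>I. T i (z i)) -` (PiE I A) \<inter> space (PiM I (\<lambda>_. M)) =
       PiE I (\<lambda>i. T i -` A i \<inter> space M)"
      by (auto simp: space_PiM PiE_iff)
    then have "emeasure (distr (PiM I (\<lambda>_. M)) (PiM I (\<lambda>_. M)) (\<lambda>z. \<lambda>i\<in>I. T i (z i))) (PiE I A)
       = emeasure (PiM I (\<lambda>_. M)) (PiE I (\<lambda>i. T i -` A i \<inter> space M))"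
      using A fin by (subst emeasure_distr) (auto intro!: sets_PiM_I_finite)
    also have "\<dots> = (\<Prod>i\<in>I. emeasure M (T i -` A i \<inter> space M))"
      using A fin T by (subst emeasure_PiM) (auto intro: measurable_sets)
    also have "\<dots> = (\<Prod>i\<in>I. emeasure (distr M M (T i)) (A i))"
      using A T by (intro prod.cong) (auto simp: emeasure_distr)
    finally show "emeasure (distr (PiM I (\<lambda>_. M)) (PiM I (\<lambda>_. M)) (\<lambda>z. \<lambda>i\<in>I. T i (z i))) (PiE I A)
        = (\<Prod>i\<in>I. emeasure M (A i))"
      using pres by simp
  qed simp
qed

locale design_noise =
  fixes p :: nat and PX :: "(nat \<Rightarrow> real) measure" and P\<xi> :: "real measure"
  assumes PX: "prob_space PX" "sets PX = sets (vec_space p)"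
    and P\<xi>: "prob_space P\<xi>" "sets P\<xi> = sets borel"
    and symmetric: "distr P\<xi> borel uminus = P\<xi>"
begin

sublocale PX: prob_space PX by (rule PX)
sublocale P\<xi>: prob_space P\<xi> by (rule P\<xi>)

abbreviation Q :: "((nat \<Rightarrow> real) \<times> real) measure" where
  "Q \<equiv> PX \<Otimes>\<^sub>M P\<xi>"

sublocale pair_prob_space PX P\<xi> ..

lemma sets_Q [measurable_cong]: "sets Q = sets (vec_space p \<Otimes>\<^sub>M borel)"
  using PX(2) P\<xi>(2) by (rule sets_pair_measure_cong)

lemma space_PX: "space PX = space (vec_space p)"
  using PX(2) by (rule sets_eq_imp_space_eq)

lemma space_P\<xi>: "space P\<xi> = UNIV"
  using P\<xi>(2) by (simp add: sets_eq_imp_space_eq)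

lemma measurable_dot: "(\<lambda>x. dot p x d) \<in> borel_measurable (vec_space p)"
  unfolding dot_def by measurable

lemma measurable_flip: "(\<lambda>(x, y). (x, if b then - y else y)) \<in> measurable Q Q"
proof -
  have *: "measurable Q Q = measurable (vec_space p \<Otimes>\<^sub>M borel) (vec_space p \<Otimes>\<^sub>M borel)"
    by (rule measurable_cong_sets) (rule sets_Q)+
  show ?thesis unfolding * by (cases b) simp_all
qed

lemma distr_flip: "distr Q Q (\<lambda>(x, y). (x, if b then - y else y)) = Q"
proof (cases b)
  case True
  have "uminus \<in> measurable P\<xi> P\<xi>"
    by (subst measurable_cong_sets[OF P\<xi>(2) P\<xi>(2)]) simp
  moreover have [simp]: "distr P\<xi> P\<xi> uminus = P\<xi>"
    using symmetric distr_cong[OF refl P\<xi>(2), of P\<xi> uminus uminus] by simp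
  have "distr PX PX (\<lambda>x. x) = PX" by (rule distr_id2) simp
  ultimately have "Q = distr Q Q (\<lambda>(x, y). (x, - y))"
    using pair_measure_distr[of "\<lambda>x. x" PX PX uminus P\<xi> P\<xi>] P\<xi>.prob_space_axioms
    by (simp add: P\<xi>.sigma_finite_measure_axioms)
  then show ?thesis using True by simp
qed (simp add: id_def)

end

declare One_nat_def [simp del]

text \<open>\<open>B\<close> is the noise level under study, \<open>v\<close> the weight of an
  observed point in a cell and \<open>a\<close> that of a ghost. \<open>balance\<close> is half the
  sum over the four moves of a pair with exactly one member in the trace: that member is twice the
  ghost and twice the observation, once with each sign of its noise. A positive \<open>a\<close>
  yields lower bounds on counts, a negative one upper bounds.\<close>

locale ghost_sample = design_noise +
  fixes n :: nat and A0 :: "(nat \<Rightarrow> real) set" and side :: bool and B :: "real set"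
    and v :: "real \<Rightarrow> real" and a :: real
  assumes A0 [measurable]: "A0 \<in> sets (vec_space p)"
    and B [measurable]: "B \<in> sets borel" and B_sym: "\<And>y. - y \<in> B \<longleftrightarrow> y \<in> B"
    and v [measurable]: "v \<in> borel_measurable borel"
    and balance: "\<And>y. y \<in> B \<Longrightarrow> exp a + (exp (v y) + exp (v (- y))) / 2 \<le> 2"
begin

abbreviation "U \<equiv> {1..2 * n}"

definition C :: "(nat \<Rightarrow> real) \<Rightarrow> ((nat \<Rightarrow> real) \<times> real) set" where
  "C d = {w. snd w \<in> B \<and> fst w \<in> A0 \<and> (0 < dot p (fst w) d) = side}"

definition trace :: "(nat \<Rightarrow> (nat \<Rightarrow> real) \<times> real) \<Rightarrow> (nat \<Rightarrow> real) \<Rightarrow> nat set" where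
  "trace z d = {i\<in>U. z i \<in> C d}"

definition W :: "(nat \<Rightarrow> (nat \<Rightarrow> real) \<times> real) \<Rightarrow> nat set \<Rightarrow> real" where
  "W z A = (\<Prod>i\<in>{1..n}. (if i \<in> A then exp (v (snd (z i))) else 1) * (if i + n \<in> A then exp a else 1))"

text \<open>Summing over the distinct traces instead of the directions is the union bound: the sum
  is finite and dominates the weight of any single direction.\<close>

definition \<Phi> :: "(nat \<Rightarrow> (nat \<Rightarrow> real) \<times> real) \<Rightarrow> real" where
  "\<Phi> z = (\<Sum>A\<in>range (trace z). W z A)"

text \<open>A move swaps observation \<open>i\<close> with its ghost \<open>i + n\<close> and flips the sign of the noise which
  then sits in position \<open>i\<close>.\<close>

definition src :: "(nat \<Rightarrow> bool \<times> bool) \<Rightarrow> nat \<Rightarrow> nat" where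
  "src g i = (if i \<in> {1..n} then if fst (g i) then i + n else i
     else if i \<in> {n<..2 * n} then if fst (g (i - n)) then i - n else i else i)"

definition move :: "(nat \<Rightarrow> bool \<times> bool) \<Rightarrow> (nat \<Rightarrow> (nat \<Rightarrow> real) \<times> real) \<Rightarrow> (nat \<Rightarrow> (nat \<Rightarrow> real) \<times> real)" where
  "move g z = (\<lambda>i\<in>U. (\<lambda>(x, y). (x, if i \<le> n \<and> snd (g i) then - y else y)) (z (src g i)))"

lemma trace_subset: "trace z d \<subseteq> U"
  by (auto simp: trace_def)

lemma finite_range_trace [simp]: "finite (range (trace z))"
  by (rule finite_subset[of _ "Pow U"]) (auto simp: trace_def)

lemma W_nonneg: "0 \<le> W z A"
  unfolding W_def by (intro prod_nonneg) auto

lemma \<Phi>_nonneg: "0 \<le> \<Phi> z"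
  unfolding \<Phi>_def by (intro sum_nonneg W_nonneg)

lemma src_in: "i \<in> U \<Longrightarrow> src g i \<in> U"
  by (auto simp: src_def)

lemma src_src: "src g (src g i) = i"
  by (auto simp: src_def)

text \<open>\<open>C d\<close> depends on the noise only through the symmetric set \<open>B\<close>,
  so a sign flip leaves the trace alone and only the exchange acts on it.\<close>

lemma trace_move: "trace (move g z) d = {i\<in>U. src g i \<in> trace z d}"
proof -
  have "move g z i \<in> C d \<longleftrightarrow> z (src g i) \<in> C d" if "i \<in> U" for i
    using that by (cases "z (src g i)") (simp add: move_def C_def B_sym)
  then show ?thesis using src_in unfolding trace_def by blast
qed

lemma sum_bool_pairs: "(\<Sum>b\<in>UNIV. F b) = F (False, False) + F (False, True) + F (True, False) + (F (True, True) :: real)"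
  by (simp add: UNIV_Times_UNIV[symmetric] UNIV_bool sum.cartesian_product[symmetric] del: UNIV_Times_UNIV)

text \<open>With the trace fixed the weight is a product over the pairs \<open>i\<close>,
  \<open>i + n\<close>, and so is the sum over all moves. It remains to see that one pair
  contributes at most \<open>4\<close>, the number of its moves.\<close>

lemma sum_W_move:
  assumes A: "A \<in> range (trace z)"
  shows "(\<Sum>g\<in>PiE {1..n} (\<lambda>_. UNIV). W (move g z) {i\<in>U. src g i \<in> A}) \<le> 4 ^ n"
proof -
  define f where "f i = (\<lambda>(s, b). (if (if s then i + n else i) \<in> A
        then exp (v (if b then - snd (z (if s then i + n else i)) else snd (z (if s then i + n else i)))) else 1) *
      (if (if s then i else i + n) \<in> A then exp a else (1::real)))" for i
  have "W (move g z) {i\<in>U. src g i \<in> A} = (\<Prod>i\<in>{1..n}. f i (g i))" for g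
    unfolding W_def
  proof (rule prod.cong[OF refl])
    fix i assume i: "i \<in> {1..n}"
    obtain s b where g: "g i = (s, b)" by fastforce
    show "(if i \<in> {i \<in> U. src g i \<in> A} then exp (v (snd (move g z i))) else 1) *
        (if i + n \<in> {i \<in> U. src g i \<in> A} then exp a else 1) = f i (g i)"
      using i g by (auto simp: f_def src_def move_def split: prod.splits)
  qed
  then have "(\<Sum>g\<in>PiE {1..n} (\<lambda>_. UNIV). W (move g z) {i\<in>U. src g i \<in> A})
      = (\<Sum>g\<in>PiE {1..n} (\<lambda>_. UNIV). \<Prod>i\<in>{1..n}. f i (g i))" by simp
  also have "\<dots> = (\<Prod>i\<in>{1..n}. \<Sum>b\<in>UNIV. f i b)"
    by (subst prod_sum_PiE) auto
  also have "\<dots> \<le> (\<Prod>i\<in>{1..n}. 4)"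
  proof (intro prod_mono conjI)
    fix i assume i: "i \<in> {1..n}"
    show "0 \<le> (\<Sum>b\<in>UNIV. f i b)" by (intro sum_nonneg) (auto simp: f_def)
    define E where "E y = exp (v y) + exp (v (- y))" for y
    have E: "E (snd (z j)) \<le> 4 - 2 * exp a" if "j \<in> A" for j
    proof -
      have "snd (z j) \<in> B" using A that by (auto simp: trace_def C_def)
      from balance[OF this] show ?thesis unfolding E_def by (simp add: field_simps)
    qed
    \<comment> \<open>With both members active, \<open>exp a\<close> is a common factor and
      \<open>balance\<close> leaves \<open>4 - 4 * (exp a - 1)\<^sup>2\<close>, at most
      \<open>4\<close> whatever the sign of \<open>a\<close>.\<close>
    have both: "exp a * (E (snd (z i)) + E (snd (z (i + n)))) \<le> 4" if "i \<in> A" "i + n \<in> A"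
    proof -
      have "exp a * (E (snd (z i)) + E (snd (z (i + n)))) \<le> exp a * (8 - 4 * exp a)"
        using E[OF that(1)] E[OF that(2)] by (intro mult_left_mono) auto
      also have "\<dots> = 4 - 4 * (exp a - 1)\<^sup>2" by (simp add: power2_eq_square algebra_simps)
      finally show ?thesis by (smt (verit) zero_le_power2)
    qed
    show "(\<Sum>b\<in>UNIV. f i b) \<le> 4"
      using E[of i] E[of "i + n"] both
      by (cases "i \<in> A"; cases "i + n \<in> A")
         (simp_all add: sum_bool_pairs f_def E_def algebra_simps)
  qed
  finally show ?thesis by simp
qed

lemma sum_\<Phi>_move: "(\<Sum>g\<in>PiE {1..n} (\<lambda>_. UNIV). \<Phi> (move g z)) \<le> 4 ^ n * real (card (range (trace z)))"
proof -
  have "\<Phi> (move g z) \<le> (\<Sum>A\<in>range (trace z). W (move g z) {i\<in>U. src g i \<in> A})" for g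
  proof -
    have "range (trace (move g z)) = (\<lambda>A. {i\<in>U. src g i \<in> A}) ` range (trace z)"
      by (auto simp: trace_move image_image)
    then show ?thesis unfolding \<Phi>_def by (simp only:) (rule sum_image_le[unfolded o_def], auto intro: W_nonneg)
  qed
  then have "(\<Sum>g\<in>PiE {1..n} (\<lambda>_. UNIV). \<Phi> (move g z))
      \<le> (\<Sum>g\<in>PiE {1..n} (\<lambda>_. UNIV). \<Sum>A\<in>range (trace z). W (move g z) {i\<in>U. src g i \<in> A})"
    by (intro sum_mono)
  also have "\<dots> = (\<Sum>A\<in>range (trace z). \<Sum>g\<in>PiE {1..n} (\<lambda>_. UNIV). W (move g z) {i\<in>U. src g i \<in> A})"
    by (rule sum.swap)
  also have "\<dots> \<le> (\<Sum>A\<in>range (trace z). 4 ^ n)" by (intro sum_mono sum_W_move)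
  finally show ?thesis by (simp add: mult.commute)
qed

text \<open>A point with noise outside \<open>B\<close> lies in no trace, so only active points are
  counted. They are on average at most a fraction \<open>measure P\<xi> B\<close> of all points, the
  source of the smaller entropy at rare noise levels. For the nonpositive side the traces are
  complements within the active set.\<close>

lemma card_traces:
  assumes "0 < r" "r \<le> 1"
  shows "real (card (range (trace z))) \<le> (\<Prod>i\<in>U. 1 + r * indicator B (snd (z i))) / r ^ p"
proof -
  define Act where "Act = {i\<in>U. snd (z i) \<in> B \<and> fst (z i) \<in> A0}"
  let ?H = "{{i\<in>Act. 0 < dot p (fst (z i)) d} | d. True}"
  have "trace z d = (if side then {i\<in>Act. 0 < dot p (fst (z i)) d} else Act - {i\<in>Act. 0 < dot p (fst (z i)) d})" for d
    by (auto simp: trace_def C_def Act_def)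
  then have "range (trace z) = (\<lambda>T. if side then T else Act - T) ` ?H" by auto
  moreover have "finite ?H" by (rule finite_subset[of _ "Pow Act"]) (auto simp: Act_def)
  ultimately have "real (card (range (trace z))) \<le> card ?H" by (simp add: card_image_le)
  also have "\<dots> \<le> (1 + r) ^ card Act / r ^ p"
    using assms by (intro card_halfspace_traces) (auto simp: Act_def)
  also have "\<dots> \<le> (1 + r) ^ card {i\<in>U. snd (z i) \<in> B} / r ^ p"
    using assms by (intro divide_right_mono power_increasing card_mono) (auto simp: Act_def)
  also have "(1 + r) ^ card {i\<in>U. snd (z i) \<in> B} = (\<Prod>i\<in>{i\<in>U. snd (z i) \<in> B}. 1 + r)" by simp
  also have "\<dots> = (\<Prod>i\<in>U. 1 + r * indicator B (snd (z i)))"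
    by (intro prod.mono_neutral_cong_left) auto
  finally show ?thesis .
qed

lemma measurable_coord: "i \<in> I \<Longrightarrow> (\<lambda>z. z i) \<in> measurable (PiM I (\<lambda>_. Q)) (vec_space p \<Otimes>\<^sub>M borel)"
  by measurable

text \<open>Once the set \<open>V\<close> of active points is fixed, realizing \<open>A\<close> is a
  feasibility problem with fixed index sets, and there are finitely many \<open>V\<close>.\<close>

lemma measurable_trace_realized:
  assumes "A \<subseteq> U"
  shows "{z\<in>space (PiM U (\<lambda>_. Q)). A \<in> range (trace z)} \<in> sets (PiM U (\<lambda>_. Q))"
proof -
  let ?N = "PiM U (\<lambda>_. Q)"
  define act where "act z = {i\<in>U. snd (z i) \<in> B \<and> fst (z i) \<in> A0}" for z :: "nat \<Rightarrow> (nat \<Rightarrow> real) \<times> real"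
  define K where "K V = (if side then A else V - A)" for V
  define L where "L V = (if side then V - A else A)" for V
  have "A \<in> range (trace z) \<longleftrightarrow>
     (\<exists>V\<in>Pow U. act z = V \<and> A \<subseteq> V \<and> (\<exists>d. (\<forall>i\<in>K V. 0 < dot p (fst (z i)) d) \<and> (\<forall>i\<in>L V. dot p (fst (z i)) d \<le> 0)))" for z
  proof -
    have tr: "trace z d = {i\<in>act z. (0 < dot p (fst (z i)) d) = side}" for d
      by (auto simp: trace_def act_def C_def)
    have "A = trace z d \<longleftrightarrow> A \<subseteq> act z \<and> (\<forall>i\<in>K (act z). 0 < dot p (fst (z i)) d) \<and> (\<forall>i\<in>L (act z). dot p (fst (z i)) d \<le> 0)" for d
      unfolding tr K_def L_def by (cases side) (auto simp: not_less[symmetric])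
    then show ?thesis by (auto simp: image_iff act_def)
  qed
  then have "{z\<in>space ?N. A \<in> range (trace z)} = (\<Union>V\<in>Pow U. {z\<in>space ?N. act z = V} \<inter> {z\<in>space ?N. A \<subseteq> V} \<inter>
     {z\<in>space ?N. \<exists>d. (\<forall>i\<in>K V. 0 < dot p (fst (z i)) d) \<and> (\<forall>i\<in>L V. dot p (fst (z i)) d \<le> 0)})"
    by auto
  also have "\<dots> \<in> sets ?N"
  proof (intro sets.finite_UN sets.Int)
    fix V assume V: "V \<in> Pow U"
    have "act z = V \<longleftrightarrow> (\<forall>i\<in>U. (snd (z i) \<in> B \<and> fst (z i) \<in> A0) = (i \<in> V))" for z
      using V by (auto simp: act_def)
    moreover have "{z\<in>space ?N. \<forall>i\<in>U. (snd (z i) \<in> B \<and> fst (z i) \<in> A0) = (i \<in> V)} \<in> sets ?N"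
    proof (intro sets.sets_Collect_finite_All)
      fix i assume i: "i \<in> U"
      note measurable_coord[OF i, measurable]
      show "{z\<in>space ?N. (snd (z i) \<in> B \<and> fst (z i) \<in> A0) = (i \<in> V)} \<in> sets ?N" by measurable
    qed simp
    ultimately show "{z\<in>space ?N. act z = V} \<in> sets ?N" by simp
    show "{z\<in>space ?N. \<exists>d. (\<forall>i\<in>K V. 0 < dot p (fst (z i)) d) \<and> (\<forall>i\<in>L V. dot p (fst (z i)) d \<le> 0)} \<in> sets ?N"
    proof (rule measurable_feasible)
      have "K V \<subseteq> U" "L V \<subseteq> U" using V assms by (auto simp: K_def L_def)
      then show "finite (K V)" "finite (L V)" by (auto intro: finite_subset)
      fix i d assume "i \<in> K V \<union> L V"
      then have i: "i \<in> U" using \<open>K V \<subseteq> U\<close> \<open>L V \<subseteq> U\<close> by auto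
      note measurable_coord[OF i, measurable] measurable_dot[measurable]
      show "(\<lambda>z. dot p (fst (z i)) d) \<in> borel_measurable ?N" by measurable
    qed
    show "{z\<in>space ?N. A \<subseteq> V} \<in> sets ?N" by simp
  qed simp
  finally show ?thesis .
qed

lemma \<Phi>_eq: "\<Phi> z = (\<Sum>A\<in>Pow U. if A \<in> range (trace z) then W z A else 0)"
proof -
  have "range (trace z) \<subseteq> Pow U" using trace_subset by auto
  then show ?thesis unfolding \<Phi>_def by (intro sum.mono_neutral_cong_left) auto
qed

lemma measurable_\<Phi> [measurable]: "\<Phi> \<in> borel_measurable (PiM U (\<lambda>_. Q))"
proof -
  let ?N = "PiM U (\<lambda>_. Q)"
  have [measurable]: "Measurable.pred ?N (\<lambda>z. A \<in> range (trace z))" if "A \<subseteq> U" for A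
    using measurable_trace_realized[OF that] by (simp add: pred_def)
  have "(\<lambda>z. W z A) \<in> borel_measurable ?N" for A
    unfolding W_def
  proof (intro borel_measurable_prod borel_measurable_times)
    fix i assume "i \<in> {1..n}"
    then have i: "i \<in> U" by auto
    note measurable_coord[OF i, measurable]
    show "(\<lambda>z. if i \<in> A then exp (v (snd (z i))) else 1) \<in> borel_measurable ?N"
      by measurable
  qed simp
  then show ?thesis unfolding \<Phi>_eq[abs_def]
    by (intro borel_measurable_sum measurable_If measurable_trace_realized) auto
qed

lemma measurable_move: "move g \<in> measurable (PiM U (\<lambda>_. Q)) (PiM U (\<lambda>_. Q))"
  unfolding move_def
  by (intro measurable_restrict measurable_compose[OF _ measurable_flip] measurable_component_singleton src_in)

lemma distr_move: "distr (PiM U (\<lambda>_. Q)) (PiM U (\<lambda>_. Q)) (move g) = PiM U (\<lambda>_. Q)"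
proof -
  let ?N = "PiM U (\<lambda>_. Q)"
  have inj: "inj_on (src g) U" by (rule inj_on_inverseI[of _ "src g"]) (rule src_src)
  have 1: "distr ?N ?N (\<lambda>z. \<lambda>i\<in>U. z (src g i)) = ?N"
    by (rule distr_PiM_reindex[OF _ inj]) (use src_in in \<open>auto intro: prob_space_axioms\<close>)
  have 2: "distr ?N ?N (\<lambda>z. \<lambda>i\<in>U. (\<lambda>(x, y). (x, if i \<le> n \<and> snd (g i) then - y else y)) (z i)) = ?N"
    by (rule distr_PiM_componentwise) (auto intro: measurable_flip distr_flip)
  define F1 :: "(nat \<Rightarrow> (nat \<Rightarrow> real) \<times> real) \<Rightarrow> _" where "F1 z = (\<lambda>i\<in>U. z (src g i))" for z
  define F2 :: "(nat \<Rightarrow> (nat \<Rightarrow> real) \<times> real) \<Rightarrow> _"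
    where "F2 z = (\<lambda>i\<in>U. (\<lambda>(x, y). (x, if i \<le> n \<and> snd (g i) then - y else y)) (z i))" for z
  have "move g = F2 \<circ> F1" by (auto simp: move_def F1_def F2_def fun_eq_iff)
  moreover have "F1 \<in> measurable ?N ?N" unfolding F1_def
    using src_in by (intro measurable_restrict measurable_component_singleton)
  moreover have "F2 \<in> measurable ?N ?N" unfolding F2_def
    by (intro measurable_restrict measurable_compose[OF _ measurable_flip] measurable_component_singleton)
  moreover have "distr ?N ?N F1 = ?N" "distr ?N ?N F2 = ?N"
    using 1 2 unfolding F1_def F2_def by simp_all
  ultimately show ?thesis by (metis distr_distr)
qed

text \<open>Every move preserves the law, so \<open>4 ^ n\<close> times the expectation is the
  expectation of the sum over moves, which is at most \<open>4 ^ n\<close> times the number of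
  traces. The product bound on that number integrates to
  \<open>(1 + r * measure P\<xi> B) ^ (2 * n) / r ^ p\<close>.\<close>

lemma nn_integral_\<Phi>:
  assumes "0 < r" "r \<le> 1"
  shows "(\<integral>\<^sup>+z. \<Phi> z \<partial>PiM U (\<lambda>_. Q)) \<le> ennreal (exp (2 * n * measure P\<xi> B * r) / r ^ p)"
proof -
  let ?N = "PiM U (\<lambda>_. Q)" and ?G = "PiE {1..n} (\<lambda>_. UNIV :: (bool \<times> bool) set)"
  interpret N: product_prob_space "\<lambda>_. Q" U by unfold_locales
  have cardG: "card ?G = 4 ^ n"
    by (subst card_PiE) (auto simp: UNIV_Times_UNIV[symmetric] simp del: UNIV_Times_UNIV)
  have four: "(4::ennreal) ^ n = ennreal (4 ^ n)"
    using ennreal_power[of 4 n] by simp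
  have inv: "(\<integral>\<^sup>+z. \<Phi> (move g z) \<partial>?N) = (\<integral>\<^sup>+z. \<Phi> z \<partial>?N)" for g
  proof -
    have "(\<lambda>z. ennreal (\<Phi> z)) \<in> borel_measurable ?N" by measurable
    then have "(\<integral>\<^sup>+z. \<Phi> z \<partial>distr ?N ?N (move g)) = (\<integral>\<^sup>+z. \<Phi> (move g z) \<partial>?N)"
      by (intro nn_integral_distr measurable_move) (simp only: measurable_distr_eq1)
    then show ?thesis unfolding distr_move by simp
  qed
  have "4 ^ n * (\<integral>\<^sup>+z. \<Phi> z \<partial>?N) = (\<Sum>g\<in>?G. \<integral>\<^sup>+z. \<Phi> (move g z) \<partial>?N)"
    by (simp only: inv sum_constant cardG) simp
  also have "\<dots> = (\<integral>\<^sup>+z. (\<Sum>g\<in>?G. ennreal (\<Phi> (move g z))) \<partial>?N)"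
    by (intro nn_integral_sum[symmetric] measurable_compose[OF measurable_move]) simp
  also have "\<dots> \<le> (\<integral>\<^sup>+z. ennreal (4 ^ n * ((\<Prod>i\<in>U. 1 + r * indicator B (snd (z i))) / r ^ p)) \<partial>?N)"
  proof (rule nn_integral_mono)
    fix z
    have "(\<Sum>g\<in>?G. ennreal (\<Phi> (move g z))) = ennreal (\<Sum>g\<in>?G. \<Phi> (move g z))"
      by (intro sum_ennreal \<Phi>_nonneg)
    also have "\<dots> \<le> ennreal (4 ^ n * real (card (range (trace z))))" by (intro ennreal_leI sum_\<Phi>_move)
    also have "\<dots> \<le> ennreal (4 ^ n * ((\<Prod>i\<in>U. 1 + r * indicator B (snd (z i))) / r ^ p))"
      by (rule ennreal_leI, rule mult_left_mono, rule card_traces[OF assms]) simp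
    finally show "(\<Sum>g\<in>?G. ennreal (\<Phi> (move g z)))
        \<le> ennreal (4 ^ n * ((\<Prod>i\<in>U. 1 + r * indicator B (snd (z i))) / r ^ p))" .
  qed
  also have "\<dots> = (\<integral>\<^sup>+z. ennreal (4 ^ n / r ^ p) * (\<Prod>i\<in>U. ennreal (1 + r * indicator B (snd (z i)))) \<partial>?N)"
    using assms by (subst prod_ennreal) (auto simp: ennreal_mult[symmetric] prod_nonneg)
  also have "\<dots> = ennreal (4 ^ n / r ^ p) * (\<Prod>i\<in>U. \<integral>\<^sup>+z. ennreal (1 + r * indicator B (snd z)) \<partial>Q)"
  proof (subst nn_integral_cmult)
    have [measurable]: "(\<lambda>w. ennreal (1 + r * indicator B (snd w))) \<in> borel_measurable Q" by measurable
    show "(\<lambda>z. \<Prod>i\<in>U. ennreal (1 + r * indicator B (snd (z i)))) \<in> borel_measurable ?N"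
      by (intro borel_measurable_prod_ennreal measurable_compose[OF measurable_component_singleton]) auto
    have "(\<integral>\<^sup>+z. (\<Prod>i\<in>U. ennreal (1 + r * indicator B (snd (z i)))) \<partial>?N)
        = (\<Prod>i\<in>U. \<integral>\<^sup>+z. ennreal (1 + r * indicator B (snd z)) \<partial>Q)"
      by (rule N.product_nn_integral_prod) auto
    then show "ennreal (4 ^ n / r ^ p) * (\<integral>\<^sup>+z. (\<Prod>i\<in>U. ennreal (1 + r * indicator B (snd (z i)))) \<partial>?N)
        = ennreal (4 ^ n / r ^ p) * (\<Prod>i\<in>U. \<integral>\<^sup>+z. ennreal (1 + r * indicator B (snd z)) \<partial>Q)"
      by simp
  qed
  also have "(\<integral>\<^sup>+z. ennreal (1 + r * indicator B (snd z)) \<partial>Q) = ennreal (1 + r * measure P\<xi> B)"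
  proof -
    have S [measurable]: "space PX \<times> B \<in> sets Q" using B P\<xi>(2) by (intro pair_measureI) auto
    have "(\<integral>\<^sup>+z. ennreal (1 + r * indicator B (snd z)) \<partial>Q)
        = (\<integral>\<^sup>+z. 1 + ennreal r * indicator (space PX \<times> B) z \<partial>Q)"
      using assms by (intro nn_integral_cong) (auto simp: space_pair_measure indicator_def ennreal_plus)
    also have "\<dots> = 1 + ennreal r * emeasure Q (space PX \<times> B)"
      by (subst nn_integral_add) (simp_all add: nn_integral_cmult_indicator S emeasure_space_1)
    also have "\<dots> = 1 + ennreal r * ennreal (measure P\<xi> B)"
      using B P\<xi>(2) by (subst P\<xi>.emeasure_pair_measure_Times) (auto simp: PX.emeasure_space_1 P\<xi>.emeasure_eq_measure)
    finally show ?thesis using assms by (simp add: ennreal_mult ennreal_plus)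
  qed
  also have "(\<Prod>i\<in>U. ennreal (1 + r * measure P\<xi> B)) = ennreal ((1 + r * measure P\<xi> B) ^ (2 * n))"
    unfolding prod_constant using assms by (subst ennreal_power) auto
  also have "ennreal (4 ^ n / r ^ p) * \<dots> \<le> ennreal (4 ^ n / r ^ p) * ennreal (exp (2 * n * measure P\<xi> B * r))"
  proof (intro mult_left_mono ennreal_leI)
    have "(1 + r * measure P\<xi> B) ^ (2 * n) \<le> exp (r * measure P\<xi> B) ^ (2 * n)"
      using assms by (intro power_mono) (auto simp: exp_ge_add_one_self)
    then show "(1 + r * measure P\<xi> B) ^ (2 * n) \<le> exp (2 * n * measure P\<xi> B * r)"
      by (simp add: exp_of_nat_mult[symmetric] mult_ac)
  qed simp
  also have "\<dots> = 4 ^ n * ennreal (exp (2 * n * measure P\<xi> B * r) / r ^ p)"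
    using assms unfolding four by (simp add: ennreal_mult[symmetric])
  finally show ?thesis
    unfolding four by (subst (asm) ennreal_mult_le_mult_iff) auto
qed

end

section \<open>Integrating out the ghosts\<close>

lemma exp_chord:
  fixes a t :: real
  assumes "0 \<le> t" "t \<le> 1"
  shows "exp (a * t) \<le> 1 + t * (exp a - 1)"
proof -
  have "convex_on UNIV (exp :: real \<Rightarrow> real)" by (rule exp_convex)
  from convex_onD[OF this assms, of 0 a] show ?thesis by (simp add: algebra_simps)
qed

context ghost_sample
begin

abbreviation side_prob :: "(nat \<Rightarrow> real) \<Rightarrow> real" where
  "side_prob d \<equiv> measure PX {x\<in>space PX. x \<in> A0 \<and> (0 < dot p x d) = side}"

text \<open>The conditional expectation of \<open>\<Phi>\<close> given the observations: a function
  of the sample alone, to which Markov's inequality can be applied.\<close>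

definition \<Psi> :: "(nat \<Rightarrow> (nat \<Rightarrow> real) \<times> real) \<Rightarrow> ennreal" where
  "\<Psi> z = (\<integral>\<^sup>+z'. \<Phi> (merge {1..n} {n<..2*n} (z, z')) \<partial>PiM {n<..2*n} (\<lambda>_. Q))"

lemma U_split: "U = {1..n} \<union> {n<..2*n}" "{1..n} \<inter> {n<..2*n} = {}"
  by auto

lemma nn_integral_\<Psi>: "(\<integral>\<^sup>+z. \<Psi> z \<partial>PiM {1..n} (\<lambda>_. Q)) = (\<integral>\<^sup>+z. \<Phi> z \<partial>PiM U (\<lambda>_. Q))"
  and measurable_\<Psi> [measurable]: "\<Psi> \<in> borel_measurable (PiM {1..n} (\<lambda>_. Q))"
proof -
  interpret P: product_sigma_finite "\<lambda>_. Q" by unfold_locales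
  interpret J: finite_product_prob_space "\<lambda>_. Q" "{n<..2*n}" by unfold_locales simp
  have \<Phi>: "(\<lambda>z. ennreal (\<Phi> z)) \<in> borel_measurable (PiM ({1..n} \<union> {n<..2*n}) (\<lambda>_. Q))"
    unfolding U_split(1)[symmetric] by measurable
  show "(\<integral>\<^sup>+z. \<Psi> z \<partial>PiM {1..n} (\<lambda>_. Q)) = (\<integral>\<^sup>+z. \<Phi> z \<partial>PiM U (\<lambda>_. Q))"
    unfolding \<Psi>_def U_split(1) using U_split(2) \<Phi>
    by (intro P.product_nn_integral_fold[symmetric]) auto
  have "(\<lambda>w. ennreal (\<Phi> (merge {1..n} {n<..2*n} w)))
      \<in> borel_measurable (PiM {1..n} (\<lambda>_. Q) \<Otimes>\<^sub>M PiM {n<..2*n} (\<lambda>_. Q))"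
    by (rule measurable_compose[OF measurable_merge \<Phi>])
  then show "\<Psi> \<in> borel_measurable (PiM {1..n} (\<lambda>_. Q))"
    unfolding \<Psi>_def[abs_def] by (intro J.borel_measurable_nn_integral) (simp add: case_prod_unfold)
qed

lemma sets_C: "C d \<inter> space Q \<in> sets Q"
  and prob_C: "measure Q (C d \<inter> space Q) = measure P\<xi> B * side_prob d"
proof -
  note [measurable] = measurable_dot
  have S: "{x\<in>space PX. x \<in> A0 \<and> (0 < dot p x d) = side} \<in> sets PX"
    unfolding space_PX PX(2) by measurable
  have eq: "C d \<inter> space Q = {x\<in>space PX. x \<in> A0 \<and> (0 < dot p x d) = side} \<times> B"
    by (auto simp: C_def space_pair_measure space_P\<xi>)
  show "C d \<inter> space Q \<in> sets Q" unfolding eq using S B P\<xi>(2) by (intro pair_measureI) auto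
  show "measure Q (C d \<inter> space Q) = measure P\<xi> B * side_prob d"
    unfolding eq measure_def using S B P\<xi>(2)
    by (subst P\<xi>.emeasure_pair_measure_Times) (auto simp: enn2real_mult)
qed

text \<open>\<open>\<Phi>\<close> is at least the weight of the trace of \<open>d\<close>. Its ghost
  factors are independent with mean \<open>1 + t * (exp a - 1)\<close>, where \<open>t\<close> is
  the mass of \<open>C d\<close>, and convexity bounds this below by \<open>exp (a * t)\<close>. One
  \<open>\<Psi>\<close> serves all \<open>d\<close>, whence the uniformity.\<close>

lemma \<Psi>_lower_bound:
  "ennreal (exp (a * n * (measure P\<xi> B * side_prob d) + (\<Sum>i | i \<in> {1..n} \<and> z i \<in> C d. v (snd (z i))))) \<le> \<Psi> z"
proof -
  let ?J = "{n<..2*n}"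
  interpret J: finite_product_prob_space "\<lambda>_. Q" ?J by unfold_locales simp
  define S where "S = (\<Sum>i | i \<in> {1..n} \<and> z i \<in> C d. v (snd (z i)))"
  define g where "g w = (if w \<in> C d then exp a else 1)" for w
  define t where "t = measure P\<xi> B * side_prob d"
  have t: "0 \<le> t" "t \<le> 1" unfolding t_def by (auto intro: mult_le_one)
  have g: "(\<integral>\<^sup>+w. ennreal (g w) \<partial>Q) = ennreal (1 + t * (exp a - 1))"
  proof -
    have "(\<integral>\<^sup>+w. ennreal (g w) \<partial>Q) = (\<integral>\<^sup>+w. ennreal (exp a) * indicator (C d \<inter> space Q) w
         + indicator (space Q - C d \<inter> space Q) w \<partial>Q)"
      by (intro nn_integral_cong) (auto simp: g_def indicator_def)
    also have "\<dots> = ennreal (exp a) * emeasure Q (C d \<inter> space Q) + emeasure Q (space Q - C d \<inter> space Q)"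
      using sets_C by (subst nn_integral_add) (auto simp: nn_integral_cmult_indicator)
    also have "\<dots> = ennreal (exp a) * ennreal t + ennreal (1 - t)"
      unfolding emeasure_eq_measure using sets_C by (simp add: prob_compl prob_C t_def)
    also have "\<dots> = ennreal (exp a * t + (1 - t))"
      using t by (simp add: ennreal_mult ennreal_plus)
    finally show ?thesis by (simp add: algebra_simps)
  qed
  have gm: "(\<lambda>w. ennreal (g w)) \<in> borel_measurable Q"
  proof -
    have "(\<lambda>w. ennreal (g w)) \<in> borel_measurable Q \<longleftrightarrow>
      (\<lambda>w. if w \<in> C d \<inter> space Q then ennreal (exp a) else 1) \<in> borel_measurable Q"
      by (intro measurable_cong) (auto simp: g_def)
    moreover have "(\<lambda>w. if w \<in> C d \<inter> space Q then ennreal (exp a) else 1) \<in> borel_measurable Q"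
      by (intro measurable_If_set) (auto simp: Int_assoc sets_C)
    ultimately show ?thesis by blast
  qed
  have "exp (a * n * t) \<le> (1 + t * (exp a - 1)) ^ n"
    using power_mono[OF exp_chord[OF t, of a], of n] by (simp add: exp_of_nat_mult[symmetric] mult_ac)
  then have "ennreal (exp (a * n * t + S)) \<le> ennreal (exp S * (1 + t * (exp a - 1)) ^ n)"
    by (intro ennreal_leI) (simp add: exp_add mult.commute)
  also have "\<dots> = ennreal (exp S) * (\<Prod>j\<in>?J. \<integral>\<^sup>+w. ennreal (g w) \<partial>Q)"
  proof -
    have "0 \<le> 1 + t * (exp a - 1)" using exp_chord[OF t, of a] by (meson exp_ge_zero order_trans)
    then show ?thesis unfolding g by (simp add: ennreal_mult ennreal_power)
  qed
  also have "(\<Prod>j\<in>?J. \<integral>\<^sup>+w. ennreal (g w) \<partial>Q) = (\<integral>\<^sup>+z'. (\<Prod>j\<in>?J. ennreal (g (z' j))) \<partial>PiM ?J (\<lambda>_. Q))"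
    by (rule J.product_nn_integral_prod[symmetric]) (auto intro: gm)
  also have "ennreal (exp S) * \<dots> = (\<integral>\<^sup>+z'. ennreal (exp S) * (\<Prod>j\<in>?J. ennreal (g (z' j))) \<partial>PiM ?J (\<lambda>_. Q))"
    by (intro nn_integral_cmult[symmetric] borel_measurable_prod_ennreal
        measurable_compose[OF _ gm] measurable_component_singleton) auto
  also have "\<dots> \<le> \<Psi> z"
    unfolding \<Psi>_def
  proof (intro nn_integral_mono)
    fix z'
    let ?m = "merge {1..n} ?J (z, z')"
    have "W ?m (trace ?m d) = (\<Prod>i\<in>{1..n}. (if z i \<in> C d then exp (v (snd (z i))) else 1) * g (z' (i + n)))"
      unfolding W_def by (intro prod.cong refl) (auto simp: trace_def merge_def g_def)
    also have "\<dots> = (\<Prod>i\<in>{1..n}. if z i \<in> C d then exp (v (snd (z i))) else 1) * (\<Prod>i\<in>{1..n}. g (z' (i + n)))"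
      by (rule prod.distrib)
    also have "(\<Prod>i\<in>{1..n}. if z i \<in> C d then exp (v (snd (z i))) else 1) = exp S"
    proof -
      have "S = (\<Sum>i\<in>{1..n}. if z i \<in> C d then v (snd (z i)) else 0)"
        unfolding S_def by (rule sum.inter_filter) simp
      then show ?thesis by (simp only: exp_sum finite_atLeastAtMost) (intro prod.cong, auto)
    qed
    also have "(\<Prod>i\<in>{1..n}. g (z' (i + n))) = (\<Prod>j\<in>?J. g (z' j))"
      by (rule prod.reindex_bij_witness[of _ "\<lambda>j. j - n" "\<lambda>i. i + n"]) auto
    finally have "W ?m (trace ?m d) = exp S * (\<Prod>j\<in>?J. g (z' j))" .
    moreover have "W ?m (trace ?m d) \<le> \<Phi> ?m"
      unfolding \<Phi>_def by (rule member_le_sum) (auto intro: W_nonneg)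
    ultimately have "exp S * (\<Prod>j\<in>?J. g (z' j)) \<le> \<Phi> ?m" by simp
    then show "ennreal (exp S) * (\<Prod>j\<in>?J. ennreal (g (z' j))) \<le> ennreal (\<Phi> ?m)"
      by (subst prod_ennreal) (auto simp: g_def ennreal_mult[symmetric] prod_nonneg ennreal_leI)
  qed
  finally show ?thesis unfolding S_def t_def .
qed

end

section \<open>The sample and its uniform tail bound\<close>

locale iid_model =
  fixes p n :: nat and M :: "'a measure" and X :: "nat \<Rightarrow> 'a \<Rightarrow> nat \<Rightarrow> real"
    and \<xi> :: "nat \<Rightarrow> 'a \<Rightarrow> real" and PX :: "(nat \<Rightarrow> real) measure" and P\<xi> :: "real measure"
  assumes n: "1 \<le> n" and sample: "iid_sample p n M X \<xi> PX P\<xi>"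
    and noise_sym: "distr P\<xi> borel uminus = P\<xi>"
begin

sublocale design_noise p PX P\<xi>
  using sample noise_sym by (intro design_noise.intro) (simp_all add: iid_sample_def)

sublocale M: prob_space M
  using sample by (simp add: iid_sample_def)

abbreviation Z :: "'a \<Rightarrow> nat \<Rightarrow> (nat \<Rightarrow> real) \<times> real" where
  "Z \<omega> \<equiv> (\<lambda>i\<in>{1..n}. (X i \<omega>, \<xi> i \<omega>))"

lemma measurable_pair: "i \<in> {1..n} \<Longrightarrow> (\<lambda>\<omega>. (X i \<omega>, \<xi> i \<omega>)) \<in> measurable M Q"
  using sample unfolding iid_sample_def M.indep_vars_def
  by (subst measurable_cong_sets[OF refl sets_Q]) auto

lemma measurable_Z: "Z \<in> measurable M (PiM {1..n} (\<lambda>_. Q))"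
  by (intro measurable_restrict measurable_pair)

lemma distr_pair: "i \<in> {1..n} \<Longrightarrow> distr M Q (\<lambda>\<omega>. (X i \<omega>, \<xi> i \<omega>)) = Q"
  using sample unfolding iid_sample_def by (subst distr_cong[OF refl sets_Q refl]) blast

lemma distr_Z: "distr M (PiM {1..n} (\<lambda>_. Q)) Z = PiM {1..n} (\<lambda>_. Q)"
proof -
  let ?V = "vec_space p \<Otimes>\<^sub>M borel"
  have "distr M (PiM {1..n} (\<lambda>_. ?V)) Z = PiM {1..n} (\<lambda>i. distr M ?V (\<lambda>\<omega>. (X i \<omega>, \<xi> i \<omega>)))"
    using sample n unfolding iid_sample_def
    by (subst M.indep_vars_iff_distr_eq_PiM'[symmetric]) (auto simp: M.indep_vars_def)
  also have "\<dots> = PiM {1..n} (\<lambda>_. Q)"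
    using sample unfolding iid_sample_def by (intro PiM_cong) auto
  also have "distr M (PiM {1..n} (\<lambda>_. ?V)) Z = distr M (PiM {1..n} (\<lambda>_. Q)) Z"
    by (intro distr_cong sets_PiM_cong) (auto simp: sets_Q)
  finally show ?thesis .
qed

definition cell :: "(nat \<Rightarrow> real) set \<Rightarrow> bool \<Rightarrow> (nat \<Rightarrow> real) \<Rightarrow> 'a \<Rightarrow> nat set" where
  "cell A0 side d \<omega> = {i\<in>{1..n}. X i \<omega> \<in> A0 \<and> (0 < dot p (X i \<omega>) d) = side}"

definition cell_prob :: "(nat \<Rightarrow> real) set \<Rightarrow> bool \<Rightarrow> (nat \<Rightarrow> real) \<Rightarrow> real" where
  "cell_prob A0 side d = measure PX {x\<in>space PX. x \<in> A0 \<and> (0 < dot p x d) = side}"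

text \<open>Markov's inequality for \<open>\<Psi>\<close> at the level
  \<open>u / \<epsilon>\<close>, followed by logarithms. The mass of the cell stays on the left with
  the factor \<open>a\<close>, so deviations are measured relative to that mass; the cost of all
  directions is on the right and governed by \<open>r\<close>.\<close>

proposition uniform_exponential_tail:
  fixes a r \<epsilon> :: real
  assumes "A0 \<in> sets (vec_space p)" "B \<in> sets borel" "\<And>y. - y \<in> B \<longleftrightarrow> y \<in> B"
    "v \<in> borel_measurable borel" "\<And>y. y \<in> B \<Longrightarrow> exp a + (exp (v y) + exp (v (- y))) / 2 \<le> 2"
    and r: "0 < r" "r \<le> 1" and \<epsilon>: "0 < \<epsilon>"
  shows "\<exists>E\<in>sets M. measure M E \<le> \<epsilon> \<and> (\<forall>\<omega>\<in>space M - E. \<forall>d.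
    a * n * (measure P\<xi> B * cell_prob A0 side d) + (\<Sum>i | i \<in> cell A0 side d \<omega> \<and> \<xi> i \<omega> \<in> B. v (\<xi> i \<omega>))
      \<le> 2 * n * measure P\<xi> B * r + p * ln (1 / r) + ln (1 / \<epsilon>))"
proof -
  interpret G: ghost_sample p PX P\<xi> n A0 side B v a
    using assms by unfold_locales
  define u where "u = exp (2 * n * measure P\<xi> B * r) / r ^ p"
  have u: "u > 0" using r by (simp add: u_def)
  define E where "E = {\<omega>\<in>space M. ennreal (u / \<epsilon>) \<le> G.\<Psi> (Z \<omega>)}"
  have [measurable]: "(\<lambda>\<omega>. G.\<Psi> (Z \<omega>)) \<in> borel_measurable M"
    by (rule measurable_compose[OF measurable_Z G.measurable_\<Psi>])
  have E: "E \<in> sets M" unfolding E_def by measurable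
  have "(\<integral>\<^sup>+\<omega>. G.\<Psi> (Z \<omega>) \<partial>M) = (\<integral>\<^sup>+z. G.\<Psi> z \<partial>distr M (PiM {1..n} (\<lambda>_. Q)) Z)"
    by (rule nn_integral_distr[symmetric, OF measurable_Z]) (simp add: G.measurable_\<Psi>)
  also have "\<dots> \<le> ennreal u"
    unfolding distr_Z G.nn_integral_\<Psi> u_def by (rule G.nn_integral_\<Phi>[OF r])
  finally have int: "(\<integral>\<^sup>+\<omega>. G.\<Psi> (Z \<omega>) \<partial>M) \<le> ennreal u" .
  have "ennreal (u / \<epsilon>) * emeasure M E = (\<integral>\<^sup>+\<omega>. ennreal (u / \<epsilon>) * indicator E \<omega> \<partial>M)"
    using E by (simp add: nn_integral_cmult_indicator)
  also have "\<dots> \<le> (\<integral>\<^sup>+\<omega>. G.\<Psi> (Z \<omega>) \<partial>M)"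
    by (intro nn_integral_mono) (auto simp: E_def indicator_def)
  also note int
  finally have "u / \<epsilon> * measure M E \<le> u"
    using u \<epsilon> by (simp add: M.emeasure_eq_measure ennreal_mult[symmetric])
  then have ME: "measure M E \<le> \<epsilon>" using u \<epsilon> by (simp add: field_simps)
  show ?thesis
  proof (intro bexI[OF _ E] conjI ME ballI allI)
    fix \<omega> d assume "\<omega> \<in> space M - E"
    let ?L = "a * n * (measure P\<xi> B * cell_prob A0 side d) + (\<Sum>i | i \<in> cell A0 side d \<omega> \<and> \<xi> i \<omega> \<in> B. v (\<xi> i \<omega>))"
    have "{i. i \<in> {1..n} \<and> Z \<omega> i \<in> G.C d} = {i. i \<in> cell A0 side d \<omega> \<and> \<xi> i \<omega> \<in> B}"
      by (auto simp: cell_def G.C_def)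
    moreover have "(\<Sum>i | i \<in> {1..n} \<and> Z \<omega> i \<in> G.C d. v (snd (Z \<omega> i))) = (\<Sum>i | i \<in> {1..n} \<and> Z \<omega> i \<in> G.C d. v (\<xi> i \<omega>))"
      by (intro sum.cong) auto
    ultimately have "ennreal (exp ?L) \<le> G.\<Psi> (Z \<omega>)"
      using G.\<Psi>_lower_bound[of d "Z \<omega>"] by (simp only: cell_prob_def)
    also have "\<dots> < ennreal (u / \<epsilon>)" using \<open>\<omega> \<in> space M - E\<close> by (auto simp: E_def)
    finally have "exp ?L < u / \<epsilon>" using u \<epsilon> by (simp add: ennreal_less_iff)
    then have "?L < ln (u / \<epsilon>)" using u \<epsilon> ln_less_cancel_iff[of "exp ?L" "u / \<epsilon>"] by simp
    also have "\<dots> = 2 * n * measure P\<xi> B * r + p * ln (1 / r) + ln (1 / \<epsilon>)"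
      using r \<epsilon> by (simp add: u_def ln_div ln_mult ln_realpow)
    finally show "?L \<le> 2 * n * measure P\<xi> B * r + p * ln (1 / r) + ln (1 / \<epsilon>)" by simp
  qed
qed

end

section \<open>Cell counts and noise sums\<close>

lemma exp_le_quadratic:
  fixes x :: real
  assumes "x \<le> 1"
  shows "exp x \<le> 1 + x + x\<^sup>2"
proof (cases "0 \<le> x")
  case False
  define u where "u = - x"
  have u: "u \<ge> 0" using False by (simp add: u_def)
  have pos: "1 + u + u\<^sup>2 / 2 > 0" using u by (intro add_pos_nonneg) auto
  \<comment> \<open>For negative \<open>x\<close> the Taylor lower bound of \<open>exp u\<close> is
    inverted; this product says that \<open>1 - u + u\<^sup>2\<close> is at least the reciprocal of
    that bound.\<close>
  have "1 \<le> (1 - u + u\<^sup>2) * (1 + u + u\<^sup>2 / 2)"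
  proof -
    have "(1 - u + u\<^sup>2) * (1 + u + u\<^sup>2 / 2) = 1 + u\<^sup>2 / 2 + u ^ 3 / 2 + u ^ 4 / 2"
      by (simp add: power2_eq_square power3_eq_cube power4_eq_xxxx field_simps)
    then show ?thesis using u by simp
  qed
  then have "1 / (1 + u + u\<^sup>2 / 2) \<le> 1 - u + u\<^sup>2" using pos by (simp add: divide_le_eq)
  moreover have "1 / exp u \<le> 1 / (1 + u + u\<^sup>2 / 2)"
    using exp_lower_Taylor_quadratic[OF u] pos by (intro divide_left_mono) auto
  ultimately show ?thesis by (simp add: u_def exp_minus inverse_eq_divide)
qed (use assms exp_bound in auto)

context iid_model
begin

definition half :: "(nat \<Rightarrow> real) \<Rightarrow> bool \<Rightarrow> (nat \<Rightarrow> real) set" where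
  "half d s = {x\<in>space (vec_space p). (0 < dot p x d) = s}"

lemma sets_half [measurable]: "half d s \<in> sets (vec_space p)"
proof -
  note [measurable] = measurable_dot
  show ?thesis unfolding half_def by measurable
qed

lemma finite_cell [simp]: "finite (cell A s d \<omega>)"
  by (simp add: cell_def)

lemma X_space: "\<omega> \<in> space M \<Longrightarrow> i \<in> {1..n} \<Longrightarrow> X i \<omega> \<in> space (vec_space p)"
  using measurable_space[OF measurable_pair, of i \<omega>] by (auto simp: space_pair_measure space_PX)

lemma cell_half: "\<omega> \<in> space M \<Longrightarrow>
   cell (half d0 s0) s d \<omega> = {i\<in>{1..n}. (0 < dot p (X i \<omega>) d0) = s0 \<and> (0 < dot p (X i \<omega>) d) = s}"
  using X_space by (auto simp: cell_def half_def)

text \<open>The right-hand side of the tail bound at \<open>r = p / n\<close>, with the mass of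
  \<open>B\<close> bounded by one; that \<open>r\<close> is within a factor two of the minimizer for
  full mass.\<close>

definition entropy :: "real \<Rightarrow> real" where
  "entropy \<epsilon> = p * ln (n / p) + 2 * p + ln (1 / \<epsilon>)"

lemma entropy_bound:
  fixes q \<epsilon> :: real
  assumes p: "1 \<le> p" "p \<le> n" and q: "q \<le> 1"
  shows "2 * n * q * (p / n) + p * ln (1 / (p / n)) + ln (1 / \<epsilon>) \<le> entropy \<epsilon>"
proof -
  have "2 * n * q * (p / n) = 2 * p * q" using p by simp
  also have "\<dots> \<le> 2 * p" using q mult_left_mono[of q 1 "2 * real p"] by simp
  finally show ?thesis by (simp add: entropy_def)
qed

text \<open>These are the points on which every loss is curved for a shift with the sign of
  \<open>t\<close>. The origin is left out of \<open>B\<close> because only for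
  \<open>y \<noteq> 0\<close> does exactly one of \<open>y\<close> and \<open>- y\<close> get the
  weight \<open>- 1\<close>.\<close>

lemma count_lower:
  fixes t \<epsilon> :: real
  assumes p: "1 \<le> p" "p \<le> n" and A: "A \<in> sets (vec_space p)" and t: "t \<noteq> 0" and \<epsilon>: "0 < \<epsilon>"
  shows "\<exists>E\<in>sets M. measure M E \<le> \<epsilon> \<and> (\<forall>\<omega>\<in>space M - E. \<forall>d.
     n * measure P\<xi> {y. 0 < \<bar>y\<bar> \<and> \<bar>y\<bar> < \<rho>} * cell_prob A s d / 8 - entropy \<epsilon>
      \<le> card {i\<in>cell A s d \<omega>. \<xi> i \<omega> * t < 0 \<and> \<bar>\<xi> i \<omega>\<bar> < \<rho>})"
proof -
  define B where "B = {y. 0 < \<bar>y\<bar> \<and> \<bar>y\<bar> < \<rho>}"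
  define v where "v y = (if y * t < 0 \<and> \<bar>y\<bar> < \<rho> then - 1 else (0::real))" for y
  have "\<exists>E\<in>sets M. measure M E \<le> \<epsilon> \<and> (\<forall>\<omega>\<in>space M - E. \<forall>d.
    (1/8) * n * (measure P\<xi> B * cell_prob A s d) + (\<Sum>i | i \<in> cell A s d \<omega> \<and> \<xi> i \<omega> \<in> B. v (\<xi> i \<omega>))
      \<le> 2 * n * measure P\<xi> B * (p / n) + p * ln (1 / (p / n)) + ln (1 / \<epsilon>))"
  proof (rule uniform_exponential_tail[OF A])
    show "B \<in> sets borel" unfolding B_def by measurable
    show "v \<in> borel_measurable borel" unfolding v_def by measurable
    show "0 < real p / real n" "real p / real n \<le> 1" using p by auto
    fix y
    show "- y \<in> B \<longleftrightarrow> y \<in> B" by (auto simp: B_def)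
    assume y: "y \<in> B"
    \<comment> \<open>\<open>1/8\<close> is small enough for \<open>exp (1/8) \<le> 5/4\<close>,
      which together with \<open>exp (-1) \<le> 1/2\<close> meets the bound
      \<open>2\<close>.\<close>
    have "exp (1/8 :: real) \<le> 5/4" using exp_le_quadratic[of "1/8"] by (simp add: power2_eq_square)
    moreover have "exp (-1 :: real) \<le> 1/2"
      using exp_lower_Taylor_quadratic[of 1] by (simp add: exp_minus field_simps)
    ultimately have "exp (1/8 :: real) + (1 + exp (-1)) / 2 \<le> 2" by argo
    moreover have "exp (v y) + exp (v (- y)) = 1 + exp (-1)"
    proof -
      have "y * t \<noteq> 0" using y t by (auto simp: B_def)
      then show ?thesis using y by (cases "y * t < 0") (auto simp: v_def B_def)
    qed
    ultimately show "exp (1/8) + (exp (v y) + exp (v (- y))) / 2 \<le> 2" by simp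
  qed (use \<epsilon> in auto)
  then obtain E where E: "E \<in> sets M" "measure M E \<le> \<epsilon>"
    and bound: "\<And>\<omega> d. \<omega> \<in> space M - E \<Longrightarrow>
    (1/8) * n * (measure P\<xi> B * cell_prob A s d) + (\<Sum>i | i \<in> cell A s d \<omega> \<and> \<xi> i \<omega> \<in> B. v (\<xi> i \<omega>))
      \<le> 2 * n * measure P\<xi> B * (p / n) + p * ln (1 / (p / n)) + ln (1 / \<epsilon>)"
    by blast
  show ?thesis
  proof (intro bexI[OF _ E(1)] conjI E(2) ballI allI)
    fix \<omega> d assume \<omega>: "\<omega> \<in> space M - E"
    have "(\<Sum>i | i \<in> cell A s d \<omega> \<and> \<xi> i \<omega> \<in> B. v (\<xi> i \<omega>))
        = (\<Sum>i\<in>{i\<in>cell A s d \<omega>. \<xi> i \<omega> * t < 0 \<and> \<bar>\<xi> i \<omega>\<bar> < \<rho>}. - 1)"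
      by (rule sum.mono_neutral_cong_right) (auto simp: v_def B_def)
    also have "\<dots> = - real (card {i\<in>cell A s d \<omega>. \<xi> i \<omega> * t < 0 \<and> \<bar>\<xi> i \<omega>\<bar> < \<rho>})" by simp
    finally show "n * measure P\<xi> {y. 0 < \<bar>y\<bar> \<and> \<bar>y\<bar> < \<rho>} * cell_prob A s d / 8 - entropy \<epsilon>
      \<le> card {i\<in>cell A s d \<omega>. \<xi> i \<omega> * t < 0 \<and> \<bar>\<xi> i \<omega>\<bar> < \<rho>}"
      using bound[OF \<omega>, of d] entropy_bound[OF p, of "measure P\<xi> B" \<epsilon>] by (simp add: B_def)
  qed
qed

lemma count_upper:
  fixes \<epsilon> :: real
  assumes p: "1 \<le> p" "p \<le> n" and A: "A \<in> sets (vec_space p)" and \<epsilon>: "0 < \<epsilon>"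
  shows "\<exists>E\<in>sets M. measure M E \<le> \<epsilon> \<and> (\<forall>\<omega>\<in>space M - E. \<forall>d.
     card (cell A s d \<omega>) \<le> 4 * n * cell_prob A s d + 2 * entropy \<epsilon>)"
proof -
  have "\<exists>E\<in>sets M. measure M E \<le> \<epsilon> \<and> (\<forall>\<omega>\<in>space M - E. \<forall>d.
    (-2 :: real) * n * (measure P\<xi> UNIV * cell_prob A s d) + (\<Sum>i | i \<in> cell A s d \<omega> \<and> \<xi> i \<omega> \<in> UNIV. 1/2)
      \<le> 2 * n * measure P\<xi> UNIV * (p / n) + p * ln (1 / (p / n)) + ln (1 / \<epsilon>))"
  proof (rule uniform_exponential_tail[OF A])
    show "0 < real p / real n" "real p / real n \<le> 1" using p by auto
    fix y :: real
    \<comment> \<open>The pair \<open>-2\<close>, \<open>1/2\<close> is balanced since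
      \<open>1/4 + 7/4 = 2\<close>; doubling turns it into the constants \<open>4\<close> and
      \<open>2\<close> of the statement.\<close>
    have "exp (1/2 :: real) \<le> 7/4" using exp_le_quadratic[of "1/2"] by (simp add: power2_eq_square)
    moreover have "exp (-2 :: real) \<le> 1/4"
      using exp_lower_Taylor_quadratic[of 2] by (simp add: exp_minus field_simps power2_eq_square)
    ultimately show "exp (-2) + (exp (1/2) + exp (1/2)) / 2 \<le> (2::real)" by simp
  qed (use \<epsilon> in auto)
  then obtain E where E: "E \<in> sets M" "measure M E \<le> \<epsilon>"
    and bound: "\<And>\<omega> d. \<omega> \<in> space M - E \<Longrightarrow>
    (-2 :: real) * n * (measure P\<xi> UNIV * cell_prob A s d) + (\<Sum>i | i \<in> cell A s d \<omega> \<and> \<xi> i \<omega> \<in> UNIV. 1/2)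
      \<le> 2 * n * measure P\<xi> UNIV * (p / n) + p * ln (1 / (p / n)) + ln (1 / \<epsilon>)"
    by blast
  show ?thesis
  proof (intro bexI[OF _ E(1)] conjI E(2) ballI allI)
    fix \<omega> d assume \<omega>: "\<omega> \<in> space M - E"
    show "card (cell A s d \<omega>) \<le> 4 * n * cell_prob A s d + 2 * entropy \<epsilon>"
      using bound[OF \<omega>, of d] entropy_bound[OF p, of "measure P\<xi> UNIV" \<epsilon>] P\<xi>.prob_space
      by (simp add: space_P\<xi>)
  qed
qed

text \<open>A bound of Bernstein type. The tilt \<open>s / w\<close> keeps the exponent at most
  \<open>s\<close> in absolute value; oddness of \<open>\<psi>\<close> cancels its first-order term,
  and the ghost weight \<open>- 2 * s\<^sup>2\<close> pays for the quadratic one. Dividing by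
  \<open>s / w\<close> makes the price linear in \<open>s\<close>, so a small \<open>s\<close> lets
  curvature absorb it at the expense of \<open>1 / s\<close> before the entropy.\<close>

lemma noise_tail:
  fixes s r w \<epsilon> :: real
  assumes A: "A \<in> sets (vec_space p)" and B: "B \<in> sets borel" "\<And>y. - y \<in> B \<longleftrightarrow> y \<in> B"
    and \<psi>: "\<psi> \<in> borel_measurable borel" "\<And>y. \<psi> (- y) = - \<psi> y" "\<And>y. y \<in> B \<Longrightarrow> \<bar>\<psi> y\<bar> \<le> w"
    and w: "0 < w" and s: "0 < s" "s \<le> 1/2" and r: "0 < r" "r \<le> 1" and \<epsilon>: "0 < \<epsilon>"
  shows "\<exists>E\<in>sets M. measure M E \<le> \<epsilon> \<and> (\<forall>\<omega>\<in>space M - E. \<forall>d.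
    \<bar>\<Sum>i | i \<in> cell A side d \<omega> \<and> \<xi> i \<omega> \<in> B. \<psi> (\<xi> i \<omega>)\<bar>
      \<le> 2 * s * n * (w * measure P\<xi> B) * cell_prob A side d
        + w / s * (2 * n * measure P\<xi> B * r + p * ln (1 / r) + ln (2 / \<epsilon>)))"
proof -
  \<comment> \<open>Used with both signs \<open>\<sigma>\<close> to get the absolute value, whence
    \<open>ln (2 / \<epsilon>)\<close>.\<close>
  have *: "\<exists>E\<in>sets M. measure M E \<le> \<epsilon> / 2 \<and> (\<forall>\<omega>\<in>space M - E. \<forall>d.
    (- 2 * s\<^sup>2) * n * (measure P\<xi> B * cell_prob A side d)
      + (\<Sum>i | i \<in> cell A side d \<omega> \<and> \<xi> i \<omega> \<in> B. \<sigma> * (s / w) * \<psi> (\<xi> i \<omega>))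
      \<le> 2 * n * measure P\<xi> B * r + p * ln (1 / r) + ln (1 / (\<epsilon> / 2)))" if \<sigma>: "\<bar>\<sigma>\<bar> = 1" for \<sigma> :: real
  proof (rule uniform_exponential_tail[OF A B(1,2) _ _ r])
    show "(\<lambda>y. \<sigma> * (s / w) * \<psi> y) \<in> borel_measurable borel" using \<psi>(1) by measurable
    fix y assume y: "y \<in> B"
    define \<theta> where "\<theta> = \<sigma> * (s / w) * \<psi> y"
    have "\<bar>\<theta>\<bar> = s / w * \<bar>\<psi> y\<bar>" using \<sigma> s w by (simp add: \<theta>_def abs_mult)
    also have "\<dots> \<le> s / w * w" using \<psi>(3)[OF y] s w by (intro mult_left_mono) auto
    finally have \<theta>: "\<bar>\<theta>\<bar> \<le> s" using w by simp
    have s2: "s\<^sup>2 \<le> 1/4" using s power_mono[of s "1/2" 2] by (simp add: power2_eq_square)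
    have "exp (- 2 * s\<^sup>2) \<le> 1 - 2 * s\<^sup>2 + 4 * (s\<^sup>2 * s\<^sup>2)"
      using exp_le_quadratic[of "- 2 * s\<^sup>2"] zero_le_power2[of s]
      by (simp only: power2_eq_square mult_minus_left mult_minus_right minus_minus) argo
    also have "\<dots> \<le> 1 - s\<^sup>2" using mult_right_mono[OF s2, of "s\<^sup>2"] by simp
    finally have 1: "exp (- 2 * s\<^sup>2) \<le> 1 - s\<^sup>2" .
    have "\<theta>\<^sup>2 \<le> s\<^sup>2" using \<theta> s by (simp add: abs_le_square_iff[symmetric])
    moreover have "exp \<theta> \<le> 1 + \<theta> + \<theta>\<^sup>2" "exp (- \<theta>) \<le> 1 - \<theta> + \<theta>\<^sup>2"
      using exp_le_quadratic[of \<theta>] exp_le_quadratic[of "- \<theta>"] \<theta> s by auto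
    ultimately have "exp (- 2 * s\<^sup>2) + (exp \<theta> + exp (- \<theta>)) / 2 \<le> 2" using 1 by argo
    then show "exp (- 2 * s\<^sup>2) + (exp (\<sigma> * (s / w) * \<psi> y) + exp (\<sigma> * (s / w) * \<psi> (- y))) / 2 \<le> 2"
      by (simp add: \<theta>_def \<psi>(2))
  qed (use \<epsilon> in auto)
  obtain E1 where E1: "E1 \<in> sets M" "measure M E1 \<le> \<epsilon> / 2"
    and b1: "\<forall>\<omega>\<in>space M - E1. \<forall>d. (- 2 * s\<^sup>2) * n * (measure P\<xi> B * cell_prob A side d)
      + (\<Sum>i | i \<in> cell A side d \<omega> \<and> \<xi> i \<omega> \<in> B. 1 * (s / w) * \<psi> (\<xi> i \<omega>))
      \<le> 2 * n * measure P\<xi> B * r + p * ln (1 / r) + ln (1 / (\<epsilon> / 2))"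
    using *[OF abs_one] by (elim bexE conjE)
  have "\<bar>- 1 :: real\<bar> = 1" by simp
  from *[OF this] obtain E2 where E2: "E2 \<in> sets M" "measure M E2 \<le> \<epsilon> / 2"
    and b2: "\<forall>\<omega>\<in>space M - E2. \<forall>d. (- 2 * s\<^sup>2) * n * (measure P\<xi> B * cell_prob A side d)
      + (\<Sum>i | i \<in> cell A side d \<omega> \<and> \<xi> i \<omega> \<in> B. (- 1) * (s / w) * \<psi> (\<xi> i \<omega>))
      \<le> 2 * n * measure P\<xi> B * r + p * ln (1 / r) + ln (1 / (\<epsilon> / 2))"
    by (elim bexE conjE)
  show ?thesis
  proof (intro bexI[of _ "E1 \<union> E2"] conjI ballI allI)
    show "measure M (E1 \<union> E2) \<le> \<epsilon>"
      using measure_Un_le[OF E1(1) E2(1)] E1(2) E2(2) by simp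
    fix \<omega> d assume \<omega>: "\<omega> \<in> space M - (E1 \<union> E2)"
    define S where "S = (\<Sum>i | i \<in> cell A side d \<omega> \<and> \<xi> i \<omega> \<in> B. \<psi> (\<xi> i \<omega>))"
    define T where "T = 2 * n * measure P\<xi> B * r + p * ln (1 / r) + ln (2 / \<epsilon>)"
    define R where "R = measure P\<xi> B * cell_prob A side d"
    have "(- 2 * s\<^sup>2) * n * R + s / w * S \<le> T" "(- 2 * s\<^sup>2) * n * R - s / w * S \<le> T"
      using b1[rule_format, of \<omega> d] b2[rule_format, of \<omega> d] \<omega> by (simp_all add: S_def T_def R_def sum_distrib_left sum_negf)
    then have "s / w * \<bar>S\<bar> \<le> T + 2 * s\<^sup>2 * n * R" by (simp add: abs_if)
    then have "w / s * (s / w * \<bar>S\<bar>) \<le> w / s * (T + 2 * s\<^sup>2 * n * R)"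
      using w s by (intro mult_left_mono) auto
    also have "\<dots> = 2 * s * n * (w * R) + w / s * T"
      using s by (simp add: distrib_left power2_eq_square)
    finally show "\<bar>\<Sum>i | i \<in> cell A side d \<omega> \<and> \<xi> i \<omega> \<in> B. \<psi> (\<xi> i \<omega>)\<bar>
      \<le> 2 * s * n * (w * measure P\<xi> B) * cell_prob A side d
        + w / s * (2 * n * measure P\<xi> B * r + p * ln (1 / r) + ln (2 / \<epsilon>))"
      using w s by (simp add: S_def T_def R_def mult_ac)
  qed (use E1 E2 in auto)
qed

end

text \<open>A measurable exceptional set replaces the event, because \<open>P\<close> will quantify
  over all directions or all estimates and may fail to be measurable.\<close>

definition except_prob :: "'a measure \<Rightarrow> real \<Rightarrow> ('a \<Rightarrow> bool) \<Rightarrow> bool" where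
  "except_prob M \<epsilon> P \<longleftrightarrow> (\<exists>E\<in>sets M. measure M E \<le> \<epsilon> \<and> (\<forall>\<omega>\<in>space M - E. P \<omega>))"

lemma except_prob_mono:
  assumes "except_prob M \<epsilon> P" "\<epsilon> \<le> \<epsilon>'" "\<And>\<omega>. \<omega> \<in> space M \<Longrightarrow> P \<omega> \<Longrightarrow> P' \<omega>"
  shows "except_prob M \<epsilon>' P'"
  using assms unfolding except_prob_def by (meson DiffD1 order_trans)

lemma except_prob_conj:
  assumes "except_prob M \<epsilon> P" "except_prob M \<epsilon>' P'"
  shows "except_prob M (\<epsilon> + \<epsilon>') (\<lambda>\<omega>. P \<omega> \<and> P' \<omega>)"
proof -
  obtain E E' where E: "E \<in> sets M" "measure M E \<le> \<epsilon>" "\<forall>\<omega>\<in>space M - E. P \<omega>"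
    and E': "E' \<in> sets M" "measure M E' \<le> \<epsilon>'" "\<forall>\<omega>\<in>space M - E'. P' \<omega>"
    using assms unfolding except_prob_def by blast
  have "measure M (E \<union> E') \<le> \<epsilon> + \<epsilon>'" using measure_Un_le[OF E(1) E'(1)] E(2) E'(2) by simp
  then show ?thesis
    unfolding except_prob_def using E E' by (intro bexI[of _ "E \<union> E'"]) auto
qed

lemma except_prob_all:
  assumes "finite I" "\<And>i. i \<in> I \<Longrightarrow> except_prob M (\<epsilon> i) (P i)"
  shows "except_prob M (\<Sum>i\<in>I. \<epsilon> i) (\<lambda>\<omega>. \<forall>i\<in>I. P i \<omega>)"
  using assms
proof (induction I rule: finite_induct)
  case empty
  show ?case unfolding except_prob_def by (intro bexI[of _ "{}"]) auto
next
  case (insert i I)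
  have "except_prob M (\<epsilon> i + (\<Sum>i\<in>I. \<epsilon> i)) (\<lambda>\<omega>. P i \<omega> \<and> (\<forall>i\<in>I. P i \<omega>))"
    using insert by (intro except_prob_conj) auto
  then show ?case using insert by simp
qed

lemma measure_le_except_prob:
  assumes "prob_space M" "except_prob M \<epsilon> P"
  shows "measure M {\<omega>\<in>space M. \<not> P \<omega>} \<le> \<epsilon>"
proof -
  interpret prob_space M by fact
  obtain E where E: "E \<in> sets M" "measure M E \<le> \<epsilon>" "\<forall>\<omega>\<in>space M - E. P \<omega>"
    using assms unfolding except_prob_def by blast
  then have "{\<omega>\<in>space M. \<not> P \<omega>} \<subseteq> E" by auto
  then have "measure M {\<omega>\<in>space M. \<not> P \<omega>} \<le> measure M E" using E(1) by (rule finite_measure_mono)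
  then show ?thesis using E(2) by simp
qed

lemma sum_dyadic: "(\<Sum>j<J. 1 / 2 ^ j) \<le> (2::real)"
proof -
  have "(\<Sum>j<J. 1 / 2 ^ j) = 2 - 2 / (2::real) ^ J" by (induction J) (auto simp: field_simps)
  then show ?thesis by simp
qed

lemma sum_weighted_dyadic: "(\<Sum>j<J. real j / 2 ^ j) \<le> 2"
proof -
  have "(\<Sum>j<J. real j / 2 ^ j) = 2 - (2 * real J + 2) / 2 ^ J"
  proof (induction J)
    case (Suc J)
    show ?case by (simp only: sum.lessThan_Suc Suc.IH) (simp add: field_simps)
  qed simp
  then show ?thesis by simp
qed

section \<open>Chebyshev's inequality and dyadic noise levels\<close>

context iid_model
begin

lemma measurable_at_pair:
  assumes "\<phi> \<in> borel_measurable Q" "i \<in> {1..n}"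
  shows "(\<lambda>\<omega>. \<phi> (X i \<omega>, \<xi> i \<omega>)) \<in> borel_measurable M"
  using measurable_compose[OF measurable_pair[OF assms(2)] assms(1)] .

lemma integral_at_pair:
  fixes \<phi> :: "_ \<Rightarrow> real"
  assumes "\<phi> \<in> borel_measurable Q" "i \<in> {1..n}"
  shows "integrable M (\<lambda>\<omega>. \<phi> (X i \<omega>, \<xi> i \<omega>)) \<longleftrightarrow> integrable Q \<phi>"
    and "(\<integral>\<omega>. \<phi> (X i \<omega>, \<xi> i \<omega>) \<partial>M) = (\<integral>w. \<phi> w \<partial>Q)"
proof -
  have "\<phi> \<in> borel_measurable Q" by fact
  then show "integrable M (\<lambda>\<omega>. \<phi> (X i \<omega>, \<xi> i \<omega>)) \<longleftrightarrow> integrable Q \<phi>"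
    using integrable_distr_eq[OF measurable_pair[OF assms(2)], of \<phi>] by (simp add: distr_pair[OF assms(2)])
  show "(\<integral>\<omega>. \<phi> (X i \<omega>, \<xi> i \<omega>) \<partial>M) = (\<integral>w. \<phi> w \<partial>Q)"
    using integral_distr[OF measurable_pair[OF assms(2)], of \<phi>] assms(1)
    by (simp add: distr_pair[OF assms(2)])
qed

lemma chebyshev:
  fixes \<phi> :: "_ \<Rightarrow> real"
  assumes \<phi> [measurable]: "\<phi> \<in> borel_measurable Q" and sq: "integrable Q (\<lambda>w. (\<phi> w)\<^sup>2)" and \<delta>: "0 < \<delta>"
  shows "except_prob M (n * (\<integral>w. (\<phi> w)\<^sup>2 \<partial>Q) / \<delta>\<^sup>2)
     (\<lambda>\<omega>. \<bar>(\<Sum>i\<in>{1..n}. \<phi> (X i \<omega>, \<xi> i \<omega>)) - n * (\<integral>w. \<phi> w \<partial>Q)\<bar> < \<delta>)"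
proof -
  define m where "m = (\<integral>w. \<phi> w \<partial>Q)"
  define g where "g w = \<phi> w - m" for w
  have [measurable]: "g \<in> borel_measurable Q" unfolding g_def by measurable
  have int: "integrable Q \<phi>" by (rule square_integrable_imp_integrable[OF \<phi> sq])
  then have g: "integrable Q g" "(\<integral>w. g w \<partial>Q) = 0"
    unfolding g_def by (simp_all add: m_def prob_space)
  have g2: "integrable Q (\<lambda>w. (g w)\<^sup>2)" "(\<integral>w. (g w)\<^sup>2 \<partial>Q) \<le> (\<integral>w. (\<phi> w)\<^sup>2 \<partial>Q)"
  proof -
    have eq: "(\<lambda>w. (g w)\<^sup>2) = (\<lambda>w. (\<phi> w)\<^sup>2 - 2 * m * \<phi> w + m\<^sup>2)"
      by (simp add: g_def power2_eq_square algebra_simps)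
    show "integrable Q (\<lambda>w. (g w)\<^sup>2)" unfolding eq using int sq by simp
    have "(\<integral>w. (g w)\<^sup>2 \<partial>Q) = (\<integral>w. (\<phi> w)\<^sup>2 \<partial>Q) - m\<^sup>2"
      unfolding eq using int sq by (simp add: prob_space m_def[symmetric] power2_eq_square)
    then show "(\<integral>w. (g w)\<^sup>2 \<partial>Q) \<le> (\<integral>w. (\<phi> w)\<^sup>2 \<partial>Q)" by simp
  qed
  define Y where "Y i \<omega> = g (X i \<omega>, \<xi> i \<omega>)" for i \<omega>
  have Y: "integrable M (Y i)" "(\<integral>\<omega>. Y i \<omega> \<partial>M) = 0" "integrable M (\<lambda>\<omega>. (Y i \<omega>)\<^sup>2)"
    "(\<integral>\<omega>. (Y i \<omega>)\<^sup>2 \<partial>M) = (\<integral>w. (g w)\<^sup>2 \<partial>Q)" "Y i \<in> borel_measurable M" if "i \<in> {1..n}" for i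
    using integral_at_pair[of g i] integral_at_pair[of "\<lambda>w. (g w)\<^sup>2" i] measurable_at_pair[of g i] that g g2(1)
    by (simp_all add: Y_def[abs_def])
  have "M.indep_vars (\<lambda>_. vec_space p \<Otimes>\<^sub>M borel) (\<lambda>i \<omega>. (X i \<omega>, \<xi> i \<omega>)) {1..n}"
    using sample by (simp add: iid_sample_def)
  then have ind: "M.indep_vars (\<lambda>_. borel) Y {1..n}"
    unfolding Y_def by (rule M.indep_vars_compose2) simp
  have cross: "integrable M (\<lambda>\<omega>. Y i \<omega> * Y j \<omega>) \<and> (\<integral>\<omega>. Y i \<omega> * Y j \<omega> \<partial>M) = (if i = j then (\<integral>w. (g w)\<^sup>2 \<partial>Q) else 0)"
    if ij: "i \<in> {1..n}" "j \<in> {1..n}" for i j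
  proof (cases "i = j")
    case True
    then show ?thesis using Y[OF ij(1)] by (simp add: power2_eq_square)
  next
    case False
    have "M.indep_vars (\<lambda>_. borel) Y {i, j}" using ind ij by (intro M.indep_vars_subset[OF ind]) auto
    then show ?thesis
      using M.indep_vars_lebesgue_integral[of "{i, j}" Y] M.indep_vars_integrable[of "{i, j}" Y] Y(1,2) ij False by auto
  qed
  let ?S = "\<lambda>\<omega>. \<Sum>i\<in>{1..n}. Y i \<omega>"
  have sqS: "(\<lambda>\<omega>. (?S \<omega>)\<^sup>2) = (\<lambda>\<omega>. \<Sum>i\<in>{1..n}. \<Sum>j\<in>{1..n}. Y i \<omega> * Y j \<omega>)"
    by (simp add: power2_eq_square sum_product)
  have S2: "integrable M (\<lambda>\<omega>. (?S \<omega>)\<^sup>2)" unfolding sqS using cross by (intro Bochner_Integration.integrable_sum) blast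
  have cross_int: "integrable M (\<lambda>\<omega>. Y i \<omega> * Y j \<omega>)" if "i \<in> {1..n}" "j \<in> {1..n}" for i j
    using cross[OF that] by simp
  have "(\<integral>\<omega>. (?S \<omega>)\<^sup>2 \<partial>M) = (\<Sum>i\<in>{1..n}. \<integral>\<omega>. (\<Sum>j\<in>{1..n}. Y i \<omega> * Y j \<omega>) \<partial>M)"
    unfolding sqS by (rule Bochner_Integration.integral_sum) (rule Bochner_Integration.integrable_sum, rule cross_int)
  also have "\<dots> = (\<Sum>i\<in>{1..n}. \<Sum>j\<in>{1..n}. \<integral>\<omega>. Y i \<omega> * Y j \<omega> \<partial>M)"
    by (rule sum.cong[OF refl], rule Bochner_Integration.integral_sum, rule cross_int)
  also have "\<dots> = (\<Sum>i\<in>{1..n}. \<Sum>j\<in>{1..n}. if i = j then (\<integral>w. (g w)\<^sup>2 \<partial>Q) else 0)"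
    using cross by (intro sum.cong) auto
  also have "\<dots> = n * (\<integral>w. (g w)\<^sup>2 \<partial>Q)" by simp
  finally have ES: "(\<integral>\<omega>. (?S \<omega>)\<^sup>2 \<partial>M) \<le> n * (\<integral>w. (\<phi> w)\<^sup>2 \<partial>Q)"
    using g2(2) by (simp add: mult_left_mono)
  have Sm [measurable]: "?S \<in> borel_measurable M" using Y(5) by measurable
  have "measure M {\<omega>\<in>space M. \<bar>?S \<omega>\<bar> \<ge> \<delta>} \<le> (\<integral>\<omega>. (?S \<omega>)\<^sup>2 \<partial>M) / \<delta>\<^sup>2"
    by (rule M.second_moment_method[OF _ S2 \<delta>]) measurable
  also have "\<dots> \<le> n * (\<integral>w. (\<phi> w)\<^sup>2 \<partial>Q) / \<delta>\<^sup>2" using ES by (intro divide_right_mono) auto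
  finally have "measure M {\<omega>\<in>space M. \<bar>?S \<omega>\<bar> \<ge> \<delta>} \<le> n * (\<integral>w. (\<phi> w)\<^sup>2 \<partial>Q) / \<delta>\<^sup>2" .
  moreover have "?S \<omega> = (\<Sum>i\<in>{1..n}. \<phi> (X i \<omega>, \<xi> i \<omega>)) - n * m" for \<omega>
    by (simp add: Y_def g_def sum_subtractf)
  moreover have "{\<omega>\<in>space M. \<bar>?S \<omega>\<bar> \<ge> \<delta>} \<in> sets M" by measurable
  ultimately show ?thesis
    unfolding except_prob_def m_def[symmetric]
    by (intro bexI[of _ "{\<omega>\<in>space M. \<bar>?S \<omega>\<bar> \<ge> \<delta>}"]) auto
qed

lemma truncated_noise_levels:
  fixes y :: "nat \<Rightarrow> real"
  assumes c: "finite c" and w: "\<And>j. w (Suc j) \<le> w j"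
  shows "(\<Sum>i | i \<in> c \<and> \<bar>y i\<bar> \<le> w 0. y i) =
     (\<Sum>j<J. \<Sum>i | i \<in> c \<and> w (Suc j) < \<bar>y i\<bar> \<and> \<bar>y i\<bar> \<le> w j. y i) + (\<Sum>i | i \<in> c \<and> \<bar>y i\<bar> \<le> w J. y i)"
proof (induction J)
  case (Suc J)
  have "(\<Sum>i | i \<in> c \<and> \<bar>y i\<bar> \<le> w J. y i) = (\<Sum>i\<in>{i\<in>c. w (Suc J) < \<bar>y i\<bar> \<and> \<bar>y i\<bar> \<le> w J} \<union> {i\<in>c. \<bar>y i\<bar> \<le> w (Suc J)}. y i)"
    using w[of J] by (intro sum.cong) auto
  also have "\<dots> = (\<Sum>i | i \<in> c \<and> w (Suc J) < \<bar>y i\<bar> \<and> \<bar>y i\<bar> \<le> w J. y i) + (\<Sum>i | i \<in> c \<and> \<bar>y i\<bar> \<le> w (Suc J). y i)"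
    using c by (intro sum.union_disjoint) auto
  finally show ?case using Suc.IH by simp
qed simp

text \<open>On level \<open>j\<close> the noise exceeds \<open>w j / 2\<close>, and the levels are
  disjoint, so the sum is at most twice the first absolute moment however many levels there
  are.\<close>

lemma sum_level_prob:
  assumes int: "integrable P\<xi> (\<lambda>y. \<bar>y\<bar>)" and w: "\<And>j. w (Suc j) = w j / 2" "\<And>j. 0 < w j"
  shows "(\<Sum>j<J. w j * measure P\<xi> {y. w (Suc j) < \<bar>y\<bar> \<and> \<bar>y\<bar> \<le> w j}) \<le> 2 * (\<integral>y. \<bar>y\<bar> \<partial>P\<xi>)"
proof -
  have mono: "w j \<le> w 0" for j
  proof (induction j)
    case (Suc j)
    then show ?case using w(1)[of j] w(2)[of j] by simp
  qed simp
  define B where "B j = {y. w (Suc j) < \<bar>y\<bar> \<and> \<bar>y\<bar> \<le> w j}" for j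
  have B [measurable]: "B j \<in> sets P\<xi>" for j unfolding B_def P\<xi>(2) by measurable
  have intB: "integrable P\<xi> (\<lambda>y. \<bar>y\<bar> * indicator (B j) y)" for j
    by (rule Bochner_Integration.integrable_bound[OF int]) (use int in \<open>auto simp: indicator_def\<close>)
  have "w j * measure P\<xi> (B j) \<le> 2 * (\<integral>y. \<bar>y\<bar> * indicator (B j) y \<partial>P\<xi>)" for j
  proof -
    have "w j * measure P\<xi> (B j) = 2 * (\<integral>y. w (Suc j) * indicator (B j) y \<partial>P\<xi>)"
      using B by (simp add: w(1) space_P\<xi>)
    also have "(\<integral>y. w (Suc j) * indicator (B j) y \<partial>P\<xi>) \<le> (\<integral>y. \<bar>y\<bar> * indicator (B j) y \<partial>P\<xi>)"
    proof (rule integral_mono[OF _ intB])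
      show "integrable P\<xi> (\<lambda>y. w (Suc j) * indicator (B j) y)" 
        by (intro integrable_mult_right integrable_real_indicator B) (simp add: P\<xi>.emeasure_eq_measure)
    qed (auto simp: B_def indicator_def)
    finally show ?thesis by simp
  qed
  then have "(\<Sum>j<J. w j * measure P\<xi> (B j)) \<le> (\<Sum>j<J. 2 * (\<integral>y. \<bar>y\<bar> * indicator (B j) y \<partial>P\<xi>))"
    by (rule sum_mono)
  also have "\<dots> = 2 * (\<integral>y. (\<Sum>j<J. \<bar>y\<bar> * indicator (B j) y) \<partial>P\<xi>)"
    by (subst Bochner_Integration.integral_sum, rule intB, rule sum_distrib_left[symmetric])
  also have "(\<integral>y. (\<Sum>j<J. \<bar>y\<bar> * indicator (B j) y) \<partial>P\<xi>) \<le> (\<integral>y. \<bar>y\<bar> \<partial>P\<xi>)"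
  proof (rule integral_mono)
    fix y :: real
    have tel: "(\<Sum>j<J. \<bar>y\<bar> * indicator (B j) y) = \<bar>y\<bar> * indicator {y. w J < \<bar>y\<bar> \<and> \<bar>y\<bar> \<le> w 0} y"
    proof (induction J)
      case (Suc J)
      show ?case using Suc mono[of J] w(1)[of J] w(2)[of J] by (auto simp: B_def indicator_def)
    qed (auto simp: indicator_def)
    show "(\<Sum>j<J. \<bar>y\<bar> * indicator (B j) y) \<le> \<bar>y\<bar>" unfolding tel by (simp add: indicator_def)
  qed (rule Bochner_Integration.integrable_sum, rule intB, rule int)
  finally show ?thesis by (simp add: B_def)
qed

end

context iid_model
begin

lemma bounded_noise:
  fixes s L \<epsilon> :: real
  assumes p: "1 \<le> p" "p \<le> n" and A: "A \<in> sets (vec_space p)"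
    and \<psi>: "\<psi> \<in> borel_measurable borel" "\<And>y. \<psi> (- y) = - \<psi> y" "\<And>y. \<bar>\<psi> y\<bar> \<le> L"
    and L: "0 < L" and s: "0 < s" "s \<le> 1/2" and \<epsilon>: "0 < \<epsilon>"
  shows "except_prob M \<epsilon> (\<lambda>\<omega>. \<forall>d. \<bar>\<Sum>i\<in>cell A side d \<omega>. \<psi> (\<xi> i \<omega>)\<bar>
      \<le> 2 * s * n * L * cell_prob A side d + L / s * entropy (\<epsilon> / 2))"
proof -
  have r: "0 < real p / n" "real p / n \<le> 1" using p by auto
  have "except_prob M \<epsilon> (\<lambda>\<omega>. \<forall>d. \<bar>\<Sum>i | i \<in> cell A side d \<omega> \<and> \<xi> i \<omega> \<in> UNIV. \<psi> (\<xi> i \<omega>)\<bar>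
      \<le> 2 * s * n * (L * measure P\<xi> UNIV) * cell_prob A side d
        + L / s * (2 * n * measure P\<xi> UNIV * (p / n) + p * ln (1 / (p / n)) + ln (2 / \<epsilon>)))"
    unfolding except_prob_def by (rule noise_tail[OF A _ _ \<psi>(1,2) _ L s r \<epsilon>]) (auto intro: \<psi>(3))
  then show ?thesis
  proof (rule except_prob_mono)
    fix \<omega>
    assume *: "\<forall>d. \<bar>\<Sum>i | i \<in> cell A side d \<omega> \<and> \<xi> i \<omega> \<in> UNIV. \<psi> (\<xi> i \<omega>)\<bar>
      \<le> 2 * s * n * (L * measure P\<xi> UNIV) * cell_prob A side d
        + L / s * (2 * n * measure P\<xi> UNIV * (p / n) + p * ln (1 / (p / n)) + ln (2 / \<epsilon>))"
    have "measure P\<xi> UNIV = 1" using P\<xi>.prob_space by (simp add: space_P\<xi>)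
    then have "2 * n * measure P\<xi> UNIV * (p / n) + p * ln (1 / (p / n)) + ln (2 / \<epsilon>) \<le> entropy (\<epsilon> / 2)"
      using entropy_bound[OF p, of 1 "\<epsilon> / 2"] by simp
    then have "L / s * (2 * n * measure P\<xi> UNIV * (p / n) + p * ln (1 / (p / n)) + ln (2 / \<epsilon>)) \<le> L / s * entropy (\<epsilon> / 2)"
      using L s by (intro mult_left_mono) auto
    then show "\<forall>d. \<bar>\<Sum>i\<in>cell A side d \<omega>. \<psi> (\<xi> i \<omega>)\<bar>
      \<le> 2 * s * n * L * cell_prob A side d + L / s * entropy (\<epsilon> / 2)"
      using * \<open>measure P\<xi> UNIV = 1\<close> by (simp del: times_divide_eq_left) (meson add_left_mono order_trans)
  qed simp
qed

text \<open>The noise is cut into dyadic levels.  At level \<open>w\<close> only about \<open>n / w\<close> of the design points are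
  active, which is what lowers the entropy from \<open>p ln (n / p)\<close> to \<open>p ln (n / (p w))\<close>.\<close>

lemma truncated_noise:
  fixes s K \<epsilon> :: real
  assumes p: "1 \<le> p" "p * K \<le> n" and A: "A \<in> sets (vec_space p)"
    and int: "integrable P\<xi> (\<lambda>y. \<bar>y\<bar>)"
    and K: "0 < K" and s: "0 < s" "s \<le> 1/2" and \<epsilon>: "0 < \<epsilon>" "\<epsilon> \<le> 1"
  defines "m \<equiv> \<integral>y. \<bar>y\<bar> \<partial>P\<xi>"
  shows "except_prob M \<epsilon> (\<lambda>\<omega>. \<forall>d. \<bar>\<Sum>i | i \<in> cell A side d \<omega> \<and> \<bar>\<xi> i \<omega>\<bar> \<le> K. \<xi> i \<omega>\<bar>
      \<le> 2 * s * n * (2 * m + 1) * cell_prob A side d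
        + p * K / s * (4 * m + 3 * ln (n / (p * K)) + 3 * ln (1 / \<epsilon>) + 15))"
proof -
  \<comment> \<open>Halving \<open>J\<close> times brings the level below one; the noise that
    remains is treated as a single bounded level.\<close>
  obtain J :: nat where J: "K < 2 ^ J" using real_arch_pow[of 2 K] by auto
  define w where "w j = K / 2 ^ j" for j :: nat
  have w: "w (Suc j) = w j / 2" "0 < w j" "w j \<le> K" for j
    using K by (auto simp: w_def field_simps)
  have wJ: "w J \<le> 1" using J by (simp add: w_def)
  define B where "B j = (if j < J then {y. w (Suc j) < \<bar>y\<bar> \<and> \<bar>y\<bar> \<le> w j} else {y. \<bar>y\<bar> \<le> w J})" for j
  have B: "B j \<in> sets borel" "\<And>y. - y \<in> B j \<longleftrightarrow> y \<in> B j" "\<And>y. y \<in> B j \<Longrightarrow> j \<le> J \<Longrightarrow> \<bar>y\<bar> \<le> w j" for j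
    by (auto simp: B_def le_less split: if_splits)
  define q where "q j = measure P\<xi> (B j)" for j
  \<comment> \<open>The failure probabilities decay geometrically. Then \<open>ln (2 / e j)\<close>
    grows linearly in \<open>j\<close>, which the factor \<open>w j\<close> makes summable.\<close>
  define e where "e j = (if j < J then \<epsilon> / 2 ^ (j + 2) else \<epsilon> / 2)" for j
  have e: "0 < e j" for j using \<epsilon> by (simp add: e_def)
  \<comment> \<open>Since \<open>q j\<close> is at most of order \<open>1 / w j\<close>, the
    parameter may be as large as \<open>p * w j / n\<close>. This lowers the logarithm to
    \<open>ln (n / (p * w j))\<close> while the first term stays summable.\<close>
  define R where "R j = 2 * n * q j * (p * w j / n) + p * ln (1 / (p * w j / n)) + ln (2 / e j)" for j
  define P where "P j \<omega> \<longleftrightarrow> (\<forall>d. \<bar>\<Sum>i | i \<in> cell A side d \<omega> \<and> \<xi> i \<omega> \<in> B j. \<xi> i \<omega>\<bar>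
      \<le> 2 * s * n * (w j * q j) * cell_prob A side d + w j / s * R j)" for j \<omega>
  have level: "except_prob M (e j) (P j)" if "j \<in> {..J}" for j
  proof -
    have "real p * w j \<le> n" using p w(3)[of j] mult_left_mono[of "w j" K "real p"] by linarith
    moreover have "0 < real p * w j" using p w(2)[of j] by simp
    ultimately have r: "0 < p * w j / n" "p * w j / n \<le> 1" using n by auto
    show ?thesis
      unfolding except_prob_def P_def R_def q_def
      by (rule noise_tail[OF A B(1,2) _ _ _ w(2) s r e]) (use B(3) that in auto)
  qed
  have sum_e: "(\<Sum>j\<in>{..J}. e j) \<le> \<epsilon>"
  proof -
    have "(\<Sum>j\<in>{..J}. e j) = \<epsilon> / 4 * (\<Sum>j<J. 1 / 2 ^ j) + \<epsilon> / 2"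
      by (simp add: lessThan_Suc_atMost[symmetric] e_def sum_distrib_left)
    also have "\<dots> \<le> \<epsilon> / 4 * 2 + \<epsilon> / 2" using \<epsilon> sum_dyadic[of J] by (intro add_mono mult_left_mono) auto
    finally show ?thesis by simp
  qed
  define L where "L = ln (n / (p * K))"
  define l where "l = ln (1 / \<epsilon>)"
  have L: "0 \<le> L" and l: "0 \<le> l" using p K \<epsilon> by (auto simp: L_def l_def)
  have p1: "1 \<le> real p" using p(1) by simp
  have m: "0 \<le> m" unfolding m_def by simp
  have ln_r: "ln (1 / (p * w j / n)) = L + j * ln 2" for j
    using p K n by (simp add: w_def L_def ln_div ln_mult ln_realpow)
  have ln2: "0 < ln (2::real)" "ln (2::real) \<le> 1" using ln_add_one_self_le_self[of 1] by auto
  have jln2: "j * ln 2 \<le> real j" for j :: nat using ln2 by (simp add: mult_left_le)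
  have sum_wq: "(\<Sum>j<J. w j * q j) \<le> 2 * m"
    using sum_level_prob[where w = w and J = J, OF int w(1,2)] by (simp add: q_def B_def m_def)
  have q: "0 \<le> q j" "q j \<le> 1" for j unfolding q_def by auto
  have wqJ: "w J * q J \<le> 1" using wJ q w(2)[of J] by (intro mult_le_one) auto
  have first: "w j * (2 * n * q j * (p * w j / n)) \<le> 2 * p * K * (w j * q j)" for j
  proof -
    have "w j * (2 * n * q j * (p * w j / n)) = 2 * p * w j * (w j * q j)" using n by simp
    also have "\<dots> \<le> 2 * p * K * (w j * q j)"
      using w[of j] q[of j] by (intro mult_right_mono mult_left_mono) auto
    finally show ?thesis .
  qed
  have level_le: "w j * R j \<le> 2 * p * K * (w j * q j) + p * K * ((L + 3 + l) * (1 / 2 ^ j) + 2 * (real j / 2 ^ j))"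
    if "j < J" for j
  proof -
    have "2 / e j = 2 ^ (j + 3) / \<epsilon>" using that by (simp add: e_def power_add)
    then have "ln (2 / e j) = ln (2 ^ (j + 3)) - ln \<epsilon>" using \<epsilon> by (simp add: ln_div)
    also have "ln (2 ^ (j + 3)) = real (j + 3) * ln (2::real)" by (rule ln_realpow)
    finally have "ln (2 / e j) = (real j + 3) * ln 2 + l"
      using \<epsilon> by (simp add: l_def ln_div)
    also have "\<dots> \<le> 1 * (j + 3 + l)" using ln2 mult_left_mono[of "ln 2" 1 "real j + 3"] by simp
    also have "1 * (j + 3 + l) \<le> p * (j + 3 + l)"
      using p1 l by (intro mult_right_mono) auto
    finally have "ln (2 / e j) \<le> p * (j + 3 + l)" by simp
    moreover have "p * ln (1 / (p * w j / n)) \<le> p * (L + j)"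
      unfolding ln_r using jln2[of j] by (intro mult_left_mono) auto
    ultimately have "p * ln (1 / (p * w j / n)) + ln (2 / e j) \<le> p * ((L + 3 + l) + 2 * j)"
      by (simp add: algebra_simps)
    then have "w j * (p * ln (1 / (p * w j / n)) + ln (2 / e j)) \<le> w j * (p * ((L + 3 + l) + 2 * j))"
      using w(2)[of j] by (intro mult_left_mono) auto
    also have "\<dots> = p * K * ((L + 3 + l) * (1 / 2 ^ j) + 2 * (real j / 2 ^ j))"
      by (simp add: w_def field_simps)
    finally show ?thesis using first[of j] by (simp add: R_def distrib_left)
  qed
  have "(\<Sum>j<J. w j * R j) \<le> (\<Sum>j<J. 2 * p * K * (w j * q j) + p * K * ((L + 3 + l) * (1 / 2 ^ j) + 2 * (real j / 2 ^ j)))"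
    using level_le by (intro sum_mono) auto
  also have "\<dots> = 2 * p * K * (\<Sum>j<J. w j * q j) + p * K * ((L + 3 + l) * (\<Sum>j<J. 1 / 2 ^ j) + 2 * (\<Sum>j<J. real j / 2 ^ j))"
    by (simp only: sum.distrib flip: sum_distrib_left)
  also have "\<dots> \<le> 2 * p * K * (2 * m) + p * K * ((L + 3 + l) * 2 + 2 * 2)"
    using sum_wq sum_dyadic[of J] sum_weighted_dyadic[of J] K L l
    by (intro add_mono mult_left_mono) auto
  finally have sum_R: "(\<Sum>j<J. w j * R j) \<le> p * K * (4 * m + 2 * L + 2 * l + 10)"
    by (simp add: algebra_simps)
  have last_R: "w J * R J \<le> p * K * (L + l + 5)"
  proof -
    have "w J * (2 * n * q J * (p * w J / n)) \<le> 2 * p * K * 1"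
      using first[of J] mult_left_mono[OF wqJ, of "2 * p * K"] K by simp
    moreover have "w J * (p * ln (1 / (p * w J / n))) \<le> p * K * (L + 1)"
    proof -
      have "real J \<le> 2 ^ J" by (rule less_imp_le[OF of_nat_less_two_power])
      then have "real J / 2 ^ J \<le> 1" by simp
      moreover have "L / 2 ^ J \<le> L / 1" using L by (intro divide_left_mono) auto
      ultimately have "L / 2 ^ J + real J / 2 ^ J \<le> L + 1" by linarith
      then have "p * K * (L / 2 ^ J + real J / 2 ^ J) \<le> p * K * (L + 1)" using K by (intro mult_left_mono) auto
      moreover have "w J * (p * ln (1 / (p * w J / n))) \<le> w J * (p * (L + J))"
        unfolding ln_r using jln2[of J] w(2)[of J] by (intro mult_left_mono) auto
      moreover have "w J * (p * (L + J)) = p * K * (L / 2 ^ J + real J / 2 ^ J)"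
        by (simp add: w_def field_simps)
      ultimately show ?thesis by linarith
    qed
    moreover have "w J * ln (2 / e J) \<le> p * K * (2 + l)"
    proof -
      have "ln (2 / e J) = ln (2 ^ 2 / \<epsilon>)" by (simp add: e_def)
      also have "\<dots> = 2 * ln 2 + l"
        using \<epsilon> ln_realpow[of "2::real" 2] by (simp add: l_def ln_div)
      finally have "ln (2 / e J) \<le> 2 + l" "0 \<le> 2 + l" "0 \<le> ln (2 / e J)" using ln2 l by auto
      then have "w J * ln (2 / e J) \<le> K * (2 + l)"
        using w[of J] K by (intro mult_mono) auto
      also have "\<dots> \<le> p * (K * (2 + l))" using p K \<open>0 \<le> 2 + l\<close> mult_right_mono[of 1 "real p" "K * (2 + l)"] by simp
      finally show ?thesis by (simp add: mult.assoc)
    qed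
    ultimately show ?thesis by (simp add: R_def distrib_left algebra_simps)
  qed
  have "except_prob M (\<Sum>j\<in>{..J}. e j) (\<lambda>\<omega>. \<forall>j\<in>{..J}. P j \<omega>)"
    by (rule except_prob_all) (use level in auto)
  then show ?thesis
  proof (rule except_prob_mono[OF _ sum_e], intro allI)
    fix \<omega> d assume *: "\<forall>j\<in>{..J}. P j \<omega>"
    let ?c = "cell A side d \<omega>" and ?P = "cell_prob A side d"
    define S where "S j = (\<Sum>i | i \<in> ?c \<and> \<xi> i \<omega> \<in> B j. \<xi> i \<omega>)" for j
    have P: "0 \<le> ?P" unfolding cell_prob_def by simp
    have S: "\<bar>S j\<bar> \<le> 2 * s * n * ?P * (w j * q j) + 1 / s * (w j * R j)" if "j \<le> J" for j
      using *[unfolded P_def, rule_format, of j d] that by (simp add: S_def mult_ac)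
    have w0: "w 0 = K" by (simp add: w_def)
    have "(\<Sum>i | i \<in> ?c \<and> \<bar>\<xi> i \<omega>\<bar> \<le> K. \<xi> i \<omega>) = (\<Sum>j<J. S j) + S J"
    proof -
      have "w (Suc j) \<le> w j" for j using w(1)[of j] w(2)[of j] by simp
      from truncated_noise_levels[where w = w and y = "\<lambda>i. \<xi> i \<omega>" and J = J, OF finite_cell this, of A side d \<omega>]
      show ?thesis by (simp add: S_def B_def w0)
    qed
    then have "\<bar>\<Sum>i | i \<in> ?c \<and> \<bar>\<xi> i \<omega>\<bar> \<le> K. \<xi> i \<omega>\<bar> \<le> (\<Sum>j<J. \<bar>S j\<bar>) + \<bar>S J\<bar>"
      using sum_abs[of S "{..<J}"] by linarith
    also have "\<dots> \<le> (\<Sum>j<J. 2 * s * n * ?P * (w j * q j) + 1 / s * (w j * R j))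
        + (2 * s * n * ?P * (w J * q J) + 1 / s * (w J * R J))"
      using S by (intro add_mono sum_mono) auto
    also have "\<dots> = 2 * s * n * ?P * ((\<Sum>j<J. w j * q j) + w J * q J) + 1 / s * ((\<Sum>j<J. w j * R j) + w J * R J)"
      by (simp only: sum.distrib distrib_left flip: sum_distrib_left)
    also have "\<dots> \<le> 2 * s * n * ?P * (2 * m + 1) + 1 / s * (p * K * (4 * m + 2 * L + 2 * l + 10) + p * K * (L + l + 5))"
      using sum_wq wqJ sum_R last_R P s by (intro add_mono mult_left_mono) auto
    also have "\<dots> = 2 * s * n * (2 * m + 1) * ?P + p * K / s * (4 * m + 3 * L + 3 * l + 15)"
      by (simp add: field_simps)
    finally show "\<bar>\<Sum>i | i \<in> ?c \<and> \<bar>\<xi> i \<omega>\<bar> \<le> K. \<xi> i \<omega>\<bar>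
      \<le> 2 * s * n * (2 * m + 1) * ?P + p * K / s * (4 * m + 3 * ln (n / (p * K)) + 3 * ln (1 / \<epsilon>) + 15)"
      by (simp add: L_def l_def)
  qed
qed

lemma integral_noise:
  fixes \<phi> :: "real \<Rightarrow> real"
  assumes "\<phi> \<in> borel_measurable borel"
  shows "integrable Q (\<lambda>w. \<phi> (snd w)) \<longleftrightarrow> integrable P\<xi> \<phi>"
    and "(\<integral>w. \<phi> (snd w) \<partial>Q) = (\<integral>y. \<phi> y \<partial>P\<xi>)"
proof -
  have d: "distr Q P\<xi> snd = P\<xi>"
  proof (rule measure_eqI)
    fix A assume "A \<in> sets (distr Q P\<xi> snd)"
    then have A: "A \<in> sets P\<xi>" by simp
    have "snd -` A \<inter> space Q = space PX \<times> A"
      using sets.sets_into_space[OF A] by (auto simp: space_pair_measure)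
    then show "emeasure (distr Q P\<xi> snd) A = emeasure P\<xi> A"
      using A by (simp add: emeasure_distr P\<xi>.emeasure_pair_measure_Times PX.emeasure_space_1)
  qed simp
  have \<phi>: "\<phi> \<in> borel_measurable P\<xi>" using assms by (simp add: measurable_cong_sets[OF P\<xi>(2) refl])
  show "integrable Q (\<lambda>w. \<phi> (snd w)) \<longleftrightarrow> integrable P\<xi> \<phi>"
    using integrable_distr_eq[of snd Q P\<xi> \<phi>] \<phi> by (simp add: d)
  show "(\<integral>w. \<phi> (snd w) \<partial>Q) = (\<integral>y. \<phi> y \<partial>P\<xi>)"
    using integral_distr[of snd Q P\<xi> \<phi>] \<phi> by (simp add: d)
qed

text \<open>By Markov's inequality, truncating at a large multiple of \<open>max_abs_mean\<close>
  changes nothing outside a small event; this is how that quantity enters the rate of the squared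
  loss.\<close>

lemma max_noise:
  assumes int: "integrable P\<xi> (\<lambda>y. \<bar>y\<bar>)"
  shows "(\<integral>y. \<bar>y\<bar> \<partial>P\<xi>) \<le> max_abs_mean n M \<xi>"
    and "0 < c \<Longrightarrow> except_prob M (max_abs_mean n M \<xi> / c) (\<lambda>\<omega>. \<forall>i\<in>{1..n}. \<bar>\<xi> i \<omega>\<bar> < c)"
proof -
  let ?m = "\<lambda>\<omega>. MAX i\<in>{1..n}. \<bar>\<xi> i \<omega>\<bar>"
  have absQ: "(\<lambda>w. \<bar>snd w\<bar>) \<in> borel_measurable Q" by measurable
  have \<xi>: "integrable M (\<lambda>\<omega>. \<bar>\<xi> i \<omega>\<bar>)" "(\<integral>\<omega>. \<bar>\<xi> i \<omega>\<bar> \<partial>M) = (\<integral>y. \<bar>y\<bar> \<partial>P\<xi>)" if "i \<in> {1..n}" for i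
    using integral_at_pair[OF absQ that] integral_noise[of "\<lambda>y. \<bar>y\<bar>"] int by auto
  have ne: "{1..n} \<noteq> {}" using n by auto
  have meas: "?m \<in> borel_measurable M"
  proof (rule borel_measurable_Max)
    fix i assume "i \<in> {1..n}"
    from borel_measurable_integrable[OF \<xi>(1)[OF this]] show "(\<lambda>\<omega>. \<bar>\<xi> i \<omega>\<bar>) \<in> borel_measurable M" .
  qed simp
  have nonneg: "0 \<le> ?m \<omega>" for \<omega>
    using n by (subst Max_ge_iff) (auto intro!: bexI[of _ 1])
  have intm: "integrable M ?m"
  proof (rule Bochner_Integration.integrable_bound[OF _ meas])
    show "integrable M (\<lambda>\<omega>. \<Sum>i\<in>{1..n}. \<bar>\<xi> i \<omega>\<bar>)" by (intro Bochner_Integration.integrable_sum \<xi>)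
    have "?m \<omega> \<le> (\<Sum>i\<in>{1..n}. \<bar>\<xi> i \<omega>\<bar>)" for \<omega>
      using ne by (subst Max_le_iff) (auto intro!: member_le_sum)
    then show "AE \<omega> in M. norm (?m \<omega>) \<le> norm (\<Sum>i\<in>{1..n}. \<bar>\<xi> i \<omega>\<bar>)"
      using nonneg by (auto simp: sum_nonneg)
  qed
  have one: "1 \<in> {1..n}" using n by auto
  have "(\<integral>y. \<bar>y\<bar> \<partial>P\<xi>) = (\<integral>\<omega>. \<bar>\<xi> 1 \<omega>\<bar> \<partial>M)" using \<xi>(2)[OF one] by simp
  also have "\<dots> \<le> (\<integral>\<omega>. ?m \<omega> \<partial>M)"
    by (intro integral_mono intm \<xi>(1)[OF one] Max_ge) (use one in auto)
  finally show "(\<integral>y. \<bar>y\<bar> \<partial>P\<xi>) \<le> max_abs_mean n M \<xi>" unfolding max_abs_mean_def .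
  assume c: "0 < c"
  have "measure M {\<omega>\<in>space M. ?m \<omega> \<ge> c} \<le> (\<integral>\<omega>. ?m \<omega> \<partial>M) / c"
    by (rule integral_Markov_inequality_measure[OF intm, of "{}"]) (use nonneg c in auto)
  moreover have "{\<omega>\<in>space M. ?m \<omega> \<ge> c} \<in> sets M" using meas by measurable
  ultimately show "except_prob M (max_abs_mean n M \<xi> / c) (\<lambda>\<omega>. \<forall>i\<in>{1..n}. \<bar>\<xi> i \<omega>\<bar> < c)"
    unfolding except_prob_def max_abs_mean_def using ne
    by (intro bexI[of _ "{\<omega>\<in>space M. ?m \<omega> \<ge> c}"]) (auto simp: not_le)
qed

end

section \<open>The losses\<close>

text \<open>At \<open>k = 0\<close> the value \<open>sgn 0 = 0\<close> selects the subgradient that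
  keeps \<open>score\<close> odd, hence centred under symmetric noise.\<close>

definition score :: "ennreal \<Rightarrow> real \<Rightarrow> real" where
  "score k x = (if k = 0 then sgn x else if k = \<infinity> then x
     else (enn2real k + 1) / enn2real k * max (- enn2real k) (min (enn2real k) x))"

definition bregman :: "ennreal \<Rightarrow> real \<Rightarrow> real \<Rightarrow> real" where
  "bregman k t x = scaled_huber k (x + t) - scaled_huber k x - t * score k x"

text \<open>The Huber function is the supremum of \<open>s * x - s\<^sup>2 / 2\<close> over slopes
  \<open>\<bar>s\<bar> \<le> k\<close>, attained at the clipped \<open>x\<close>. Convexity and the
  subgradient inequality follow from this without derivatives.\<close>

lemma huber_ge:
  assumes "\<bar>s\<bar> \<le> k"
  shows "s * x - s\<^sup>2 / 2 \<le> huber k x"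
proof (cases "\<bar>x\<bar> \<le> k")
  case True
  have "0 \<le> (x - s)\<^sup>2" by simp
  then show ?thesis using True by (simp add: huber_def power2_eq_square algebra_simps)
next
  case False
  have "s * x \<le> \<bar>s\<bar> * \<bar>x\<bar>" by (metis abs_ge_self abs_mult)
  moreover have "0 \<le> (k - \<bar>s\<bar>) * (2 * \<bar>x\<bar> - k - \<bar>s\<bar>)" using assms False by (intro mult_nonneg_nonneg) auto
  ultimately show ?thesis using False
    by (simp add: huber_def power2_eq_square algebra_simps)
qed

lemma huber_clip:
  fixes x :: real
  assumes "0 < k"
  defines "s \<equiv> max (- k) (min k x)"
  shows "huber k x = s * x - s\<^sup>2 / 2" "\<bar>s\<bar> \<le> k"
proof -
  consider "x < - k" | "\<bar>x\<bar> \<le> k" | "k < x" by linarith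
  then show "huber k x = s * x - s\<^sup>2 / 2"
    using assms(1) by cases (auto simp: s_def huber_def power2_eq_square algebra_simps)
qed (use assms in auto)

text \<open>Every loss is treated through its subgradient \<open>score\<close> and the Bregman remainder; for \<open>k = 0\<close>
  the loss is not differentiable at the origin.\<close>

lemma ennreal_cases_loss [case_names zero finite infinity]:
  fixes k :: ennreal
  obtains "k = 0" | r where "0 < r" "k = ennreal r" | "k = top"
  by (cases k) (force simp: zero_less_iff_neq_zero)+

lemma scaled_huber_finite: "0 < r \<Longrightarrow> scaled_huber (ennreal r) x = (r + 1) / r * huber r x"
  and score_finite: "0 < r \<Longrightarrow> score (ennreal r) x = (r + 1) / r * max (- r) (min r x)"
  by (simp_all add: scaled_huber_def score_def ennreal_eq_0_iff)

lemma score_odd: "score k (- x) = - score k x"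
proof (cases k rule: ennreal_cases_loss)
  case (finite r)
  have "max (- r) (min r (- x)) = - max (- r) (min r x)" using finite by (auto simp: max_def min_def)
  then show ?thesis using finite by (simp only: score_finite mult_minus_right)
qed (auto simp: score_def sgn_minus)

lemma measurable_huber [measurable]: "huber r \<in> borel_measurable borel"
  unfolding huber_def[abs_def] by measurable

lemma measurable_scaled_huber [measurable]: "scaled_huber k \<in> borel_measurable borel"
  unfolding scaled_huber_def[abs_def] by measurable

lemma measurable_score [measurable]: "score k \<in> borel_measurable borel"
  unfolding score_def[abs_def] by measurable

lemma measurable_bregman [measurable]: "bregman k t \<in> borel_measurable borel"
  unfolding bregman_def[abs_def] by measurable

lemma bregman_nonneg: "0 \<le> bregman k t x"
proof (cases k rule: ennreal_cases_loss)
  case zero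
  show ?thesis by (auto simp: zero bregman_def scaled_huber_def score_def sgn_real_def abs_if)
next
  case (finite r)
  let ?s = "max (- r) (min r x)"
  have "?s * x - ?s\<^sup>2 / 2 + t * ?s \<le> huber r (x + t)"
    using huber_ge[of ?s r "x + t"] finite by (simp add: algebra_simps)
  then have "huber r x + t * ?s \<le> huber r (x + t)" using huber_clip(1)[OF finite(1), of x] by simp
  then have "(r + 1) / r * (huber r x + t * ?s) \<le> (r + 1) / r * huber r (x + t)"
    using finite by (intro mult_left_mono) auto
  then show ?thesis using finite by (simp only: bregman_def scaled_huber_finite score_finite distrib_left) (simp add: mult_ac)
next
  case infinity
  show ?thesis by (simp add: infinity bregman_def scaled_huber_def score_def power2_eq_square algebra_simps)
qed

text \<open>Uniform in \<open>x\<close> even when \<open>score\<close> itself is unbounded: for the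
  squared loss the increment is \<open>t\<close>. Upper bounds on the remainders involve increments
  only, so a Lipschitz constant is available for every loss.\<close>

lemma score_increment:
  "\<exists>C>0. \<forall>t x. \<bar>t\<bar> \<le> D \<longrightarrow> \<bar>score k (x + t) - score k x\<bar> \<le> C"
proof (cases k rule: ennreal_cases_loss)
  case zero
  have "\<bar>sgn (x + t) - sgn x\<bar> \<le> (2::real)" for x t :: real by (auto simp: sgn_real_def)
  then show ?thesis by (intro exI[of _ 2]) (auto simp: zero score_def)
next
  case (finite r)
  have "\<bar>score k (x + t) - score k x\<bar> \<le> 2 * (r + 1)" for x t
  proof -
    have "\<bar>max (- r) (min r (x + t)) - max (- r) (min r x)\<bar> \<le> 2 * r" using finite by (auto simp: abs_if min_def max_def)
    then have "(r + 1) / r * \<bar>max (- r) (min r (x + t)) - max (- r) (min r x)\<bar> \<le> (r + 1) / r * (2 * r)"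
      using finite by (intro mult_left_mono) auto
    also have "\<dots> = 2 * (r + 1)" using finite by simp
    finally have "\<bar>(r + 1) / r * (max (- r) (min r (x + t)) - max (- r) (min r x))\<bar> \<le> 2 * (r + 1)"
      using finite by (simp only: abs_mult) simp
    then show ?thesis using finite by (simp only: score_finite right_diff_distrib)
  qed
  then show ?thesis using finite by (intro exI[of _ "2 * (r + 1)"]) auto
next
  case infinity
  then show ?thesis by (intro exI[of _ "max D 1"]) (auto simp: score_def)
qed

lemma score_bounded:
  assumes "k < \<infinity>"
  shows "\<exists>L>0. \<forall>x. \<bar>score k x\<bar> \<le> L"
proof (cases k rule: ennreal_cases_loss)
  case zero
  then show ?thesis by (intro exI[of _ 1]) (auto simp: score_def sgn_real_def)
next
  case (finite r)
  have "\<bar>score k x\<bar> \<le> r + 1" for x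
  proof -
    have "(r + 1) / r * \<bar>max (- r) (min r x)\<bar> \<le> (r + 1) / r * r"
      using finite huber_clip(2)[OF finite(1), of x] by (intro mult_left_mono) auto
    then show ?thesis using finite by (simp add: score_finite abs_mult)
  qed
  then show ?thesis using finite by (intro exI[of _ "r + 1"]) auto
qed (use assms in simp)

text \<open>The remainders seen from the two endpoints add up to
  \<open>t * (score k (x + t) - score k x)\<close>, and both are nonnegative.\<close>

lemma bregman_le: "bregman k t x \<le> \<bar>t\<bar> * \<bar>score k (x + t) - score k x\<bar>"
proof -
  have "bregman k t x \<le> t * (score k (x + t) - score k x)"
    using bregman_nonneg[of k "- t" "x + t"] by (simp add: bregman_def algebra_simps)
  also have "\<dots> \<le> \<bar>t\<bar> * \<bar>score k (x + t) - score k x\<bar>" by (metis abs_ge_self abs_mult)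
  finally show ?thesis .
qed

text \<open>A convex function vanishing at zero is superlinear. A lower bound at one radius thus
  controls all larger shifts, which spares a uniform bound over the levels in the second
  step.\<close>

lemma bregman_scale:
  assumes "1 \<le> c"
  shows "c * bregman k t x \<le> bregman k (c * t) x"
proof -
  define y where "y = x + t"
  have "0 \<le> bregman k ((c - 1) * t) y" "0 \<le> bregman k (- t) y" by (rule bregman_nonneg)+
  then have "0 \<le> bregman k ((c - 1) * t) y + (c - 1) * bregman k (- t) y" using assms by simp
  also have "\<dots> = bregman k (c * t) x - c * bregman k t x"
    by (simp add: bregman_def y_def algebra_simps)
  finally show ?thesis by simp
qed

lemma bregman_quadratic:
  assumes "0 < r" "\<bar>x\<bar> \<le> r / 2"
  shows "min (t\<^sup>2 / 2) (r * \<bar>t\<bar> / 4) \<le> bregman (ennreal r) t x"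
proof -
  \<comment> \<open>The clipped shift keeps \<open>x + e\<close> an admissible slope, since both
    summands are at most \<open>r / 2\<close> in absolute value. The value
    \<open>e * t - e\<^sup>2 / 2\<close> then shows the quadratic or the linear regime.\<close>
  define e where "e = sgn t * min \<bar>t\<bar> (r / 2)"
  have e: "\<bar>e\<bar> \<le> r / 2" using assms(1) by (auto simp: e_def abs_mult sgn_real_def)
  have clip: "max (- r) (min r x) = x" using assms by auto
  have hx: "huber r x = x\<^sup>2 / 2" using assms by (simp add: huber_def)
  have "min (t\<^sup>2 / 2) (r * \<bar>t\<bar> / 4) \<le> e * t - e\<^sup>2 / 2"
  proof (cases "\<bar>t\<bar> \<le> r / 2")
    case True
    then have "e = t" by (auto simp: e_def sgn_real_def)
    then show ?thesis by (simp add: power2_eq_square)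
  next
    case False
    then have "e * t = r / 2 * \<bar>t\<bar>" "e\<^sup>2 = (r / 2)\<^sup>2" using assms(1) by (auto simp: e_def sgn_real_def power2_eq_square)
    moreover have "(r / 2)\<^sup>2 \<le> r / 2 * \<bar>t\<bar>" using False assms by (simp add: power2_eq_square)
    ultimately show ?thesis by simp
  qed
  also have "\<dots> = (x + e) * (x + t) - (x + e)\<^sup>2 / 2 - x\<^sup>2 / 2 - t * x"
    by (simp add: power2_eq_square algebra_simps)
  also have "\<dots> \<le> huber r (x + t) - huber r x - t * max (- r) (min r x)"
    unfolding clip hx using huber_ge[of "x + e" r "x + t"] e assms by simp
  also have "\<dots> \<le> (r + 1) / r * (huber r (x + t) - huber r x - t * max (- r) (min r x))"
  proof -
    have "0 \<le> bregman (ennreal r) t x" by (rule bregman_nonneg)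
    then have "0 \<le> (r + 1) / r * (huber r (x + t) - huber r x - t * max (- r) (min r x))"
      using assms by (simp only: bregman_def scaled_huber_finite score_finite) (simp add: algebra_simps)
    moreover have "0 < (r + 1) / r" using assms by simp
    ultimately have "0 \<le> huber r (x + t) - huber r x - t * max (- r) (min r x)"
      by (simp only: zero_le_mult_iff) auto
    then show ?thesis using mult_right_mono[of 1 "(r + 1) / r"] assms by simp
  qed
  also have "\<dots> = bregman (ennreal r) t x"
    using assms by (simp only: bregman_def scaled_huber_finite score_finite) (simp add: algebra_simps)
  finally show ?thesis .
qed

text \<open>The absolute value bends only at the origin. If the shift carries \<open>x\<close>
  across it, the remainder equals \<open>2 * (\<bar>t\<bar> - \<bar>x\<bar>)\<close>.\<close>

lemma bregman_zero:
  assumes "x * t < 0" "\<bar>x\<bar> \<le> \<bar>t\<bar> / 2"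
  shows "\<bar>t\<bar> \<le> bregman 0 t x"
  using assms by (auto simp: bregman_def scaled_huber_def score_def sgn_real_def abs_if mult_less_0_iff split: if_splits)

lemma bregman_infinity: "bregman top t x = t\<^sup>2 / 2"
  by (simp add: bregman_def scaled_huber_def score_def power2_eq_square algebra_simps)

text \<open>The sign condition comes from \<open>k = 0\<close>; imposing it on all losses lets one
  counting bound serve them all.\<close>

lemma bregman_curvature:
  assumes \<tau>: "0 < \<tau>"
  shows "\<exists>\<kappa>>0. \<exists>\<rho>>0. \<forall>t x. \<tau> \<le> \<bar>t\<bar> \<longrightarrow> x * t < 0 \<longrightarrow> \<bar>x\<bar> < \<rho> \<longrightarrow> \<kappa> \<le> bregman k t x"
proof (cases k rule: ennreal_cases_loss)
  case zero
  have "\<tau> \<le> bregman k t x" if "\<tau> \<le> \<bar>t\<bar>" "x * t < 0" "\<bar>x\<bar> < \<tau> / 2" for t x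
    using bregman_zero[of x t] that by (simp add: zero)
  then show ?thesis using \<tau> by (intro exI[of _ \<tau>] conjI exI[of _ "\<tau> / 2"]) auto
next
  case (finite r)
  have "min (\<tau>\<^sup>2 / 2) (r * \<tau> / 4) \<le> bregman k t x" if "\<tau> \<le> \<bar>t\<bar>" "\<bar>x\<bar> < r / 2" for t x
  proof -
    have "\<tau>\<^sup>2 \<le> t\<^sup>2" using power_mono[OF that(1), of 2] \<tau> by simp
    moreover have "r * \<tau> \<le> r * \<bar>t\<bar>" using that finite by simp
    ultimately have "min (\<tau>\<^sup>2 / 2) (r * \<tau> / 4) \<le> min (t\<^sup>2 / 2) (r * \<bar>t\<bar> / 4)" by (intro min.mono) auto
    also have "\<dots> \<le> bregman k t x" unfolding finite(2) using that finite by (intro bregman_quadratic) auto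
    finally show ?thesis .
  qed
  then show ?thesis using \<tau> finite
    by (intro exI[of _ "min (\<tau>\<^sup>2 / 2) (r * \<tau> / 4)"] conjI exI[of _ "r / 2"]) auto
next
  case infinity
  have "\<tau>\<^sup>2 / 2 \<le> t\<^sup>2 / 2" if "\<tau> \<le> \<bar>t\<bar>" for t using power_mono[OF that, of 2] \<tau> by simp
  then show ?thesis using \<tau>
    by (intro exI[of _ "\<tau>\<^sup>2 / 2"] conjI exI[of _ 1]) (auto simp: infinity bregman_infinity)
qed

text \<open>Continuity bounds the density below only near zero. Contracting an interval that
  contains zero by the factor \<open>\<mu>\<close> keeps it inside itself and moves it into that
  neighbourhood, at the cost of \<open>\<mu>\<close> in the length.\<close>

lemma noise_near_zero:
  assumes "prob_space P\<xi>" and "P\<xi> = density lborel (\<lambda>x. ennreal (f x))" "\<And>x. 0 \<le> f x"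
    "continuous_on UNIV f" "0 < f (0::real)" and U: "0 < U"
  shows "\<exists>c>0. \<forall>a b. a < b \<longrightarrow> - U \<le> a \<longrightarrow> b \<le> U \<longrightarrow> 0 \<in> {a..b} \<longrightarrow> c * (b - a) \<le> measure P\<xi> {a<..<b}"
proof -
  interpret prob_space P\<xi> by fact
  have [measurable]: "f \<in> borel_measurable borel" by (rule borel_measurable_continuous_onI[OF assms(4)])
  have "isCont f 0" using assms(4) by (simp add: continuous_on_eq_continuous_at)
  then have "\<forall>\<^sub>F x in nhds 0. f 0 / 2 < f x"
    using assms(5) order_tendstoD(1)[of f "f 0" "nhds 0" "f 0 / 2"] by (simp add: continuous_at_imp_continuous_at_within isCont_def tendsto_nhds_iff)
  then obtain \<rho> where \<rho>: "\<rho> > 0" "\<And>x. \<bar>x\<bar> < \<rho> \<Longrightarrow> f 0 / 2 < f x"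
    unfolding eventually_nhds_metric by (auto simp: dist_real_def)
  define \<mu> where "\<mu> = min 1 (\<rho> / U)"
  have \<mu>: "0 < \<mu>" "\<mu> \<le> 1" "\<mu> * U \<le> \<rho>" using \<rho> U by (auto simp: \<mu>_def min_def field_simps)
  have "f 0 / 2 * \<mu> * (b - a) \<le> measure P\<xi> {a<..<b}" if ab: "a < b" "- U \<le> a" "b \<le> U" "0 \<in> {a..b}" for a b
  proof -
    have "emeasure P\<xi> {\<mu> * a<..<\<mu> * b} = (\<integral>\<^sup>+x. ennreal (f x) * indicator {\<mu> * a<..<\<mu> * b} x \<partial>lborel)"
      unfolding assms(2) by (subst emeasure_density) auto
    also have "\<dots> \<ge> (\<integral>\<^sup>+x. ennreal (f 0 / 2) * indicator {\<mu> * a<..<\<mu> * b} x \<partial>lborel)"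
    proof (rule nn_integral_mono)
      fix x
      have "f 0 / 2 \<le> f x" if "\<mu> * a < x" "x < \<mu> * b"
      proof -
        have "\<mu> * b \<le> \<mu> * U" "\<mu> * (- U) \<le> \<mu> * a" 
          using ab \<mu> mult_left_mono[of b U \<mu>] mult_left_mono[of "- U" a \<mu>] by auto
        then have "\<bar>x\<bar> < \<rho>" using that \<mu>(3) by auto
        then show ?thesis using \<rho>(2)[of x] by simp
      qed
      then show "ennreal (f 0 / 2) * indicator {\<mu> * a<..<\<mu> * b} x \<le> ennreal (f x) * indicator {\<mu> * a<..<\<mu> * b} x"
        by (auto simp: indicator_def intro: ennreal_leI)
    qed
    also have "(\<integral>\<^sup>+x. ennreal (f 0 / 2) * indicator {\<mu> * a<..<\<mu> * b} x \<partial>lborel) = ennreal (f 0 / 2) * ennreal (\<mu> * b - \<mu> * a)"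
      using ab \<mu> by (simp add: nn_integral_cmult_indicator)
    also have "\<dots> = ennreal (f 0 / 2 * \<mu> * (b - a))"
      using ab \<mu> assms(5) by (simp add: ennreal_mult[symmetric] algebra_simps)
    finally have "f 0 / 2 * \<mu> * (b - a) \<le> measure P\<xi> {\<mu> * a<..<\<mu> * b}"
      by (simp add: emeasure_eq_measure)
    also have "\<dots> \<le> measure P\<xi> {a<..<b}"
    proof (rule finite_measure_mono)
      have "a \<le> \<mu> * a" "\<mu> * b \<le> b" using ab \<mu> by (auto simp: mult_le_cancel_right1 mult_le_cancel_right2)
      then show "{\<mu> * a<..<\<mu> * b} \<subseteq> {a<..<b}" by auto
      show "{a<..<b} \<in> sets P\<xi>" using assms(2) by simp
    qed
    finally show ?thesis .
  qed
  then show ?thesis using assms(5) \<mu> by (intro exI[of _ "f 0 / 2 * \<mu>"]) auto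
qed

section \<open>The two estimation steps on a fixed sample\<close>

lemma step_value_if: "step_value \<alpha> \<beta> t = (if 0 < t then \<beta> else \<alpha>)"
  by (auto simp: step_value_def)

lemma scaled_huber_shift: "scaled_huber k (x + t) = scaled_huber k x + t * score k x + bregman k t x"
  by (simp add: bregman_def)

lemma sum_four_cells:
  fixes g :: "bool \<Rightarrow> bool \<Rightarrow> 'i \<Rightarrow> real"
  assumes "finite I"
  shows "(\<Sum>i\<in>I. g (u i) (v i) i) =
    (\<Sum>i | i \<in> I \<and> u i = False \<and> v i = False. g False False i) + (\<Sum>i | i \<in> I \<and> u i = True \<and> v i = True. g True True i)
    + (\<Sum>i | i \<in> I \<and> u i = True \<and> v i = False. g True False i) + (\<Sum>i | i \<in> I \<and> u i = False \<and> v i = True. g False True i)"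
  using assms by (simp only: sum.inter_filter sum.distrib[symmetric]) (auto intro!: sum.cong)

text \<open>The cells are indexed by the side of the true hyperplane and the side of the candidate one, so
  the cells \<open>(True, False)\<close> and \<open>(False, True)\<close> are the misclassified points.\<close>

locale cell_data =
  fixes I :: "'i set" and u v :: "'i \<Rightarrow> bool" and y :: "'i \<Rightarrow> real" and k :: ennreal
  assumes fin: "finite I"
begin

definition cell_of :: "bool \<Rightarrow> bool \<Rightarrow> 'i set" where
  "cell_of s s' = {i\<in>I. u i = s \<and> v i = s'}"

definition S :: "'i set \<Rightarrow> real" where
  "S A = (\<Sum>i\<in>A. score k (y i))"

definition R :: "real \<Rightarrow> 'i set \<Rightarrow> real" where
  "R t A = (\<Sum>i\<in>A. bregman k t (y i))"

definition side_of :: "bool \<Rightarrow> 'i set" where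
  "side_of s = {i\<in>I. u i = s}"

lemma finite_cell_of [simp]: "finite (cell_of s s')" and finite_side_of [simp]: "finite (side_of s)"
  using fin by (auto simp: cell_of_def side_of_def)

lemma side_split: "side_of s = cell_of s True \<union> cell_of s False" "cell_of s True \<inter> cell_of s False = {}"
  by (auto simp: side_of_def cell_of_def)

lemma S_side: "S (side_of s) = S (cell_of s True) + S (cell_of s False)"
  and R_side: "R t (side_of s) = R t (cell_of s True) + R t (cell_of s False)"
  unfolding S_def R_def side_split(1) using side_split(2) by (auto intro!: sum.union_disjoint)

lemma R_nonneg: "0 \<le> R t A"
  unfolding R_def by (intro sum_nonneg bregman_nonneg)

lemma R_zero: "R 0 A = 0"
  by (simp add: R_def bregman_def)

lemma R_lower:
  assumes "\<And>x. x * t < 0 \<Longrightarrow> \<bar>x\<bar> < \<rho> \<Longrightarrow> \<kappa> \<le> bregman k t x" "finite A" "0 \<le> \<kappa>"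
  shows "\<kappa> * card {i\<in>A. y i * t < 0 \<and> \<bar>y i\<bar> < \<rho>} \<le> R t A"
proof -
  have "\<kappa> * card {i\<in>A. y i * t < 0 \<and> \<bar>y i\<bar> < \<rho>} = (\<Sum>i\<in>{i\<in>A. y i * t < 0 \<and> \<bar>y i\<bar> < \<rho>}. \<kappa>)" by simp
  also have "\<dots> \<le> (\<Sum>i\<in>{i\<in>A. y i * t < 0 \<and> \<bar>y i\<bar> < \<rho>}. bregman k t (y i))"
    using assms by (intro sum_mono) auto
  also have "\<dots> \<le> R t A"
    unfolding R_def using assms by (intro sum_mono2) (auto intro: bregman_nonneg)
  finally show ?thesis .
qed

lemma R_upper:
  assumes "\<And>x. \<bar>score k (x + t) - score k x\<bar> \<le> C"
  shows "R t A \<le> C * \<bar>t\<bar> * card A"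
proof -
  have "R t A \<le> (\<Sum>i\<in>A. C * \<bar>t\<bar>)"
    unfolding R_def
  proof (rule sum_mono)
    fix i
    show "bregman k t (y i) \<le> C * \<bar>t\<bar>"
      using bregman_le[of k t "y i"] mult_left_mono[OF assms, of "\<bar>t\<bar>" "y i"] by (simp add: mult.commute)
  qed
  then show ?thesis by (simp add: mult.commute)
qed

lemma R_scale: "1 \<le> c \<Longrightarrow> c * R t A \<le> R (c * t) A"
  unfolding R_def sum_distrib_left by (intro sum_mono bregman_scale)

text \<open>Each argument is the true level minus the fitted one on a cell: \<open>t1\<close> and
  \<open>t2\<close> on the correctly classified negative and positive cells, \<open>t3\<close> and
  \<open>t4\<close> on the misclassified \<open>cell_of True False\<close> and
  \<open>cell_of False True\<close>.\<close>

definition loss :: "real \<Rightarrow> real \<Rightarrow> real \<Rightarrow> real \<Rightarrow> real" where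
  "loss t1 t2 t3 t4 = (\<Sum>i\<in>I. scaled_huber k (y i + (if u i then if v i then t2 else t3 else if v i then t4 else t1)))"

definition excess :: "real \<Rightarrow> real \<Rightarrow> real \<Rightarrow> real \<Rightarrow> real" where
  "excess t1 t2 t3 t4 = (t1 * S (cell_of False False) + R t1 (cell_of False False))
     + (t2 * S (cell_of True True) + R t2 (cell_of True True))
     + (t3 * S (cell_of True False) + R t3 (cell_of True False))
     + (t4 * S (cell_of False True) + R t4 (cell_of False True))"

lemma loss_excess: "loss t1 t2 t3 t4 = (\<Sum>i\<in>I. scaled_huber k (y i)) + excess t1 t2 t3 t4"
proof -
  define G where "G s s' i = (if s then if s' then t2 else t3 else if s' then t4 else t1) * score k (y i)
        + bregman k (if s then if s' then t2 else t3 else if s' then t4 else t1) (y i)" for s s' :: bool and i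
  have "loss t1 t2 t3 t4 = (\<Sum>i\<in>I. scaled_huber k (y i)) + (\<Sum>i\<in>I. G (u i) (v i) i)"
    unfolding loss_def scaled_huber_shift G_def by (simp add: sum.distrib)
  also have "(\<Sum>i\<in>I. G (u i) (v i) i) = excess t1 t2 t3 t4"
    unfolding sum_four_cells[OF fin, of G u v] excess_def S_def R_def cell_of_def
    by (simp add: G_def sum.distrib sum_distrib_left)
  finally show ?thesis .
qed

lemma first_step_remainder:
  assumes le: "loss t1 t2 t3 t4 \<le> loss 0 0 0 0"
    and D: "\<bar>t1\<bar> \<le> D" "\<bar>t2\<bar> \<le> D" "\<bar>t3 - t2\<bar> \<le> D" "\<bar>t4 - t1\<bar> \<le> D"
  shows "R t1 (cell_of False False) + R t2 (cell_of True True) + R t3 (cell_of True False) + R t4 (cell_of False True)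
    \<le> D * (\<bar>S (side_of False)\<bar> + \<bar>S (side_of True)\<bar> + \<bar>S (cell_of True False)\<bar> + \<bar>S (cell_of False True)\<bar>)"
proof -
  have b: "- (t * s) \<le> D * \<bar>s\<bar>" if "\<bar>t\<bar> \<le> D" for t s :: real
  proof -
    have "- (t * s) \<le> \<bar>t\<bar> * \<bar>s\<bar>" by (metis abs_ge_minus_self abs_mult)
    also have "\<dots> \<le> D * \<bar>s\<bar>" using that by (intro mult_right_mono) auto
    finally show ?thesis .
  qed
  have "excess t1 t2 t3 t4 \<le> 0"
    using le by (simp add: loss_excess) (simp add: excess_def R_zero)
  \<comment> \<open>Regrouped so that the linear terms are sums over the two true sides, which are
    fixed, and over the misclassified cells, which vary with the direction.\<close>
  moreover have "excess t1 t2 t3 t4 = t1 * S (side_of False) + t2 * S (side_of True)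
      + (t3 - t2) * S (cell_of True False) + (t4 - t1) * S (cell_of False True)
      + (R t1 (cell_of False False) + R t2 (cell_of True True) + R t3 (cell_of True False) + R t4 (cell_of False True))"
    by (simp add: excess_def S_side algebra_simps)
  ultimately show ?thesis
    using b[OF D(1), of "S (side_of False)"] b[OF D(2), of "S (side_of True)"]
      b[OF D(3), of "S (cell_of True False)"] b[OF D(4), of "S (cell_of False True)"]
    by (simp add: distrib_left)
qed

text \<open>Comparing the first step with the same levels at the true direction leaves only the
  misclassified cells.\<close>

lemma misclassified_remainder:
  assumes le: "excess t1 t2 t3 t4 \<le> t1 * S (side_of False) + R t1 (side_of False) + t2 * S (side_of True) + R t2 (side_of True)"
    and D: "\<bar>t3 - t2\<bar> \<le> D" "\<bar>t4 - t1\<bar> \<le> D"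
    and C: "\<And>x. \<bar>score k (x + t1) - score k x\<bar> \<le> C" "\<And>x. \<bar>score k (x + t2) - score k x\<bar> \<le> C"
    and \<tau>: "\<bar>t1\<bar> \<le> \<tau>" "\<bar>t2\<bar> \<le> \<tau>" and C0: "0 \<le> C"
  shows "R t3 (cell_of True False) + R t4 (cell_of False True)
    \<le> D * (\<bar>S (cell_of True False)\<bar> + \<bar>S (cell_of False True)\<bar>) + C * \<tau> * (card (cell_of True False) + card (cell_of False True))"
proof -
  have b: "- (t * s) \<le> D * \<bar>s\<bar>" if "\<bar>t\<bar> \<le> D" for t s :: real
  proof -
    have "- (t * s) \<le> \<bar>t\<bar> * \<bar>s\<bar>" by (metis abs_ge_minus_self abs_mult)
    also have "\<dots> \<le> D * \<bar>s\<bar>" using that by (intro mult_right_mono) auto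
    finally show ?thesis .
  qed
  \<comment> \<open>The comparison levels are within \<open>\<tau>\<close> of the truth, so the
    remainders they leave on these cells are a small multiple of the cardinality, to be absorbed by
    the curvature.\<close>
  have "R t1 (cell_of False True) \<le> C * \<bar>t1\<bar> * card (cell_of False True)" by (rule R_upper[OF C(1)])
  also have "\<dots> \<le> C * \<tau> * card (cell_of False True)"
    using \<tau> C0 by (intro mult_right_mono mult_left_mono) auto
  finally have R1: "R t1 (cell_of False True) \<le> C * \<tau> * card (cell_of False True)" .
  have "R t2 (cell_of True False) \<le> C * \<bar>t2\<bar> * card (cell_of True False)" by (rule R_upper[OF C(2)])
  also have "\<dots> \<le> C * \<tau> * card (cell_of True False)"
    using \<tau> C0 by (intro mult_right_mono mult_left_mono) auto
  finally have R2: "R t2 (cell_of True False) \<le> C * \<tau> * card (cell_of True False)" .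
  have "(t3 - t2) * S (cell_of True False) + (t4 - t1) * S (cell_of False True)
      + R t3 (cell_of True False) + R t4 (cell_of False True) \<le> R t1 (cell_of False True) + R t2 (cell_of True False)"
    using le by (simp add: excess_def S_side R_side algebra_simps)
  then show ?thesis
    using R1 R2 b[OF D(1), of "S (cell_of True False)"] b[OF D(2), of "S (cell_of False True)"]
    by (simp add: distrib_left)
qed

text \<open>At the estimated direction even the true levels are off by \<open>\<Delta>\<close> on
  the misclassified cells. There the change of the remainder has no sign, but it is at least
  \<open>- \<bar>t\<bar> * C\<close> per point, so these cells join the linear term through their
  cardinality.\<close>

lemma second_step_remainder:
  assumes le: "loss t1 t2 (t1 - \<Delta>) (t2 + \<Delta>) \<le> loss 0 0 (- \<Delta>) \<Delta>"
    and C: "\<And>t x. \<bar>t\<bar> \<le> D \<Longrightarrow> \<bar>score k (x + t) - score k x\<bar> \<le> C"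
    and D: "\<bar>t1\<bar> \<le> D" "\<bar>t2\<bar> \<le> D" "\<bar>\<Delta>\<bar> \<le> D" and C0: "0 \<le> C"
  defines "W \<equiv> \<bar>S (side_of False)\<bar> + \<bar>S (side_of True)\<bar> + \<bar>S (cell_of True False)\<bar> + \<bar>S (cell_of False True)\<bar>
      + C * (card (cell_of True False) + card (cell_of False True))"
  shows "R t1 (side_of False) + R t2 (side_of True) \<le> (\<bar>t1\<bar> + \<bar>t2\<bar>) * W"
proof -
  have shift: "R (t + \<theta>) A - R \<theta> A \<ge> - \<bar>t\<bar> * (C * card A)" if "\<bar>\<theta>\<bar> \<le> D" for t \<theta> A
  proof -
    have "R (t + \<theta>) A - R \<theta> A = (\<Sum>i\<in>A. bregman k (t + \<theta>) (y i) - bregman k \<theta> (y i))"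
      by (simp add: R_def sum_subtractf)
    also have "\<dots> \<ge> (\<Sum>i\<in>A. - \<bar>t\<bar> * C)"
    proof (rule sum_mono)
      fix i
      have "bregman k (t + \<theta>) (y i) - bregman k \<theta> (y i)
          = bregman k t (y i + \<theta>) + t * (score k (y i + \<theta>) - score k (y i))"
        by (simp add: bregman_def algebra_simps)
      moreover have "- (t * (score k (y i + \<theta>) - score k (y i))) \<le> \<bar>t\<bar> * C"
      proof -
        have "- (t * (score k (y i + \<theta>) - score k (y i))) \<le> \<bar>t\<bar> * \<bar>score k (y i + \<theta>) - score k (y i)\<bar>"
          by (metis abs_ge_minus_self abs_mult)
        also have "\<dots> \<le> \<bar>t\<bar> * C" by (intro mult_left_mono C that) auto
        finally show ?thesis .
      qed
      ultimately show "- \<bar>t\<bar> * C \<le> bregman k (t + \<theta>) (y i) - bregman k \<theta> (y i)"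
        using bregman_nonneg[of k t "y i + \<theta>"] by simp
    qed
    finally show ?thesis by (simp add: mult_ac)
  qed
  define s0 s1 sm sp Nm Np where d: "s0 = S (side_of False)" "s1 = S (side_of True)"
    "sm = S (cell_of True False)" "sp = S (cell_of False True)"
    "Nm = C * card (cell_of True False)" "Np = C * card (cell_of False True)"
  have N: "0 \<le> Nm" "0 \<le> Np" using C0 by (auto simp: d)
  have "excess t1 t2 (t1 - \<Delta>) (t2 + \<Delta>) \<le> excess 0 0 (- \<Delta>) \<Delta>"
    using le by (simp add: loss_excess)
  then have "R t1 (side_of False) + R t2 (side_of True)
     \<le> - (t1 * (s0 - sp + sm)) - t2 * (s1 - sm + sp) + R t1 (cell_of False True) + R t2 (cell_of True False)
        - (R (t1 - \<Delta>) (cell_of True False) - R (- \<Delta>) (cell_of True False))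
        - (R (t2 + \<Delta>) (cell_of False True) - R \<Delta> (cell_of False True))"
    by (simp add: excess_def S_side R_side R_zero d algebra_simps)
  also have "\<dots> \<le> \<bar>t1\<bar> * (\<bar>s0\<bar> + \<bar>sp\<bar> + \<bar>sm\<bar>) + \<bar>t2\<bar> * (\<bar>s1\<bar> + \<bar>sp\<bar> + \<bar>sm\<bar>) + \<bar>t1\<bar> * Np + \<bar>t2\<bar> * Nm + \<bar>t1\<bar> * Nm + \<bar>t2\<bar> * Np"
  proof -
    have b: "- (t * s) \<le> \<bar>t\<bar> * w" if "\<bar>s\<bar> \<le> w" for t s w :: real
    proof -
      have "- (t * s) \<le> \<bar>t\<bar> * \<bar>s\<bar>" by (metis abs_ge_minus_self abs_mult)
      also have "\<dots> \<le> \<bar>t\<bar> * w" using that by (intro mult_left_mono) auto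
      finally show ?thesis .
    qed
    have "- (t1 * (s0 - sp + sm)) \<le> \<bar>t1\<bar> * (\<bar>s0\<bar> + \<bar>sp\<bar> + \<bar>sm\<bar>)" by (rule b) linarith
    moreover have "- (t2 * (s1 - sm + sp)) \<le> \<bar>t2\<bar> * (\<bar>s1\<bar> + \<bar>sp\<bar> + \<bar>sm\<bar>)" by (rule b) linarith
    moreover have "R t1 (cell_of False True) \<le> \<bar>t1\<bar> * Np" "R t2 (cell_of True False) \<le> \<bar>t2\<bar> * Nm"
      using R_upper[OF C[OF D(1)], of "cell_of False True"] R_upper[OF C[OF D(2)], of "cell_of True False"]
      by (auto simp: d mult_ac)
    moreover have "- (R (t1 - \<Delta>) (cell_of True False) - R (- \<Delta>) (cell_of True False)) \<le> \<bar>t1\<bar> * Nm"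
      using shift[of "- \<Delta>" "t1" "cell_of True False"] D by (simp add: d)
    moreover have "- (R (t2 + \<Delta>) (cell_of False True) - R \<Delta> (cell_of False True)) \<le> \<bar>t2\<bar> * Np"
      using shift[of \<Delta> "t2" "cell_of False True"] D by (simp add: d)
    ultimately show ?thesis by linarith
  qed
  also have "\<dots> = \<bar>t1\<bar> * (\<bar>s0\<bar> + \<bar>sp\<bar> + \<bar>sm\<bar> + Np + Nm) + \<bar>t2\<bar> * (\<bar>s1\<bar> + \<bar>sp\<bar> + \<bar>sm\<bar> + Nm + Np)"
    by (simp add: algebra_simps)
  also have "\<dots> \<le> \<bar>t1\<bar> * W + \<bar>t2\<bar> * W"
    using N by (intro add_mono mult_left_mono) (auto simp: W_def d distrib_left)
  finally show ?thesis by (simp add: distrib_right)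
qed

end

text \<open>If the total mass of the cells with a wrong level is small, the levels are nearly right.  This is
  where \<open>\<alpha> > \<beta>\<close> excludes the solution with the two sides exchanged.\<close>

lemma levels_identified:
  fixes \<alpha> \<beta> \<alpha>0 \<beta>0 \<tau> \<eta> :: real
  assumes "\<beta> < \<alpha>" and \<tau>: "2 * \<tau> \<le> \<alpha>0 - \<beta>0"
    and mass: "2 * \<eta> \<le> P00 + P01" "2 * \<eta> \<le> P10 + P11"
    and small: "\<tau> \<le> \<bar>\<alpha>0 - \<alpha>\<bar> \<Longrightarrow> P00 < \<eta>" "\<tau> \<le> \<bar>\<beta>0 - \<beta>\<bar> \<Longrightarrow> P11 < \<eta>"
      "\<tau> \<le> \<bar>\<beta>0 - \<alpha>\<bar> \<Longrightarrow> P10 < \<eta>" "\<tau> \<le> \<bar>\<alpha>0 - \<beta>\<bar> \<Longrightarrow> P01 < \<eta>"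
  shows "\<bar>\<alpha>0 - \<alpha>\<bar> < \<tau> \<and> \<bar>\<beta>0 - \<beta>\<bar> < \<tau>"
  \<comment> \<open>If \<open>\<alpha>\<close> is off, then \<open>P00\<close> is light and
    \<open>P01\<close> heavy, so \<open>\<beta>\<close> is near \<open>\<alpha>0\<close>. Then
    \<open>\<alpha> > \<beta>\<close> is far from \<open>\<beta>0\<close>, which makes
    \<open>P10\<close> light and \<open>P11\<close> heavy, so \<open>\<beta>\<close> is near
    \<open>\<beta>0\<close> as well: a contradiction. The other case is symmetric.\<close>
  using assms by (smt (verit))

section \<open>Geometry of the wedge condition\<close>

lemma csign_neq: "csign a \<noteq> csign b \<longleftrightarrow> (0 < a) \<noteq> (0 < b)"
  by (simp add: csign_def)

context design_noise
begin

lemma sets_mismatch: "{x\<in>space PX. csign (dot p x d) \<noteq> csign (dot p x e)} \<in> sets PX"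
proof -
  note [measurable] = measurable_dot
  show ?thesis unfolding space_PX PX(2) csign_neq by measurable
qed

text \<open>The wedge condition only speaks about directions near \<open>d0\<close>.  A far direction \<open>d\<close> is joined to
  \<open>d0\<close> by a great-circle arc, along which the mismatch with \<open>d0\<close> is at most that of \<open>d\<close>.\<close>

lemma distance_le_mismatch:
  assumes d: "d \<in> unit_sphere p" and d0: "d0 \<in> unit_sphere p"
    and wedge: "wedge_condition p PX d0 \<delta> c C1 C2" and \<delta>: "0 < \<delta>"
    and pos: "C3 \<le> measure PX {x\<in>space PX. 0 < dot p x d0}"
    and small: "mismatch_prob p PX d d0 < C3" "mismatch_prob p PX d d0 < c * \<delta>"
  shows "c * l2_dist p d d0 \<le> mismatch_prob p PX d d0"
proof (cases "l2_dist p d d0 \<le> \<delta>")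
  case True
  then show ?thesis using wedge d unfolding wedge_condition_def by blast
next
  case False
  have norm: "L2_set d {..<p} = 1" "L2_set d0 {..<p} = 1" using d d0 by (auto simp: unit_sphere_def)
  \<comment> \<open>Antipodal directions disagree on the whole strict positive side, whose mass is
    at least \<open>C3\<close>. This excludes the one case in which the chord from \<open>d0\<close>
    to \<open>d\<close> meets the origin.\<close>
  have opposite: False if opp: "\<And>j. j < p \<Longrightarrow> d j = - d0 j"
  proof -
    have "dot p x d = - dot p x d0" for x using opp by (simp add: dot_def sum_negf)
    then have "{x\<in>space PX. 0 < dot p x d0} \<subseteq> {x\<in>space PX. csign (dot p x d) \<noteq> csign (dot p x d0)}"
      by (auto simp: csign_def)
    then have "measure PX {x\<in>space PX. 0 < dot p x d0} \<le> mismatch_prob p PX d d0"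
      unfolding mismatch_prob_def by (rule PX.finite_measure_mono[OF _ sets_mismatch])
    then show False using pos small(1) by simp
  qed
  define w where "w t j = (1 - t) * d0 j + t * d j" for t j
  define N where "N t = L2_set (w t) {..<p}" for t
  have N_pos: "0 < N t" if t: "0 \<le> t" "t \<le> 1" for t
  proof (rule ccontr)
    assume "\<not> 0 < N t"
    then have "N t = 0" by (simp add: N_def L2_set_nonneg order_antisym not_less)
    then have w0: "t * d j = - ((1 - t) * d0 j)" if "j < p" for j
      using that by (simp add: N_def L2_set_eq_0_iff w_def algebra_simps)
    \<comment> \<open>Equal norms force \<open>t = 1 / 2\<close>, that is, antipodal
      directions.\<close>
    have "L2_set (\<lambda>j. t * d j) {..<p} = L2_set (\<lambda>j. (1 - t) * d0 j) {..<p}"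
      unfolding L2_set_def using w0 by (intro arg_cong[where f=sqrt] sum.cong refl) (simp only: lessThan_iff power2_minus)
    then have "t = 1 - t"
      using t norm by (simp add: L2_set_right_distrib[symmetric])
    then have half: "t = 1 / 2" by simp
    have "d j = - d0 j" if "j < p" for j using w0[OF that] unfolding half by simp
    then show False using opposite by blast
  qed
  define e where "e t = restrict (\<lambda>j. w t j / N t) {..<p}" for t
  define \<phi> where "\<phi> t = l2_dist p (e t) d0" for t
  have \<phi>: "\<phi> t = sqrt (\<Sum>j<p. (w t j / N t - d0 j)\<^sup>2)" for t
    by (simp add: \<phi>_def l2_dist_def L2_set_def e_def)
  have "continuous_on {0..1} \<phi>"
    unfolding \<phi> w_def
    by (intro continuous_intros) (auto simp: N_def[symmetric] dest!: N_pos intro!: continuous_intros simp: N_def L2_set_def w_def)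
  moreover have "\<phi> 0 \<le> \<delta>" using norm \<delta> by (simp add: \<phi> w_def N_def L2_set_def)
  moreover have "\<delta> \<le> \<phi> 1"
  proof -
    have "N 1 = 1" using norm by (simp add: N_def w_def L2_set_def)
    then show ?thesis using False by (simp add: \<phi> w_def l2_dist_def L2_set_def)
  qed
  \<comment> \<open>The intermediate value theorem picks a point of the arc at distance exactly
    \<open>\<delta>\<close>, where the wedge condition still applies.\<close>
  ultimately obtain t where t: "0 \<le> t" "t \<le> 1" "\<phi> t = \<delta>" using IVT'[of \<phi> 0 \<delta> 1] by auto
  have eS: "e t \<in> unit_sphere p"
  proof -
    have "L2_set (e t) {..<p} = L2_set (\<lambda>j. 1 / N t * w t j) {..<p}"
      unfolding L2_set_def e_def by (intro arg_cong[where f=sqrt] sum.cong) auto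
    also have "\<dots> = 1 / N t * N t" unfolding N_def[of t]
      by (rule L2_set_right_distrib[symmetric]) (simp add: L2_set_nonneg)
    finally show ?thesis using N_pos[OF t(1,2)] by (auto simp: unit_sphere_def space_PiM e_def)
  qed
  have dot_e: "dot p x (e t) = ((1 - t) * dot p x d0 + t * dot p x d) / N t" for x
    by (simp add: dot_def e_def w_def sum_divide_distrib sum_distrib_left sum.distrib[symmetric] algebra_simps add_divide_distrib)
  \<comment> \<open>Up to a positive factor the linear form at \<open>e t\<close> is a convex
    combination of those at \<open>d0\<close> and \<open>d\<close>; where these two agree in sign,
    all three do.\<close>
  have sub: "csign (dot p x d) \<noteq> csign (dot p x d0)" if ne: "csign (dot p x (e t)) \<noteq> csign (dot p x d0)" for x
  proof
    assume eq: "csign (dot p x d) = csign (dot p x d0)"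
    show False
    proof (cases "0 < dot p x d0")
      case True
      then have "0 < dot p x d" using eq by (auto simp: csign_def split: if_splits)
      then have "0 < (1 - t) * dot p x d0 + t * dot p x d"
        using True t by (cases "t = 0") (auto intro: add_nonneg_pos)
      then show False using ne True N_pos[OF t(1,2)] by (auto simp: csign_def dot_e)
    next
      case False
      then have "dot p x d \<le> 0" using eq by (auto simp: csign_def split: if_splits)
      then have "(1 - t) * dot p x d0 \<le> 0" "t * dot p x d \<le> 0"
        using False t by (auto intro: mult_nonneg_nonpos)
      then have "(1 - t) * dot p x d0 + t * dot p x d \<le> 0" by simp
      then have "dot p x (e t) \<le> 0" using N_pos[OF t(1,2)] by (simp add: dot_e divide_nonpos_pos)
      then show False using ne False by (auto simp: csign_def)
    qed
  qed
  have "mismatch_prob p PX (e t) d0 \<le> mismatch_prob p PX d d0"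
    unfolding mismatch_prob_def using sub by (intro PX.finite_measure_mono[OF _ sets_mismatch]) auto
  \<comment> \<open>This contradicts \<open>small(2)\<close>, so the far case does not
    occur.\<close>
  moreover have "c * \<delta> \<le> mismatch_prob p PX (e t) d0"
    using wedge eS t(3) unfolding wedge_condition_def \<phi>_def by fastforce
  ultimately show ?thesis using small(2) by simp
qed

end

section \<open>Expected curvature and sums over the two true sides\<close>

lemma (in finite_measure) integral_ge_measure:
  fixes g :: "'a \<Rightarrow> real"
  assumes "integrable M g" "A \<in> sets M" "\<And>x. 0 \<le> g x" "\<And>x. x \<in> A \<Longrightarrow> h \<le> g x"
  shows "h * measure M A \<le> (\<integral>x. g x \<partial>M)"
proof -
  have "h * measure M A = (\<integral>x. h * indicator A x \<partial>M)"
    using assms(2) by simp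
  also have "\<dots> \<le> (\<integral>x. g x \<partial>M)"
  proof (rule integral_mono[OF _ assms(1)])
    show "integrable M (\<lambda>x. h * indicator A x)"
      using assms(2) by (intro integrable_mult_right integrable_real_indicator) (simp_all add: emeasure_eq_measure)
  qed (use assms in \<open>auto simp: indicator_def\<close>)
  finally show ?thesis .
qed

lemma integrable_bregman:
  assumes "prob_space P\<xi>" "sets P\<xi> = sets borel"
  shows "integrable P\<xi> (bregman k t)"
proof -
  interpret prob_space P\<xi> by fact
  obtain C where C: "0 < C" "\<And>s x. \<bar>s\<bar> \<le> \<bar>t\<bar> \<Longrightarrow> \<bar>score k (x + s) - score k x\<bar> \<le> C"
    using score_increment[of "\<bar>t\<bar>" k] by blast
  have "norm (bregman k t x) \<le> \<bar>t\<bar> * C" for x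
    using bregman_le[of k t x] mult_left_mono[OF C(2)[of t x], of "\<bar>t\<bar>"] bregman_nonneg[of k t x] by simp
  moreover have "bregman k t \<in> borel_measurable P\<xi>" by (simp add: measurable_cong_sets[OF assms(2) refl])
  ultimately show ?thesis by (intro integrable_const_bound[of _ "\<bar>t\<bar> * C"]) auto
qed

text \<open>Averaging over the noise restores quadratic growth for every loss. For
  \<open>k = 0\<close> a shift \<open>t\<close> crosses zero with probability at least of order
  \<open>\<bar>t\<bar>\<close>, by the positive density there, and then gains at least
  \<open>\<bar>t\<bar>\<close>.\<close>

lemma mean_bregman:
  assumes P: "prob_space P\<xi>" and "P\<xi> = density lborel (\<lambda>x. ennreal (f x))" "\<And>x. 0 \<le> f x"
    "continuous_on UNIV f" "0 < f (0::real)" and D: "0 < D"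
  shows "\<exists>\<kappa>>0. \<forall>t. \<bar>t\<bar> \<le> D \<longrightarrow> \<kappa> * t\<^sup>2 \<le> (\<integral>y. bregman k t y \<partial>P\<xi>)"
proof -
  interpret prob_space P\<xi> by fact
  have sets: "sets P\<xi> = sets borel" using assms(2) by simp
  note int = integrable_bregman[OF P sets, of k]
  show ?thesis
  proof (cases k rule: ennreal_cases_loss)
    case zero
    obtain c where c: "0 < c" "\<And>a b. a < b \<Longrightarrow> - D \<le> a \<Longrightarrow> b \<le> D \<Longrightarrow> 0 \<in> {a..b} \<Longrightarrow> c * (b - a) \<le> measure P\<xi> {a<..<b}"
      using noise_near_zero[OF assms(1-5) D] by blast
    have "c / 2 * t\<^sup>2 \<le> (\<integral>y. bregman k t y \<partial>P\<xi>)" if t: "\<bar>t\<bar> \<le> D" for t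
    proof -
      \<comment> \<open>Noise of the sign opposite to \<open>t\<close> and at most half its size,
        the range of \<open>bregman_zero\<close>.\<close>
      define a b where ab: "a = (if 0 < t then - t / 2 else 0)" "b = (if 0 < t then 0 else - t / 2)"
      have "c * (b - a) \<le> measure P\<xi> {a<..<b}"
        using c(2)[of a b] t D by (cases "t = 0") (auto simp: ab)
      then have "\<bar>t\<bar> * (c * (b - a)) \<le> \<bar>t\<bar> * measure P\<xi> {a<..<b}" by (intro mult_left_mono) auto
      also have "\<dots> \<le> (\<integral>y. bregman k t y \<partial>P\<xi>)"
      proof (rule integral_ge_measure[OF int])
        fix y assume "y \<in> {a<..<b}"
        then have "y * t < 0" "\<bar>y\<bar> \<le> \<bar>t\<bar> / 2" by (auto simp: ab mult_less_0_iff split: if_splits)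
        then show "\<bar>t\<bar> \<le> bregman k t y" unfolding zero by (rule bregman_zero)
      qed (auto simp: sets bregman_nonneg)
      also have "\<bar>t\<bar> * (c * (b - a)) = c / 2 * t\<^sup>2" by (auto simp: ab power2_eq_square)
      finally show ?thesis .
    qed
    then show ?thesis using c(1) by (intro exI[of _ "c / 2"]) auto
  next
    case (finite r)
    obtain c where c: "0 < c" "\<And>a b. a < b \<Longrightarrow> - (r/2) \<le> a \<Longrightarrow> b \<le> r/2 \<Longrightarrow> 0 \<in> {a..b} \<Longrightarrow> c * (b - a) \<le> measure P\<xi> {a<..<b}"
      using noise_near_zero[OF assms(1-5), of "r/2"] finite by auto
    have q: "0 < measure P\<xi> {-(r/2)<..<r/2}"
      using c(2)[of "-(r/2)" "r/2"] mult_pos_pos[OF c(1) finite(1)] finite by simp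
    \<comment> \<open>Both branches of the minimum in \<open>bregman_quadratic\<close> are at least
      \<open>\<kappa> * t\<^sup>2\<close> as long as \<open>\<bar>t\<bar> \<le> D\<close>.\<close>
    define \<kappa> where "\<kappa> = min (1/2) (r / (4 * D))"
    have \<kappa>: "0 < \<kappa>" using finite D by (simp add: \<kappa>_def)
    have "\<kappa> * measure P\<xi> {-(r/2)<..<r/2} * t\<^sup>2 \<le> (\<integral>y. bregman k t y \<partial>P\<xi>)" if t: "\<bar>t\<bar> \<le> D" for t
    proof -
      have "\<kappa> * t\<^sup>2 \<le> t\<^sup>2 / 2" unfolding \<kappa>_def using mult_right_mono[of "min (1/2) (r / (4 * D))" "1/2" "t\<^sup>2"] by simp
      moreover have "\<kappa> * t\<^sup>2 \<le> r * \<bar>t\<bar> / 4"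
      proof -
        have "\<kappa> * t\<^sup>2 \<le> r / (4 * D) * t\<^sup>2" unfolding \<kappa>_def by (intro mult_right_mono) auto
        also have "t\<^sup>2 \<le> D * \<bar>t\<bar>" using mult_right_mono[OF t, of "\<bar>t\<bar>"] by (simp add: power2_eq_square)
        then have "r / (4 * D) * t\<^sup>2 \<le> r / (4 * D) * (D * \<bar>t\<bar>)" using finite D by (intro mult_left_mono) auto
        also have "\<dots> = r * \<bar>t\<bar> / 4" using D by simp
        finally show ?thesis .
      qed
      ultimately have "\<kappa> * t\<^sup>2 * measure P\<xi> {-(r/2)<..<r/2} \<le> (\<integral>y. bregman k t y \<partial>P\<xi>)"
      proof (intro integral_ge_measure[OF int])
        fix y assume "y \<in> {-(r/2)<..<r/2}"
        then have "min (t\<^sup>2 / 2) (r * \<bar>t\<bar> / 4) \<le> bregman k t y"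
          unfolding finite(2) using finite(1) by (intro bregman_quadratic) auto
        then show "\<kappa> * t\<^sup>2 \<le> bregman k t y"
          using \<open>\<kappa> * t\<^sup>2 \<le> t\<^sup>2 / 2\<close> \<open>\<kappa> * t\<^sup>2 \<le> r * \<bar>t\<bar> / 4\<close> by linarith
      qed (auto simp: sets bregman_nonneg)
      then show ?thesis by (simp add: mult_ac)
    qed
    then show ?thesis using \<kappa> q by (intro exI[of _ "\<kappa> * measure P\<xi> {-(r/2)<..<r/2}"]) auto
  next
    case infinity
    have "(\<integral>y. bregman k t y \<partial>P\<xi>) = t\<^sup>2 / 2" for t
      unfolding infinity bregman_infinity by (simp add: prob_space)
    then show ?thesis by (intro exI[of _ "1/2"]) auto
  qed
qed

context iid_model
begin

lemma integral_side:
  fixes g :: "real \<Rightarrow> real"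
  assumes A: "A \<in> sets (vec_space p)" and g: "g \<in> borel_measurable borel" "integrable P\<xi> g"
  shows "integrable Q (\<lambda>w. indicator A (fst w) * g (snd w))"
    and "(\<integral>w. indicator A (fst w) * g (snd w) \<partial>Q) = measure PX A * (\<integral>y. g y \<partial>P\<xi>)"
proof -
  have [measurable]: "A \<in> sets PX" using A PX(2) by simp
  have gm [measurable]: "g \<in> borel_measurable P\<xi>" using g(1) by (simp add: measurable_cong_sets[OF P\<xi>(2) refl])
  have "integrable Q (\<lambda>w. g (snd w))" using integral_noise(1)[OF g(1)] g(2) by simp
  then show int: "integrable Q (\<lambda>w. indicator A (fst w) * g (snd w))"
    by (rule Bochner_Integration.integrable_bound) (auto simp: indicator_def)
  have "(\<integral>w. indicator A (fst w) * g (snd w) \<partial>Q) = (\<integral>x. (\<integral>y. indicator A x * g y \<partial>P\<xi>) \<partial>PX)"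
    using integral_fst'[OF int] by simp
  then show "(\<integral>w. indicator A (fst w) * g (snd w) \<partial>Q) = measure PX A * (\<integral>y. g y \<partial>P\<xi>)"
    by simp
qed

lemma side_sum: "(\<Sum>i\<in>{1..n}. indicator A (X i \<omega>) * g (\<xi> i \<omega>)) = (\<Sum>i | i \<in> {1..n} \<and> X i \<omega> \<in> A. g (\<xi> i \<omega>))"
  for g :: "real \<Rightarrow> real"
proof -
  have "(\<Sum>i | i \<in> {1..n} \<and> X i \<omega> \<in> A. g (\<xi> i \<omega>)) = (\<Sum>i\<in>{1..n}. if X i \<omega> \<in> A then g (\<xi> i \<omega>) else 0)"
    by (rule sum.inter_filter) simp
  also have "\<dots> = (\<Sum>i\<in>{1..n}. indicator A (X i \<omega>) * g (\<xi> i \<omega>))"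
    by (intro sum.cong) (auto simp: indicator_def)
  finally show ?thesis by simp
qed

lemma side_chebyshev:
  fixes g :: "real \<Rightarrow> real"
  assumes A: "A \<in> sets (vec_space p)" and g: "g \<in> borel_measurable borel" "integrable P\<xi> (\<lambda>y. (g y)\<^sup>2)"
    and \<delta>: "0 < \<delta>"
  shows "except_prob M (n * (\<integral>y. (g y)\<^sup>2 \<partial>P\<xi>) / \<delta>\<^sup>2)
     (\<lambda>\<omega>. \<bar>(\<Sum>i | i \<in> {1..n} \<and> X i \<omega> \<in> A. g (\<xi> i \<omega>)) - n * (measure PX A * (\<integral>y. g y \<partial>P\<xi>))\<bar> < \<delta>)"
proof -
  have A' [measurable]: "A \<in> sets PX" using A PX(2) by simp
  have gm [measurable]: "g \<in> borel_measurable P\<xi>" using g(1) by (simp add: measurable_cong_sets[OF P\<xi>(2) refl])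
  have g1: "integrable P\<xi> g" by (rule P\<xi>.square_integrable_imp_integrable[OF gm g(2)])
  have sq: "(\<lambda>w. (indicator A (fst w) * g (snd w))\<^sup>2) = (\<lambda>w. indicator A (fst w) * (g (snd w))\<^sup>2)"
    by (auto simp: indicator_def)
  have g2: "(\<lambda>y. (g y)\<^sup>2) \<in> borel_measurable borel" using g(1) by measurable
  have m: "(\<lambda>w. indicator A (fst w) * g (snd w)) \<in> borel_measurable Q" by measurable
  have "(\<integral>w. (indicator A (fst w) * g (snd w))\<^sup>2 \<partial>Q) \<le> (\<integral>y. (g y)\<^sup>2 \<partial>P\<xi>)"
    unfolding sq integral_side(2)[OF A g2 g(2)] by (intro mult_left_le_one_le) auto
  then have le: "n * (\<integral>w. (indicator A (fst w) * g (snd w))\<^sup>2 \<partial>Q) / \<delta>\<^sup>2 \<le> n * (\<integral>y. (g y)\<^sup>2 \<partial>P\<xi>) / \<delta>\<^sup>2"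
    by (intro divide_right_mono mult_left_mono) auto
  have int: "integrable Q (\<lambda>w. (indicator A (fst w) * g (snd w))\<^sup>2)"
    unfolding sq by (rule integral_side(1)[OF A g2 g(2)])
  show ?thesis
    using except_prob_mono[OF chebyshev[OF m int \<delta>] le] by (simp add: side_sum integral_side(2)[OF A g(1) g1])
qed

lemma score_mean_zero:
  assumes "integrable P\<xi> (score k)"
  shows "(\<integral>y. score k y \<partial>P\<xi>) = 0"
proof -
  have "(\<integral>y. score k y \<partial>P\<xi>) = (\<integral>y. score k y \<partial>distr P\<xi> borel uminus)" by (simp add: symmetric)
  also have "\<dots> = (\<integral>y. score k (- y) \<partial>P\<xi>)"
    by (rule integral_distr) (simp_all add: measurable_cong_sets[OF P\<xi>(2) refl])
  also have "\<dots> = - (\<integral>y. score k y \<partial>P\<xi>)" by (simp add: score_odd)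
  finally show ?thesis by simp
qed

text \<open>The two true sides are fixed sets, so Chebyshev's inequality suffices and no logarithm
  appears.\<close>

lemma side_score:
  fixes K :: real
  assumes A: "A \<in> sets (vec_space p)" and sq: "integrable P\<xi> (\<lambda>y. (score k y)\<^sup>2)" and K: "0 < K"
  shows "except_prob M ((\<integral>y. (score k y)\<^sup>2 \<partial>P\<xi>) / K\<^sup>2)
     (\<lambda>\<omega>. \<bar>\<Sum>i | i \<in> {1..n} \<and> X i \<omega> \<in> A. score k (\<xi> i \<omega>)\<bar> \<le> K * sqrt n)"
proof -
  have "score k \<in> borel_measurable P\<xi>" by (simp add: measurable_cong_sets[OF P\<xi>(2) refl])
  from P\<xi>.square_integrable_imp_integrable[OF this sq] have "(\<integral>y. score k y \<partial>P\<xi>) = 0"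
    by (rule score_mean_zero)
  moreover have "0 < K * sqrt n" using K n by simp
  moreover have "n * (\<integral>y. (score k y)\<^sup>2 \<partial>P\<xi>) / (K * sqrt n)\<^sup>2 = (\<integral>y. (score k y)\<^sup>2 \<partial>P\<xi>) / K\<^sup>2"
    using n by (simp add: power_mult_distrib)
  ultimately show ?thesis
    using side_chebyshev[OF A measurable_score sq, of "K * sqrt n"] by (auto elim: except_prob_mono)
qed

text \<open>The mean is at least of order \<open>n * t\<^sup>2\<close>, and so large is the variance
  at most, since the remainder is bounded by \<open>C * \<bar>t\<bar>\<close>. Chebyshev's
  inequality at half the mean fails with probability of order \<open>1 / (n * t\<^sup>2)\<close>,
  small once \<open>t\<close> is a large multiple of \<open>1 / sqrt n\<close>.\<close>

lemma side_bregman: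
  fixes t c \<kappa> C :: real
  assumes A: "A \<in> sets (vec_space p)" and c: "0 < c" "c \<le> measure PX A"
    and \<kappa>: "0 < \<kappa>" "\<kappa> * t\<^sup>2 \<le> (\<integral>y. bregman k t y \<partial>P\<xi>)" and t: "t \<noteq> 0"
    and C: "\<And>x. \<bar>score k (x + t) - score k x\<bar> \<le> C"
  shows "except_prob M (4 * C\<^sup>2 / (c\<^sup>2 * \<kappa>\<^sup>2 * (n * t\<^sup>2)))
     (\<lambda>\<omega>. c * \<kappa> / 2 * (n * t\<^sup>2) \<le> (\<Sum>i | i \<in> {1..n} \<and> X i \<omega> \<in> A. bregman k t (\<xi> i \<omega>)))"
proof -
  have b: "bregman k t x \<le> C * \<bar>t\<bar>" for x
    using bregman_le[of k t x] mult_left_mono[OF C[of x], of "\<bar>t\<bar>"] by (simp add: mult.commute)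
  have sq: "(bregman k t x)\<^sup>2 \<le> C\<^sup>2 * t\<^sup>2" for x
    using power_mono[OF b[of x] bregman_nonneg, of 2] by (simp add: power_mult_distrib)
  have m: "(\<lambda>y. (bregman k t y)\<^sup>2) \<in> borel_measurable P\<xi>" by (simp add: measurable_cong_sets[OF P\<xi>(2) refl])
  have int: "integrable P\<xi> (\<lambda>y. (bregman k t y)\<^sup>2)"
    by (rule P\<xi>.integrable_const_bound[of _ "C\<^sup>2 * t\<^sup>2", OF _ m]) (auto simp: sq)
  have "(\<integral>y. (bregman k t y)\<^sup>2 \<partial>P\<xi>) \<le> (\<integral>y. C\<^sup>2 * t\<^sup>2 \<partial>P\<xi>)"
    by (intro integral_mono int) (auto simp: sq)
  then have int_le: "(\<integral>y. (bregman k t y)\<^sup>2 \<partial>P\<xi>) \<le> C\<^sup>2 * t\<^sup>2" by (simp add: P\<xi>.prob_space)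
  define \<delta> where "\<delta> = c * \<kappa> / 2 * (n * t\<^sup>2)"
  have \<delta>: "0 < \<delta>" using c \<kappa> t n by (simp add: \<delta>_def)
  have mean: "2 * \<delta> \<le> n * (measure PX A * (\<integral>y. bregman k t y \<partial>P\<xi>))"
  proof -
    have "c * (\<kappa> * t\<^sup>2) \<le> measure PX A * (\<integral>y. bregman k t y \<partial>P\<xi>)" using c \<kappa> by (intro mult_mono) auto
    then have "n * (c * (\<kappa> * t\<^sup>2)) \<le> n * (measure PX A * (\<integral>y. bregman k t y \<partial>P\<xi>))" by (intro mult_left_mono) auto
    then show ?thesis by (simp add: \<delta>_def mult_ac)
  qed
  have "n * (\<integral>y. (bregman k t y)\<^sup>2 \<partial>P\<xi>) / \<delta>\<^sup>2 \<le> n * (C\<^sup>2 * t\<^sup>2) / \<delta>\<^sup>2"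
    using int_le by (intro divide_right_mono mult_left_mono) auto
  also have "\<dots> = 4 * C\<^sup>2 / (c\<^sup>2 * \<kappa>\<^sup>2 * (n * t\<^sup>2))"
    using c \<kappa> t n by (simp add: \<delta>_def power2_eq_square field_simps)
  finally have le: "n * (\<integral>y. (bregman k t y)\<^sup>2 \<partial>P\<xi>) / \<delta>\<^sup>2 \<le> 4 * C\<^sup>2 / (c\<^sup>2 * \<kappa>\<^sup>2 * (n * t\<^sup>2))" .
  show ?thesis
    unfolding \<delta>_def[symmetric]
    by (rule except_prob_mono[OF side_chebyshev[OF A measurable_bregman int \<delta>] le]) (use mean in linarith)
qed

end

section \<open>Rates on a regular sample\<close>

context iid_model
begin

lemma cell_prob_range: "0 \<le> cell_prob A s d" "cell_prob A s d \<le> 1"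
  by (simp_all add: cell_prob_def)

lemma sets_cell: "A \<in> sets (vec_space p) \<Longrightarrow> {x\<in>space PX. x \<in> A \<and> (0 < dot p x d) = s} \<in> sets PX"
proof -
  assume [measurable]: "A \<in> sets (vec_space p)"
  note [measurable] = measurable_dot
  show ?thesis unfolding space_PX PX(2) by measurable
qed

lemma half_prob: "measure PX (half d0 s) = cell_prob (half d0 s) True d + cell_prob (half d0 s) False d"
proof -
  have eq: "half d0 s = {x\<in>space PX. x \<in> half d0 s \<and> (0 < dot p x d) = True} \<union> {x\<in>space PX. x \<in> half d0 s \<and> (0 < dot p x d) = False}"
    by (auto simp: half_def space_PX)
  have disj: "{x\<in>space PX. x \<in> half d0 s \<and> (0 < dot p x d) = True} \<inter> {x\<in>space PX. x \<in> half d0 s \<and> (0 < dot p x d) = False} = {}"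
    by auto
  show ?thesis
    unfolding cell_prob_def
    by (subst eq, rule PX.finite_measure_Union[OF sets_cell[OF sets_half] sets_cell[OF sets_half] disj])
qed

lemma mismatch_cells: "mismatch_prob p PX d d0 = cell_prob (half d0 True) False d + cell_prob (half d0 False) True d"
proof -
  have eq: "{x\<in>space PX. csign (dot p x d) \<noteq> csign (dot p x d0)} =
     {x\<in>space PX. x \<in> half d0 True \<and> (0 < dot p x d) = False} \<union> {x\<in>space PX. x \<in> half d0 False \<and> (0 < dot p x d) = True}"
    by (auto simp: half_def space_PX csign_neq)
  have disj: "{x\<in>space PX. x \<in> half d0 True \<and> (0 < dot p x d) = False} \<inter> {x\<in>space PX. x \<in> half d0 False \<and> (0 < dot p x d) = True} = {}"
    by (auto simp: half_def)
  show ?thesis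
    unfolding mismatch_prob_def cell_prob_def eq
    by (rule PX.finite_measure_Union[OF sets_cell[OF sets_half] sets_cell[OF sets_half] disj])
qed

text \<open>The counting bound appears twice because of the order in which constants are chosen. The
  pair \<open>\<rho>1\<close>, \<open>g1\<close> belongs to shifts of at least half the separation
  of the levels and determines the tolerance \<open>\<tau>\<close>; the pair \<open>\<rho>\<close>,
  \<open>g\<close> belongs to shifts of at least \<open>\<tau>\<close>.\<close>

definition regular_sample ::
  "ennreal \<Rightarrow> (nat \<Rightarrow> real) \<Rightarrow> real \<Rightarrow> real \<Rightarrow> real \<Rightarrow> real \<Rightarrow> real \<Rightarrow> real \<Rightarrow> real \<Rightarrow> real \<Rightarrow> 'a \<Rightarrow> bool" where
  "regular_sample k d0 V s K1 K2 \<rho> g \<rho>1 g1 \<omega> \<longleftrightarrow>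
    (\<forall>u. \<bar>\<Sum>i | i \<in> {1..n} \<and> X i \<omega> \<in> half d0 u. score k (\<xi> i \<omega>)\<bar> \<le> K1 * sqrt n) \<and>
    (\<forall>u d. \<bar>\<Sum>i\<in>cell (half d0 u) (\<not> u) d \<omega>. score k (\<xi> i \<omega>)\<bar> \<le> s * real n * cell_prob (half d0 u) (\<not> u) d + K2 * V) \<and>
    (\<forall>u. \<forall>t\<in>{-1,1}. \<forall>v d. g * real n * cell_prob (half d0 u) v d - K2 * V
       \<le> card {i\<in>cell (half d0 u) v d \<omega>. \<xi> i \<omega> * t < 0 \<and> \<bar>\<xi> i \<omega>\<bar> < \<rho>}) \<and>
    (\<forall>u. \<forall>t\<in>{-1,1}. \<forall>v d. g1 * real n * cell_prob (half d0 u) v d - K2 * V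
       \<le> card {i\<in>cell (half d0 u) v d \<omega>. \<xi> i \<omega> * t < 0 \<and> \<bar>\<xi> i \<omega>\<bar> < \<rho>1}) \<and>
    (\<forall>u d. card (cell (half d0 u) (\<not> u) d \<omega>) \<le> 4 * real n * cell_prob (half d0 u) (\<not> u) d + K2 * V)"

definition regular_curvature :: "ennreal \<Rightarrow> (nat \<Rightarrow> real) \<Rightarrow> real \<Rightarrow> real \<Rightarrow> 'a \<Rightarrow> bool" where
  "regular_curvature k d0 G t \<omega> \<longleftrightarrow>
    (\<forall>u. \<forall>\<sigma>\<in>{-1,1}. G * (real n * t\<^sup>2) \<le> (\<Sum>i | i \<in> {1..n} \<and> X i \<omega> \<in> half d0 u. bregman k (\<sigma> * t) (\<xi> i \<omega>)))"

text \<open>Purely deterministic. \<open>consistent\<close> makes every cell with a wrong level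
  light, \<open>slack\<close> lets the curvature on misclassified cells absorb the terms
  proportional to their mass, and \<open>large\<close> contradicts the second-step bound beyond
  radius \<open>t\<close>.\<close>

lemma estimate_rates:
  fixes \<alpha>0 \<beta>0 a b ai bi D C \<kappa>1 \<rho>1 \<kappa> \<tau> \<rho> \<eta> V s K1 K2 g g1 G t K5 :: real
  assumes \<omega>: "\<omega> \<in> space M"
    and est: "two_step_estimate k \<Omega> p n (\<lambda>i. X i \<omega>) (\<lambda>i. response p \<alpha>0 \<beta>0 d0 X \<xi> i \<omega>) ai bi d a b"
    and \<Omega>: "(\<alpha>0, \<beta>0) \<in> \<Omega>" "\<And>\<alpha> \<beta>. (\<alpha>, \<beta>) \<in> \<Omega> \<Longrightarrow> \<beta> < \<alpha> \<and> \<bar>\<alpha>\<bar> \<le> D / 2 \<and> \<bar>\<beta>\<bar> \<le> D / 2"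
    and d0: "d0 \<in> unit_sphere p"
    and C: "0 < C" "\<And>t x. \<bar>t\<bar> \<le> D \<Longrightarrow> \<bar>score k (x + t) - score k x\<bar> \<le> C"
    and curv1: "0 < \<kappa>1" "\<And>t x. (\<alpha>0 - \<beta>0) / 2 \<le> \<bar>t\<bar> \<Longrightarrow> x * t < 0 \<Longrightarrow> \<bar>x\<bar> < \<rho>1 \<Longrightarrow> \<kappa>1 \<le> bregman k t x"
    and curv: "0 < \<kappa>" "\<And>t x. \<tau> \<le> \<bar>t\<bar> \<Longrightarrow> x * t < 0 \<Longrightarrow> \<bar>x\<bar> < \<rho> \<Longrightarrow> \<kappa> \<le> bregman k t x"
    and \<tau>: "0 < \<tau>" "2 * \<tau> \<le> \<alpha>0 - \<beta>0"
    and mass: "\<And>u. 2 * \<eta> \<le> measure PX (half d0 u)"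
    and reg: "regular_sample k d0 V s K1 K2 \<rho> g \<rho>1 g1 \<omega>" "regular_curvature k d0 G t \<omega>"
    and pos: "0 < g" "0 < g1" "0 \<le> V" "0 \<le> K2" "0 < s" "0 < t"
    and consistent: "D * (2 * K1 * sqrt n + 2 * s * n + 2 * K2 * V) + \<kappa> * K2 * V < \<kappa> * g * \<eta> * n"
    and slack: "4 * D * s \<le> \<kappa>1 * g1" "16 * C * \<tau> \<le> \<kappa>1 * g1"
    and K5: "K5 = 2 * (2 * \<kappa>1 * K2 + 2 * D * K2 + 2 * C * \<tau> * K2) / (\<kappa>1 * g1)"
    and large: "2 * (2 * K1 * sqrt n + ((s + 4 * C) * K5 + 2 * K2 + 2 * C * K2) * V) < G * (n * t)"
  shows "n * mismatch_prob p PX d d0 \<le> K5 * V \<and> \<bar>a - \<alpha>0\<bar> < t \<and> \<bar>b - \<beta>0\<bar> < t"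
proof -
  interpret cell_data "{1..n}" "\<lambda>i. 0 < dot p (X i \<omega>) d0" "\<lambda>i. 0 < dot p (X i \<omega>) d" "\<lambda>i. \<xi> i \<omega>" k
    by unfold_locales simp
  define \<Delta> where "\<Delta> = \<alpha>0 - \<beta>0"
  have cell: "cell (half d0 u) v d \<omega> = cell_of u v" for u v
    using cell_half[OF \<omega>] by (auto simp: cell_of_def)
  have side: "{i. i \<in> {1..n} \<and> X i \<omega> \<in> half d0 u} = side_of u" for u
    using X_space[OF \<omega>] by (auto simp: side_of_def half_def)
  define P where "P u v = cell_prob (half d0 u) v d" for u v
  have P: "0 \<le> P u v" "P u v \<le> 1" for u v unfolding P_def by (rule cell_prob_range)+
  define m where "m = P True False + P False True"
  have m: "m = mismatch_prob p PX d d0" "0 \<le> m" using P by (simp_all add: m_def P_def mismatch_cells)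
  have S_side_le: "\<bar>S (side_of u)\<bar> \<le> K1 * sqrt n" for u
    using reg(1) unfolding regular_sample_def S_def side by blast
  have S_cell_le: "\<bar>S (cell_of u (\<not> u))\<bar> \<le> s * n * P u (\<not> u) + K2 * V" for u
    using reg(1) unfolding regular_sample_def S_def cell[symmetric] P_def by blast
  have N_le: "card (cell_of u (\<not> u)) \<le> 4 * real n * P u (\<not> u) + K2 * V" for u
    using reg(1) unfolding regular_sample_def cell[symmetric] P_def by blast
  \<comment> \<open>Only the sign of the shift matters for the count, which reduces all shifts to
    the two values in \<open>regular_sample\<close>.\<close>
  have sgn_set: "{i\<in>A. \<xi> i \<omega> * q < 0 \<and> \<bar>\<xi> i \<omega>\<bar> < r} = {i\<in>A. \<xi> i \<omega> * sgn q < 0 \<and> \<bar>\<xi> i \<omega>\<bar> < r}" for A q r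
    by (auto simp: sgn_real_def mult_less_0_iff)
  have R_cell: "\<kappa> * (g * n * P u v - K2 * V) \<le> R q (cell_of u v)" if q: "\<tau> \<le> \<bar>q\<bar>" for q u v
  proof -
    have "sgn q \<in> {-1, 1}" using q \<tau> by (auto simp: sgn_real_def)
    then have "g * n * P u v - K2 * V \<le> card {i\<in>cell_of u v. \<xi> i \<omega> * q < 0 \<and> \<bar>\<xi> i \<omega>\<bar> < \<rho>}"
      using reg(1) unfolding regular_sample_def cell[symmetric] P_def sgn_set[of _ q] by blast
    then have "\<kappa> * (g * n * P u v - K2 * V) \<le> \<kappa> * card {i\<in>cell_of u v. \<xi> i \<omega> * q < 0 \<and> \<bar>\<xi> i \<omega>\<bar> < \<rho>}"
      using curv(1) by (intro mult_left_mono) auto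
    also have "\<dots> \<le> R q (cell_of u v)"
      by (rule R_lower) (use curv q in auto)
    finally show ?thesis .
  qed
  have R_cell1: "\<kappa>1 * (g1 * n * P u v - K2 * V) \<le> R q (cell_of u v)" if q: "\<Delta> / 2 \<le> \<bar>q\<bar>" for q u v
  proof -
    have "sgn q \<in> {-1, 1}" using q \<tau> by (auto simp: sgn_real_def \<Delta>_def)
    then have "g1 * n * P u v - K2 * V \<le> card {i\<in>cell_of u v. \<xi> i \<omega> * q < 0 \<and> \<bar>\<xi> i \<omega>\<bar> < \<rho>1}"
      using reg(1) unfolding regular_sample_def cell[symmetric] P_def sgn_set[of _ q] by blast
    then have "\<kappa>1 * (g1 * n * P u v - K2 * V) \<le> \<kappa>1 * card {i\<in>cell_of u v. \<xi> i \<omega> * q < 0 \<and> \<bar>\<xi> i \<omega>\<bar> < \<rho>1}"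
      using curv1(1) by (intro mult_left_mono) auto
    also have "\<dots> \<le> R q (cell_of u v)"
      by (rule R_lower) (use curv1 q in \<open>auto simp: \<Delta>_def\<close>)
    finally show ?thesis .
  qed
  have emp: "empirical_loss k p n (\<lambda>i. X i \<omega>) (\<lambda>i. response p \<alpha>0 \<beta>0 d0 X \<xi> i \<omega>) \<alpha> \<beta> d
      = loss (\<alpha>0 - \<alpha>) (\<beta>0 - \<beta>) (\<beta>0 - \<alpha>) (\<alpha>0 - \<beta>)" for \<alpha> \<beta>
    unfolding empirical_loss_def loss_def response_def step_value_if
    by (intro sum.cong refl arg_cong[where f="scaled_huber k"]) auto
  have emp0: "empirical_loss k p n (\<lambda>i. X i \<omega>) (\<lambda>i. response p \<alpha>0 \<beta>0 d0 X \<xi> i \<omega>) \<alpha> \<beta> d0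
      = loss (\<alpha>0 - \<alpha>) (\<beta>0 - \<beta>) (\<beta>0 - \<beta>) (\<alpha>0 - \<alpha>)" for \<alpha> \<beta>
    unfolding empirical_loss_def loss_def response_def step_value_if
    by (intro sum.cong refl arg_cong[where f="scaled_huber k"]) auto
  have min1: "(ai, bi) \<in> \<Omega>" "\<And>\<alpha> \<beta>. (\<alpha>, \<beta>) \<in> \<Omega> \<Longrightarrow>
      loss (\<alpha>0 - ai) (\<beta>0 - bi) (\<beta>0 - ai) (\<alpha>0 - bi) \<le> loss (\<alpha>0 - \<alpha>) (\<beta>0 - \<beta>) (\<beta>0 - \<beta>) (\<alpha>0 - \<alpha>)"
    and min2: "(a, b) \<in> \<Omega>" "\<And>\<alpha> \<beta>. (\<alpha>, \<beta>) \<in> \<Omega> \<Longrightarrow>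
      loss (\<alpha>0 - a) (\<beta>0 - b) (\<beta>0 - a) (\<alpha>0 - b) \<le> loss (\<alpha>0 - \<alpha>) (\<beta>0 - \<beta>) (\<beta>0 - \<alpha>) (\<alpha>0 - \<beta>)"
    using est d0 unfolding two_step_estimate_def is_arg_min_def
    by (auto simp: emp emp0[symmetric] not_less split: prod.splits)
  define t1 t2 t3 t4 where t: "t1 = \<alpha>0 - ai" "t2 = \<beta>0 - bi" "t3 = \<beta>0 - ai" "t4 = \<alpha>0 - bi"
  have bd: "\<bar>\<alpha>0\<bar> \<le> D / 2" "\<bar>\<beta>0\<bar> \<le> D / 2" "\<bar>ai\<bar> \<le> D / 2" "\<bar>bi\<bar> \<le> D / 2" "bi < ai" "\<bar>a\<bar> \<le> D / 2" "\<bar>b\<bar> \<le> D / 2"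
    using \<Omega>(2)[OF \<Omega>(1)] \<Omega>(2)[OF min1(1)] \<Omega>(2)[OF min2(1)] by auto
  have D: "\<bar>t1\<bar> \<le> D" "\<bar>t2\<bar> \<le> D" "\<bar>t3 - t2\<bar> \<le> D" "\<bar>t4 - t1\<bar> \<le> D" "0 \<le> D" using bd by (auto simp: t)
  define E where "E = D * (2 * K1 * sqrt n + 2 * s * n + 2 * K2 * V)"
  have sP: "s * n * P u v \<le> s * n" for u v using P[of u v] pos by (intro mult_left_le) auto
  have "R t1 (cell_of False False) + R t2 (cell_of True True) + R t3 (cell_of True False) + R t4 (cell_of False True)
    \<le> D * (\<bar>S (side_of False)\<bar> + \<bar>S (side_of True)\<bar> + \<bar>S (cell_of True False)\<bar> + \<bar>S (cell_of False True)\<bar>)"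
    using min1(2)[OF \<Omega>(1)] by (intro first_step_remainder D) (simp add: t)
  also have "\<dots> \<le> E"
    unfolding E_def
    using S_side_le[of True] S_side_le[of False] S_cell_le[of True] S_cell_le[of False] sP[of True False] sP[of False True]
    by (intro mult_left_mono D) simp_all
  finally have RE: "R t1 (cell_of False False) + R t2 (cell_of True True) + R t3 (cell_of True False) + R t4 (cell_of False True) \<le> E" .
  \<comment> \<open>A level wrong by \<open>\<tau>\<close> costs \<open>\<kappa> * g * n\<close>
    times the mass of the cell, up to \<open>\<kappa> * K2 * V\<close>, while the whole remainder is
    at most \<open>E\<close>.\<close>
  have small: "P u v < \<eta>" if "\<tau> \<le> \<bar>q\<bar>" "R q (cell_of u v) \<le> E" for q u v
  proof -
    have "\<kappa> * g * n * P u v \<le> E + \<kappa> * K2 * V"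
      using R_cell[OF that(1), of u v] that(2) by (simp add: algebra_simps)
    also have "\<dots> < \<kappa> * g * n * \<eta>" using consistent by (simp add: E_def mult_ac)
    finally show ?thesis using curv(1) pos n by (simp add: mult_less_cancel_left_pos)
  qed
  have lev: "\<bar>\<alpha>0 - ai\<bar> < \<tau> \<and> \<bar>\<beta>0 - bi\<bar> < \<tau>"
  proof (rule levels_identified)
    show "2 * \<eta> \<le> P False False + P False True" "2 * \<eta> \<le> P True False + P True True"
      using mass half_prob[of d0 _ d] by (simp_all add: P_def add.commute)
    show "\<tau> \<le> \<bar>\<alpha>0 - ai\<bar> \<Longrightarrow> P False False < \<eta>" "\<tau> \<le> \<bar>\<beta>0 - bi\<bar> \<Longrightarrow> P True True < \<eta>"
      "\<tau> \<le> \<bar>\<beta>0 - ai\<bar> \<Longrightarrow> P True False < \<eta>" "\<tau> \<le> \<bar>\<alpha>0 - bi\<bar> \<Longrightarrow> P False True < \<eta>"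
      using small[of t1 False False] small[of t2 True True] small[of t3 True False] small[of t4 False True] RE
        R_nonneg[of t1 "cell_of False False"] R_nonneg[of t2 "cell_of True True"]
        R_nonneg[of t3 "cell_of True False"] R_nonneg[of t4 "cell_of False True"]
      by (auto simp: t)
  qed (use \<tau> bd in auto)
  \<comment> \<open>With the levels within \<open>\<tau>\<close>, at most half the separation, a
    misclassified point is still shifted by at least the other half.\<close>
  have big: "\<Delta> / 2 \<le> \<bar>t3\<bar>" "\<Delta> / 2 \<le> \<bar>t4\<bar>" using lev \<tau>(2) by (auto simp: t \<Delta>_def abs_if split: if_splits)
  have mis: "R t3 (cell_of True False) + R t4 (cell_of False True)
    \<le> D * (\<bar>S (cell_of True False)\<bar> + \<bar>S (cell_of False True)\<bar>) + C * \<tau> * (card (cell_of True False) + card (cell_of False True))"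
  proof (rule misclassified_remainder)
    have "excess t1 t2 t3 t4 \<le> excess t1 t2 t2 t1" using min1(2)[OF min1(1)] by (simp add: loss_excess t)
    then show "excess t1 t2 t3 t4 \<le> t1 * S (side_of False) + R t1 (side_of False) + t2 * S (side_of True) + R t2 (side_of True)"
      by (simp add: excess_def S_side R_side algebra_simps)
  qed (use D C lev in \<open>auto simp: t\<close>)
  have mn: "s * n * P True False + s * n * P False True = s * n * m" by (simp add: m_def distrib_left)
  have scores: "\<bar>S (cell_of True False)\<bar> + \<bar>S (cell_of False True)\<bar> \<le> s * n * m + 2 * K2 * V"
    using S_cell_le[of True] S_cell_le[of False] mn by simp
  have cards: "real (card (cell_of True False)) + card (cell_of False True) \<le> 4 * real n * m + 2 * K2 * V"
    using N_le[of True] N_le[of False] by (simp add: m_def distrib_left)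
  have rate: "n * m \<le> K5 * V"
  proof -
    have "\<kappa>1 * (g1 * n * P True False - K2 * V) + \<kappa>1 * (g1 * n * P False True - K2 * V)
      \<le> D * (s * n * m + 2 * K2 * V) + C * \<tau> * (4 * real n * m + 2 * K2 * V)"
    proof -
      have "D * (\<bar>S (cell_of True False)\<bar> + \<bar>S (cell_of False True)\<bar>) \<le> D * (s * n * m + 2 * K2 * V)"
        using scores D(5) by (rule mult_left_mono)
      moreover have "C * \<tau> * (real (card (cell_of True False)) + card (cell_of False True)) \<le> C * \<tau> * (4 * real n * m + 2 * K2 * V)"
        using cards C(1) \<tau>(1) by (intro mult_left_mono) auto
      ultimately show ?thesis
        using mis[unfolded of_nat_add] R_cell1[OF big(1), of True False] R_cell1[OF big(2), of False True] by linarith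
    qed
    \<comment> \<open>The two \<open>slack\<close> conditions bound \<open>D * s\<close> and
      \<open>4 * C * \<tau>\<close> by a quarter of \<open>\<kappa>1 * g1\<close> each, so half the
      curvature survives.\<close>
    then have "(\<kappa>1 * g1 - D * s - 4 * C * \<tau>) * (n * m) \<le> (2 * \<kappa>1 * K2 + 2 * D * K2 + 2 * C * \<tau> * K2) * V"
      by (simp add: m_def algebra_simps)
    moreover have "\<kappa>1 * g1 / 2 * (n * m) \<le> (\<kappa>1 * g1 - D * s - 4 * C * \<tau>) * (n * m)"
      using slack m(2) by (intro mult_right_mono) (auto simp: algebra_simps)
    ultimately have "\<kappa>1 * g1 / 2 * (n * m) \<le> (2 * \<kappa>1 * K2 + 2 * D * K2 + 2 * C * \<tau> * K2) * V" by linarith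
    then show ?thesis using curv1(1) pos(2) unfolding K5 by (simp add: field_simps)
  qed
  define W where "W = \<bar>S (side_of False)\<bar> + \<bar>S (side_of True)\<bar> + \<bar>S (cell_of True False)\<bar> + \<bar>S (cell_of False True)\<bar>
      + C * (card (cell_of True False) + card (cell_of False True))"
  have W0: "0 \<le> W" unfolding W_def using C(1) by auto
  have W: "2 * W < G * (n * t)"
  proof -
    have "C * (real (card (cell_of True False)) + card (cell_of False True)) \<le> C * (4 * real n * m + 2 * K2 * V)"
      using cards C(1) by (intro mult_left_mono) auto
    then have "W \<le> 2 * K1 * sqrt n + (s * n * m + 2 * K2 * V) + C * (4 * real n * m + 2 * K2 * V)"
      using S_side_le[of True] S_side_le[of False] scores by (simp add: W_def)
    also have "\<dots> = 2 * K1 * sqrt n + (s + 4 * C) * (n * m) + (2 * K2 + 2 * C * K2) * V"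
      by (simp add: algebra_simps)
    also have "\<dots> \<le> 2 * K1 * sqrt n + (s + 4 * C) * (K5 * V) + (2 * K2 + 2 * C * K2) * V"
      using rate pos C(1) by (intro add_mono order_refl mult_left_mono) auto
    finally show ?thesis using large by (simp add: algebra_simps)
  qed
  define q1 q2 where q: "q1 = \<alpha>0 - a" "q2 = \<beta>0 - b"
  have second: "R q1 (side_of False) + R q2 (side_of True) \<le> (\<bar>q1\<bar> + \<bar>q2\<bar>) * W"
    unfolding W_def
  proof (rule second_step_remainder[where D = D and \<Delta> = \<Delta>])
    show "loss q1 q2 (q1 - \<Delta>) (q2 + \<Delta>) \<le> loss 0 0 (- \<Delta>) \<Delta>"
      using min2(2)[OF \<Omega>(1)] by (simp add: q \<Delta>_def)
  qed (use bd C in \<open>auto simp: q \<Delta>_def\<close>)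
  \<comment> \<open>Superlinearity brings a deviation beyond \<open>t\<close> back to the radius
    \<open>t\<close>, where the curvature is known. Per unit of deviation it amounts to
    \<open>G * (n * t)\<close>, against \<open>2 * W\<close> from the linear term.\<close>
  have close: False if big: "t \<le> \<bar>q\<bar>" and le: "R q (side_of u) \<le> 2 * \<bar>q\<bar> * W" for q u
  proof -
    have "sgn q \<in> {-1, 1}" using big pos by (auto simp: sgn_real_def)
    then have "G * (n * t\<^sup>2) \<le> R (sgn q * t) (side_of u)"
      using reg(2) unfolding regular_curvature_def R_def side by blast
    then have "\<bar>q\<bar> / t * (G * (n * t\<^sup>2)) \<le> \<bar>q\<bar> / t * R (sgn q * t) (side_of u)"
      using pos by (intro mult_left_mono) auto
    also have "\<dots> \<le> R (\<bar>q\<bar> / t * (sgn q * t)) (side_of u)" using big pos by (intro R_scale) auto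
    also have "\<bar>q\<bar> / t * (sgn q * t) = q" using pos by (simp add: sgn_real_def)
    finally have "\<bar>q\<bar> * (G * (n * t)) \<le> 2 * \<bar>q\<bar> * W" using le pos by (simp add: power2_eq_square)
    moreover have "\<bar>q\<bar> * (2 * W) < \<bar>q\<bar> * (G * (n * t))" using W big pos by (intro mult_strict_left_mono) auto
    ultimately show False by (simp add: mult_ac)
  qed
  \<comment> \<open>The larger deviation is treated alone; the remainder of the other one is dropped
    as nonnegative.\<close>
  have "\<bar>q1\<bar> < t \<and> \<bar>q2\<bar> < t"
  proof (cases "\<bar>q2\<bar> \<le> \<bar>q1\<bar>")
    case True
    have "R q1 (side_of False) \<le> (\<bar>q1\<bar> + \<bar>q1\<bar>) * W"
      using second R_nonneg[of q2 "side_of True"] mult_right_mono[of "\<bar>q1\<bar> + \<bar>q2\<bar>" "\<bar>q1\<bar> + \<bar>q1\<bar>" W] True W0 by simp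
    then show ?thesis using close[of q1 False] True by (cases "t \<le> \<bar>q1\<bar>") auto
  next
    case False
    have "R q2 (side_of True) \<le> (\<bar>q2\<bar> + \<bar>q2\<bar>) * W"
      using second R_nonneg[of q1 "side_of False"] mult_right_mono[of "\<bar>q1\<bar> + \<bar>q2\<bar>" "\<bar>q2\<bar> + \<bar>q2\<bar>" W] False W0 by simp
    then show ?thesis using close[of q2 True] False by (cases "t \<le> \<bar>q2\<bar>") auto
  qed
  then show ?thesis using rate m by (auto simp: q abs_minus_commute)
qed

end

section \<open>Rates of convergence\<close>

context iid_model
begin

lemma except_prob_bool:
  assumes "\<And>u :: bool. except_prob M e (P u)"
  shows "except_prob M (2 * e) (\<lambda>\<omega>. \<forall>u. P u \<omega>)"
  using except_prob_all[of "UNIV :: bool set" M "\<lambda>_. e" P] assms by (simp add: UNIV_bool all_bool_eq conj_commute)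

lemma except_prob_sign:
  assumes "\<And>t :: real. t \<in> {-1, 1} \<Longrightarrow> except_prob M e (P t)"
  shows "except_prob M (2 * e) (\<lambda>\<omega>. \<forall>t\<in>{-1, 1}. P t \<omega>)"
  using except_prob_all[of "{-1, 1 :: real}" M "\<lambda>_. e" P] assms by auto

lemma regular_counts_prob:
  fixes e K V :: real
  assumes p: "1 \<le> p" "p \<le> n" and e: "0 < e" and K: "entropy e \<le> K * V"
  shows "except_prob M (8 * e) (\<lambda>\<omega>. \<forall>u. \<forall>t\<in>{-1,1}. \<forall>v d.
      measure P\<xi> {y. 0 < \<bar>y\<bar> \<and> \<bar>y\<bar> < \<rho>} / 8 * real n * cell_prob (half d0 u) v d - K * V
       \<le> card {i\<in>cell (half d0 u) v d \<omega>. \<xi> i \<omega> * t < 0 \<and> \<bar>\<xi> i \<omega>\<bar> < \<rho>})"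
proof -
  have "except_prob M e (\<lambda>\<omega>. \<forall>d.
      measure P\<xi> {y. 0 < \<bar>y\<bar> \<and> \<bar>y\<bar> < \<rho>} / 8 * real n * cell_prob (half d0 u) v d - K * V
       \<le> card {i\<in>cell (half d0 u) v d \<omega>. \<xi> i \<omega> * t < 0 \<and> \<bar>\<xi> i \<omega>\<bar> < \<rho>})" if "t \<in> {-1, 1}" for t :: real and u v
  proof -
    have t: "t \<noteq> 0" using that by auto
    show ?thesis
    proof (rule except_prob_mono[OF count_lower[OF p sets_half t e, folded except_prob_def, of \<rho> d0 u v]])
      fix \<omega> assume *: "\<forall>d. n * measure P\<xi> {y. 0 < \<bar>y\<bar> \<and> \<bar>y\<bar> < \<rho>} * cell_prob (half d0 u) v d / 8 - entropy e
        \<le> card {i\<in>cell (half d0 u) v d \<omega>. \<xi> i \<omega> * t < 0 \<and> \<bar>\<xi> i \<omega>\<bar> < \<rho>}"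
      show "\<forall>d. measure P\<xi> {y. 0 < \<bar>y\<bar> \<and> \<bar>y\<bar> < \<rho>} / 8 * real n * cell_prob (half d0 u) v d - K * V
       \<le> card {i\<in>cell (half d0 u) v d \<omega>. \<xi> i \<omega> * t < 0 \<and> \<bar>\<xi> i \<omega>\<bar> < \<rho>}"
      proof
        fix d
        have "measure P\<xi> {y. 0 < \<bar>y\<bar> \<and> \<bar>y\<bar> < \<rho>} / 8 * real n * cell_prob (half d0 u) v d
            = n * measure P\<xi> {y. 0 < \<bar>y\<bar> \<and> \<bar>y\<bar> < \<rho>} * cell_prob (half d0 u) v d / 8" by simp
        then show "measure P\<xi> {y. 0 < \<bar>y\<bar> \<and> \<bar>y\<bar> < \<rho>} / 8 * real n * cell_prob (half d0 u) v d - K * V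
          \<le> card {i\<in>cell (half d0 u) v d \<omega>. \<xi> i \<omega> * t < 0 \<and> \<bar>\<xi> i \<omega>\<bar> < \<rho>}"
          using *[rule_format, of d] K by linarith
      qed
    qed simp
  qed
  from except_prob_bool[OF except_prob_sign[OF except_prob_bool[OF this]], of "\<lambda>u t v. t" "\<lambda>u t v. u" "\<lambda>u t v. v"]
  show ?thesis by simp
qed

lemma regular_sample_prob:
  fixes e K1 K2 V s :: real
  assumes p: "1 \<le> p" "p \<le> n" and e: "0 < e"
    and sq: "integrable P\<xi> (\<lambda>y. (score k y)\<^sup>2)" and K1: "0 < K1" "(\<integral>y. (score k y)\<^sup>2 \<partial>P\<xi>) / K1\<^sup>2 \<le> e"
    and noise: "\<And>u. except_prob M e (\<lambda>\<omega>. \<forall>d. \<bar>\<Sum>i\<in>cell (half d0 u) (\<not> u) d \<omega>. score k (\<xi> i \<omega>)\<bar>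
        \<le> s * n * cell_prob (half d0 u) (\<not> u) d + K2 * V)"
    and K2: "entropy e \<le> K2 * V" "2 * entropy e \<le> K2 * V"
  shows "except_prob M (22 * e) (regular_sample k d0 V s K1 K2 \<rho> (measure P\<xi> {y. 0 < \<bar>y\<bar> \<and> \<bar>y\<bar> < \<rho>} / 8)
     \<rho>1 (measure P\<xi> {y. 0 < \<bar>y\<bar> \<and> \<bar>y\<bar> < \<rho>1} / 8))"
proof -
  have 1: "except_prob M (2 * e) (\<lambda>\<omega>. \<forall>u. \<bar>\<Sum>i | i \<in> {1..n} \<and> X i \<omega> \<in> half d0 u. score k (\<xi> i \<omega>)\<bar> \<le> K1 * sqrt n)"
    by (rule except_prob_bool, rule except_prob_mono[OF side_score[OF sets_half sq K1(1)] K1(2)])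
  have 2: "except_prob M (2 * e) (\<lambda>\<omega>. \<forall>u d. \<bar>\<Sum>i\<in>cell (half d0 u) (\<not> u) d \<omega>. score k (\<xi> i \<omega>)\<bar>
        \<le> s * n * cell_prob (half d0 u) (\<not> u) d + K2 * V)"
    by (rule except_prob_bool, rule noise)
  have 3: "except_prob M (2 * e) (\<lambda>\<omega>. \<forall>u d. card (cell (half d0 u) (\<not> u) d \<omega>) \<le> 4 * real n * cell_prob (half d0 u) (\<not> u) d + K2 * V)"
  proof (rule except_prob_bool)
    fix u
    show "except_prob M e (\<lambda>\<omega>. \<forall>d. card (cell (half d0 u) (\<not> u) d \<omega>) \<le> 4 * real n * cell_prob (half d0 u) (\<not> u) d + K2 * V)"
    proof (rule except_prob_mono[OF count_upper[OF p sets_half e, folded except_prob_def, of d0 u "\<not> u"]])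
      fix \<omega> assume *: "\<forall>d. real (card (cell (half d0 u) (\<not> u) d \<omega>)) \<le> real (4 * n) * cell_prob (half d0 u) (\<not> u) d + 2 * entropy e"
      have "real (4 * n) = 4 * real n" by simp
      then show "\<forall>d. card (cell (half d0 u) (\<not> u) d \<omega>) \<le> 4 * real n * cell_prob (half d0 u) (\<not> u) d + K2 * V"
        using * K2(2) by (metis add_left_mono order_trans)
    qed simp
  qed
  have "except_prob M (2 * e + (2 * e + (8 * e + (8 * e + 2 * e)))) (regular_sample k d0 V s K1 K2 \<rho> (measure P\<xi> {y. 0 < \<bar>y\<bar> \<and> \<bar>y\<bar> < \<rho>} / 8)
     \<rho>1 (measure P\<xi> {y. 0 < \<bar>y\<bar> \<and> \<bar>y\<bar> < \<rho>1} / 8))"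
    unfolding regular_sample_def
    by (intro except_prob_conj 1 2 3 regular_counts_prob p e K2)
  then show ?thesis by simp
qed

lemma regular_curvature_prob:
  fixes e C c \<kappa> t :: real
  assumes c: "0 < c" "\<And>u. c \<le> measure PX (half d0 u)" and \<kappa>: "0 < \<kappa>" and t: "0 < t" "t \<le> D"
    and mean: "\<And>t. \<bar>t\<bar> \<le> D \<Longrightarrow> \<kappa> * t\<^sup>2 \<le> (\<integral>y. bregman k t y \<partial>P\<xi>)"
    and C: "\<And>t x. \<bar>t\<bar> \<le> D \<Longrightarrow> \<bar>score k (x + t) - score k x\<bar> \<le> C"
    and e: "4 * C\<^sup>2 / (c\<^sup>2 * \<kappa>\<^sup>2 * (n * t\<^sup>2)) \<le> e"
  shows "except_prob M (4 * e) (regular_curvature k d0 (c * \<kappa> / 2) t)"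
proof -
  have "except_prob M e (\<lambda>\<omega>. c * \<kappa> / 2 * (real n * t\<^sup>2) \<le> (\<Sum>i | i \<in> {1..n} \<and> X i \<omega> \<in> half d0 u. bregman k (\<sigma> * t) (\<xi> i \<omega>)))"
    if "\<sigma> \<in> {-1, 1}" for \<sigma> :: real and u
  proof -
    have \<sigma>: "(\<sigma> * t)\<^sup>2 = t\<^sup>2" "\<bar>\<sigma> * t\<bar> \<le> D" "\<sigma> * t \<noteq> 0" using that t by auto
    show ?thesis
      using side_bregman[OF sets_half c(1) c(2) \<kappa> mean[OF \<sigma>(2)] \<sigma>(3) C[OF \<sigma>(2)], of u] e
      unfolding \<sigma>(1) by (rule except_prob_mono)
  qed
  then have "except_prob M (2 * (2 * e)) (regular_curvature k d0 (c * \<kappa> / 2) t)"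
    unfolding regular_curvature_def by (intro except_prob_bool except_prob_sign)
  then show ?thesis by simp
qed

end

section \<open>Choice of the constants\<close>

locale change_plane =
  fixes p :: "nat \<Rightarrow> nat" and M :: "nat \<Rightarrow> 'a measure" and X :: "nat \<Rightarrow> nat \<Rightarrow> 'a \<Rightarrow> nat \<Rightarrow> real"
    and \<xi> :: "nat \<Rightarrow> nat \<Rightarrow> 'a \<Rightarrow> real" and PX :: "nat \<Rightarrow> (nat \<Rightarrow> real) measure" and P\<xi> :: "real measure"
    and f :: "real \<Rightarrow> real" and \<Omega> :: "(real \<times> real) set" and \<alpha>0 \<beta>0 :: real and d0 :: "nat \<Rightarrow> nat \<Rightarrow> real"
    and \<delta> c C1 C2 C3 :: real
  assumes dim_pos: "\<And>n. n \<ge> 1 \<Longrightarrow> p n \<ge> 1"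
    and dim_growth: "(\<lambda>n. real (p n) / real n) \<longlonglongrightarrow> 0"
    and sample: "\<And>n. n \<ge> 1 \<Longrightarrow> iid_sample (p n) n (M n) (X n) (\<xi> n) (PX n) P\<xi>"
    and noise_symmetric: "distr P\<xi> borel uminus = P\<xi>"
    and noise_density: "P\<xi> = density lborel (\<lambda>x. ennreal (f x))"
      "\<And>x. f x \<ge> 0" "continuous_on UNIV f" "f 0 > 0"
    and cond_A: "compact \<Omega>" "\<And>\<alpha> \<beta>. (\<alpha>, \<beta>) \<in> \<Omega> \<Longrightarrow> \<alpha> > \<beta>" "(\<alpha>0, \<beta>0) \<in> \<Omega>"
      "\<And>n. n \<ge> 1 \<Longrightarrow> d0 n \<in> unit_sphere (p n)"
    and cond_B: "\<delta> > 0" "c > 0" "C1 > 0" "C2 > 0"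
      "\<And>n. n \<ge> 1 \<Longrightarrow> wedge_condition (p n) (PX n) (d0 n) \<delta> c C1 C2"
    and positive_side: "C3 > 0"
      "\<And>n. n \<ge> 1 \<Longrightarrow> measure (PX n) {x \<in> space (PX n). dot (p n) x (d0 n) > 0} \<ge> C3"
begin

lemma model: "1 \<le> n \<Longrightarrow> iid_model (p n) n (M n) (X n) (\<xi> n) (PX n) P\<xi>"
  using sample noise_symmetric by unfold_locales

lemma prob_noise: "prob_space P\<xi>" "sets P\<xi> = sets borel"
  using sample[of 1] by (simp_all add: iid_sample_def)

lemma noise_near_zero_pos:
  assumes "0 < \<rho>"
  shows "0 < measure P\<xi> {y. 0 < \<bar>y\<bar> \<and> \<bar>y\<bar> < \<rho>}"
proof -
  interpret prob_space P\<xi> by (rule prob_noise)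
  obtain b where b: "0 < b" "\<And>x y. x < y \<Longrightarrow> - \<rho> \<le> x \<Longrightarrow> y \<le> \<rho> \<Longrightarrow> 0 \<in> {x..y} \<Longrightarrow> b * (y - x) \<le> measure P\<xi> {x<..<y}"
    using noise_near_zero[OF prob_noise(1) noise_density assms] by blast
  have "0 < b * \<rho>" using b(1) assms by simp
  also have "b * \<rho> \<le> measure P\<xi> {0<..<\<rho>}" using b(2)[of 0 \<rho>] assms by simp
  also have "\<dots> \<le> measure P\<xi> {y. 0 < \<bar>y\<bar> \<and> \<bar>y\<bar> < \<rho>}"
  proof (rule finite_measure_mono)
    show "{y. 0 < \<bar>y\<bar> \<and> \<bar>y\<bar> < \<rho>} \<in> sets P\<xi>" unfolding prob_noise(2) by measurable
  qed auto
  finally show ?thesis .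
qed

text \<open>The nonpositive side is the wedge bound at \<open>d0\<close> itself. The positive side
  is strict, in accordance with \<open>csign\<close>, whereas \<open>min\<close> being nonnegative
  also counts points on the hyperplane; its mass therefore comes from \<open>C3\<close>.\<close>

lemma side_mass:
  assumes "1 \<le> n"
  shows "min C2 C3 \<le> measure (PX n) (iid_model.half (p n) (d0 n) u)"
proof -
  interpret iid_model "p n" n "M n" "X n" "\<xi> n" "PX n" P\<xi> by (rule model[OF assms])
  have True: "half (d0 n) True = {x \<in> space (PX n). dot (p n) x (d0 n) > 0}"
    by (auto simp: half_def space_PX)
  have False: "half (d0 n) False = {x \<in> space (PX n). max (dot (p n) x (d0 n)) (dot (p n) x (d0 n)) \<le> 0}"
    by (auto simp: half_def space_PX)
  have "l2_dist (p n) (d0 n) (d0 n) \<le> \<delta>" using cond_B(1) by (simp add: l2_dist_def L2_set_def)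
  then have "C2 \<le> measure (PX n) (half (d0 n) False)"
    using cond_B(5)[OF assms] cond_A(4)[OF assms] unfolding wedge_condition_def False by blast
  then show ?thesis using positive_side(2)[OF assms] by (cases u) (simp_all add: True)
qed

text \<open>The sets \<open>N\<close> and the scale \<open>V\<close> stand for the two losses: \<open>V n / n\<close> is the inverse of the rate.\<close>

definition score_control :: "ennreal \<Rightarrow> nat set \<Rightarrow> (nat \<Rightarrow> real) \<Rightarrow> bool" where
  "score_control k N V \<longleftrightarrow> (\<forall>s>0. \<forall>e>0. \<exists>K>0. \<exists>\<theta>>0. \<forall>n\<in>N. p n \<le> n \<longrightarrow> V n \<le> \<theta> * real n \<longrightarrow> (\<forall>u.
     except_prob (M n) e (\<lambda>\<omega>. \<forall>d. \<bar>\<Sum>i\<in>iid_model.cell (p n) n (X n) (iid_model.half (p n) (d0 n) u) (\<not> u) d \<omega>. score k (\<xi> n i \<omega>)\<bar>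
        \<le> s * real n * iid_model.cell_prob (p n) (PX n) (iid_model.half (p n) (d0 n) u) (\<not> u) d + K * V n)))"

text \<open>The constants are ordered so that none depends on a later one, and the deterministic
  argument then applies outside a small event. This covers the \<open>n\<close> for which
  \<open>V n\<close> is a small fraction of \<open>n\<close>; for the others in \<open>N\<close> the
  ratio \<open>n / V n\<close> is bounded.\<close>

proposition two_step_rates:
  fixes V :: "nat \<Rightarrow> real" and K0 :: real
  assumes sq: "integrable P\<xi> (\<lambda>y. (score k y)\<^sup>2)"
    and N: "\<And>n. n \<in> N \<Longrightarrow> 1 \<le> n" "\<And>n. n \<in> N \<Longrightarrow> 1 \<le> V n"
      "\<And>n. n \<in> N \<Longrightarrow> p n * ln (n / p n) + 2 * p n \<le> K0 * V n"
    and control: "score_control k N V" and \<epsilon>: "0 < \<epsilon>"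
  shows "\<exists>K>0. \<exists>\<theta>>0. \<exists>n0. \<forall>n\<ge>n0. n \<in> N \<longrightarrow> V n \<le> \<theta> * n \<longrightarrow>
     except_prob (M n) \<epsilon> (\<lambda>\<omega>. \<forall>ai bi d a b.
       two_step_estimate k \<Omega> (p n) n (\<lambda>i. X n i \<omega>) (\<lambda>i. response (p n) \<alpha>0 \<beta>0 (d0 n) (X n) (\<xi> n) i \<omega>) ai bi d a b \<longrightarrow>
       n * mismatch_prob (p n) (PX n) d (d0 n) \<le> K * V n \<and> n * l2_dist (p n) d (d0 n) \<le> K * V n \<and>
       n * \<bar>a - \<alpha>0\<bar> \<le> K * (sqrt n + V n) \<and> n * \<bar>b - \<beta>0\<bar> \<le> K * (sqrt n + V n))"
proof -
  obtain B where B: "\<And>w. w \<in> \<Omega> \<Longrightarrow> norm w \<le> B"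
    using compact_imp_bounded[OF cond_A(1)] by (auto simp: bounded_iff)
  define D where "D = 2 * \<bar>B\<bar> + 1"
  have D: "0 < D" by (simp add: D_def)
  have \<Omega>: "\<beta> < \<alpha> \<and> \<bar>\<alpha>\<bar> \<le> D / 2 \<and> \<bar>\<beta>\<bar> \<le> D / 2" if "(\<alpha>, \<beta>) \<in> \<Omega>" for \<alpha> \<beta>
    using B[OF that] norm_fst_le[of \<alpha> \<beta>] norm_snd_le[of \<beta> \<alpha>] cond_A(2)[OF that] by (simp add: D_def)
  obtain C where C: "0 < C" "\<And>t x. \<bar>t\<bar> \<le> D \<Longrightarrow> \<bar>score k (x + t) - score k x\<bar> \<le> C"
    using score_increment[of D k] by blast
  have \<Delta>: "0 < (\<alpha>0 - \<beta>0) / 2" using cond_A(2,3) by simp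
  obtain \<kappa>1 \<rho>1 where curv1: "0 < \<kappa>1" "0 < \<rho>1"
    "\<And>t x. (\<alpha>0 - \<beta>0) / 2 \<le> \<bar>t\<bar> \<Longrightarrow> x * t < 0 \<Longrightarrow> \<bar>x\<bar> < \<rho>1 \<Longrightarrow> \<kappa>1 \<le> bregman k t x"
    using bregman_curvature[OF \<Delta>, of k] by blast
  define g1 where "g1 = measure P\<xi> {y. 0 < \<bar>y\<bar> \<and> \<bar>y\<bar> < \<rho>1} / 8"
  have g1: "0 < g1" using noise_near_zero_pos[OF curv1(2)] by (simp add: g1_def)
  \<comment> \<open>\<open>\<tau>\<close> is fixed by the curvature at half the separation; the
    curvature constants for shifts of size \<open>\<tau>\<close> can only come afterwards.\<close>
  define \<tau> where "\<tau> = min ((\<alpha>0 - \<beta>0) / 2) (\<kappa>1 * g1 / (16 * C))"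
  have \<tau>: "0 < \<tau>" "2 * \<tau> \<le> \<alpha>0 - \<beta>0" 
  proof -
    show "0 < \<tau>" using \<Delta> curv1(1) g1 C(1) by (simp add: \<tau>_def)
    have "\<tau> \<le> (\<alpha>0 - \<beta>0) / 2" unfolding \<tau>_def by (rule min.cobounded1)
    then show "2 * \<tau> \<le> \<alpha>0 - \<beta>0" by simp
  qed
  have slack2: "16 * C * \<tau> \<le> \<kappa>1 * g1"
  proof -
    have "16 * C * \<tau> \<le> 16 * C * (\<kappa>1 * g1 / (16 * C))" using C(1) by (intro mult_left_mono) (auto simp: \<tau>_def)
    then show ?thesis using C(1) by simp
  qed
  obtain \<kappa> \<rho> where curv: "0 < \<kappa>" "0 < \<rho>"
    "\<And>t x. \<tau> \<le> \<bar>t\<bar> \<Longrightarrow> x * t < 0 \<Longrightarrow> \<bar>x\<bar> < \<rho> \<Longrightarrow> \<kappa> \<le> bregman k t x"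
    using bregman_curvature[OF \<tau>(1), of k] by blast
  define g where "g = measure P\<xi> {y. 0 < \<bar>y\<bar> \<and> \<bar>y\<bar> < \<rho>} / 8"
  have g: "0 < g" using noise_near_zero_pos[OF curv(2)] by (simp add: g_def)
  define \<eta> where "\<eta> = min C2 C3 / 2"
  have \<eta>: "0 < \<eta>" using cond_B(4) positive_side(1) by (simp add: \<eta>_def)
  define H where "H = \<kappa> * g * \<eta>"
  have H: "0 < H" using curv(1) g \<eta> by (simp add: H_def)
  \<comment> \<open>The first entry serves the mismatch bound, the second the consistency of the
    levels.\<close>
  define s where "s = min (\<kappa>1 * g1 / (4 * D)) (H / (8 * D))"
  have s: "0 < s" using curv1(1) g1 D H by (simp add: s_def)
  have slack1: "4 * D * s \<le> \<kappa>1 * g1" "8 * D * s \<le> H"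
  proof -
    have "4 * D * s \<le> 4 * D * (\<kappa>1 * g1 / (4 * D))" using D by (intro mult_left_mono) (auto simp: s_def)
    then show "4 * D * s \<le> \<kappa>1 * g1" using D by simp
    have "8 * D * s \<le> 8 * D * (H / (8 * D))" using D by (intro mult_left_mono) (auto simp: s_def)
    then show "8 * D * s \<le> H" using D by simp
  qed
  obtain \<kappa>2 where \<kappa>2: "0 < \<kappa>2" "\<And>t. \<bar>t\<bar> \<le> D \<Longrightarrow> \<kappa>2 * t\<^sup>2 \<le> (\<integral>y. bregman k t y \<partial>P\<xi>)"
    using mean_bregman[OF prob_noise(1) noise_density D, of k] by blast
  \<comment> \<open>\<open>22 * e\<close> for the regular sample and \<open>4 * e\<close> for the
    curvature.\<close>
  define e where "e = \<epsilon> / 26"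
  have e: "0 < e" using \<epsilon> by (simp add: e_def)
  define \<sigma>2 where "\<sigma>2 = (\<integral>y. (score k y)\<^sup>2 \<partial>P\<xi>)"
  have \<sigma>2: "0 \<le> \<sigma>2" unfolding \<sigma>2_def by simp
  define K1 where "K1 = sqrt (\<sigma>2 / e + 1)"
  have K1: "0 < K1" "\<sigma>2 / K1\<^sup>2 \<le> e"
  proof -
    have pos: "0 < \<sigma>2 / e + 1" using \<sigma>2 e by (intro add_nonneg_pos) auto
    then show "0 < K1" by (simp add: K1_def)
    have "K1\<^sup>2 = \<sigma>2 / e + 1" using pos by (simp add: K1_def)
    then have "e * K1\<^sup>2 = \<sigma>2 + e" using e by (simp add: distrib_left)
    then show "\<sigma>2 / K1\<^sup>2 \<le> e" using e pos \<open>K1\<^sup>2 = \<sigma>2 / e + 1\<close> by (simp add: pos_divide_le_eq)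
  qed
  from control[unfolded score_control_def, rule_format, OF s e]
  obtain Ks \<theta>s where Ks: "0 < Ks" "0 < \<theta>s" and noise: "\<forall>n\<in>N. p n \<le> n \<longrightarrow> V n \<le> \<theta>s * real n \<longrightarrow> (\<forall>u.
     except_prob (M n) e (\<lambda>\<omega>. \<forall>d. \<bar>\<Sum>i\<in>iid_model.cell (p n) n (X n) (iid_model.half (p n) (d0 n) u) (\<not> u) d \<omega>. score k (\<xi> n i \<omega>)\<bar>
        \<le> s * real n * iid_model.cell_prob (p n) (PX n) (iid_model.half (p n) (d0 n) u) (\<not> u) d + Ks * V n))"
    by (elim exE conjE)
  \<comment> \<open>The noise constant plus a bound for twice the entropy, whose confidence term is
    a multiple of \<open>V n\<close> because \<open>1 \<le> V n\<close>.\<close>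
  define K2 where "K2 = Ks + 2 * (\<bar>K0\<bar> + \<bar>ln (1 / e)\<bar>)"
  have K2: "0 \<le> K2" "Ks \<le> K2" using Ks by (auto simp: K2_def)
  define K5 where "K5 = 2 * (2 * \<kappa>1 * K2 + 2 * D * K2 + 2 * C * \<tau> * K2) / (\<kappa>1 * g1)"
  have K5: "0 \<le> K5" unfolding K5_def using curv1(1) K2 D C(1) \<tau>(1) g1 by (intro divide_nonneg_pos mult_nonneg_nonneg add_nonneg_nonneg) auto
  define G where "G = 2 * \<eta> * \<kappa>2 / 2"
  have G: "0 < G" using \<eta> \<kappa>2(1) by (simp add: G_def)
  define W where "W = (s + 4 * C) * K5 + 2 * K2 + 2 * C * K2"
  have W: "0 \<le> W" using s C(1) K5 K2 by (simp add: W_def)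
  \<comment> \<open>The first summand makes the curvature beat the linear term; the second makes
    each curvature event fail with probability at most \<open>e\<close>.\<close>
  define K7 where "K7 = (4 * K1 + 2 * W + 1) / G + 2 * C / (2 * \<eta> * \<kappa>2 * sqrt e)"
  have K7: "0 < K7" "4 * K1 + 2 * W + 1 \<le> G * K7" "2 * C / (2 * \<eta> * \<kappa>2 * sqrt e) \<le> K7"
  proof -
    have a: "0 < (4 * K1 + 2 * W + 1) / G" using K1(1) W G by simp
    have b: "0 < 2 * C / (2 * \<eta> * \<kappa>2 * sqrt e)" using C(1) \<eta> \<kappa>2(1) e by simp
    show "0 < K7" "2 * C / (2 * \<eta> * \<kappa>2 * sqrt e) \<le> K7" using a b by (auto simp: K7_def)
    have "G * ((4 * K1 + 2 * W + 1) / G) \<le> G * K7" using G b by (intro mult_left_mono) (auto simp: K7_def)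
    then show "4 * K1 + 2 * W + 1 \<le> G * K7" using G by simp
  qed
  \<comment> \<open>The factor in \<open>sqrt n \<le> \<gamma> * n\<close>, valid from
    \<open>n0\<close> on; its entries serve the consistency and \<open>t \<le> D\<close>.\<close>
  define \<gamma> where "\<gamma> = min (H / (8 * D * K1)) (D / (2 * K7))"
  have \<gamma>: "0 < \<gamma>" using H D K1(1) K7(1) by (simp add: \<gamma>_def)
  define Q where "Q = 2 * D * K2 + \<kappa> * K2 + 1"
  have Q: "0 < Q" using D K2 curv(1) by (simp add: Q_def add_nonneg_pos)
  \<comment> \<open>In this order: control of the scores, consistency, \<open>t \<le> D\<close>, and
    a mismatch below \<open>C3\<close> and below \<open>c * \<delta>\<close>, the conditions under
    which mismatch controls distance.\<close>
  define \<theta> where "\<theta> = Min {\<theta>s, H / (4 * Q), D / (2 * K7), C3 / (2 * (K5 + 1)), c * \<delta> / (2 * (K5 + 1))}"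
  have \<theta>: "0 < \<theta>" using Ks H Q D K7 positive_side(1) K5 cond_B by (simp add: \<theta>_def)
  have \<theta>_le: "\<theta> \<le> \<theta>s" "\<theta> \<le> H / (4 * Q)" "\<theta> \<le> D / (2 * K7)" "\<theta> \<le> C3 / (2 * (K5 + 1))" "\<theta> \<le> c * \<delta> / (2 * (K5 + 1))"
    unfolding \<theta>_def by (rule Min_le; simp)+
  have ev1: "\<forall>\<^sub>F n in sequentially. real (p n) / real n < 1"
    using order_tendstoD(2)[OF dim_growth, of 1] by simp
  obtain n1 where n1: "\<And>n. n1 \<le> n \<Longrightarrow> real (p n) / real n < 1" using ev1 unfolding eventually_sequentially by auto
  define n0 where "n0 = max (max 1 n1) (nat \<lceil>1 / \<gamma>\<^sup>2\<rceil>)"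
  define K where "K = K5 + K5 / c + K7 + 1"
  have K: "0 < K" "K5 \<le> K" "K5 / c \<le> K" "K7 \<le> K" using K5 K7 cond_B(2) by (auto simp: K_def intro: add_nonneg_pos)
  show ?thesis
  proof (rule exI[of _ K], rule conjI[OF K(1)], rule exI[of _ \<theta>], rule conjI[OF \<theta>], rule exI[of _ n0], intro allI impI)
    fix n assume hn: "n0 \<le> n" "n \<in> N" and V\<theta>: "V n \<le> \<theta> * n"
    have n1': "1 \<le> n" and n1n: "n1 \<le> n" using hn(1) by (simp_all add: n0_def)
    interpret iid_model "p n" n "M n" "X n" "\<xi> n" "PX n" P\<xi> by (rule model[OF n1'])
    have pn: "1 \<le> p n" "p n \<le> n"
      using dim_pos[OF n1'] n1[OF n1n] n1' by (auto simp: divide_less_eq)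
    have V: "1 \<le> V n" "0 \<le> V n" using N(2)[OF hn(2)] by auto
    have sqrt_le: "sqrt n \<le> \<gamma> * n"
    proof -
      have "1 / \<gamma>\<^sup>2 \<le> n" using hn(1) by (simp add: n0_def nat_le_iff ceiling_le_iff)
      then have "1 \<le> \<gamma>\<^sup>2 * n" using \<gamma> by (simp add: divide_le_eq mult.commute)
      then have "1 \<le> sqrt (\<gamma>\<^sup>2 * n)" by simp
      then have "1 \<le> \<gamma> * sqrt n" using \<gamma> by (simp add: real_sqrt_mult)
      then have "sqrt n * 1 \<le> sqrt n * (\<gamma> * sqrt n)" by (intro mult_left_mono) auto
      then show ?thesis by (simp add: mult_ac)
    qed
    have V_le: "V n \<le> b * n" if "\<theta> \<le> b" for b
      using V\<theta> mult_right_mono[OF that, of "real n"] by simp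
    have ent: "entropy e \<le> (\<bar>K0\<bar> + \<bar>ln (1 / e)\<bar>) * V n"
    proof -
      have "K0 * V n \<le> \<bar>K0\<bar> * V n" using V by (intro mult_right_mono) auto
      moreover have "\<bar>ln (1 / e)\<bar> * 1 \<le> \<bar>ln (1 / e)\<bar> * V n" using V by (intro mult_left_mono) auto
      ultimately show ?thesis using N(3)[OF hn(2)] by (simp add: entropy_def distrib_right)
    qed
    have ent_nn: "0 \<le> (\<bar>K0\<bar> + \<bar>ln (1 / e)\<bar>) * V n" using V by simp
    have KsV: "0 \<le> Ks * V n" using Ks V by simp
    have K2V: "K2 * V n = Ks * V n + 2 * ((\<bar>K0\<bar> + \<bar>ln (1 / e)\<bar>) * V n)" by (simp add: K2_def algebra_simps)
    have reg: "except_prob (M n) (22 * e) (regular_sample k (d0 n) (V n) s K1 K2 \<rho> g \<rho>1 g1)"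
      unfolding g_def g1_def
    proof (rule regular_sample_prob[OF pn e sq K1(1) K1(2)[unfolded \<sigma>2_def]])
      fix u
      have "Ks * V n \<le> K2 * V n" using K2(2) V by (intro mult_right_mono) auto
      then show "except_prob (M n) e (\<lambda>\<omega>. \<forall>d. \<bar>\<Sum>i\<in>cell (half (d0 n) u) (\<not> u) d \<omega>. score k (\<xi> n i \<omega>)\<bar>
        \<le> s * n * cell_prob (half (d0 n) u) (\<not> u) d + K2 * V n)"
        by (intro except_prob_mono[OF noise[rule_format, OF hn(2) pn(2) V_le[OF \<theta>_le(1)], of u]]) (auto intro: order_trans)
    qed (use ent ent_nn KsV K2V in linarith)+
    define t where "t = K7 * (sqrt n + V n) / n"
    have t: "0 < t" using K7(1) V n1' by (simp add: t_def add_nonneg_pos)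
    have nt: "n * t = K7 * (sqrt n + V n)" using n1' by (simp add: t_def)
    have tD: "t \<le> D"
    proof -
      have "sqrt n \<le> D / (2 * K7) * n" using sqrt_le mult_right_mono[of \<gamma> "D / (2 * K7)" "real n"] by (simp add: \<gamma>_def)
      then have "sqrt n + V n \<le> D / K7 * n" using V_le[OF \<theta>_le(3)] by (simp add: field_simps)
      then have "K7 * (sqrt n + V n) \<le> K7 * (D / K7 * n)" using K7(1) by (intro mult_left_mono) auto
      also have "\<dots> = D * n" using K7(1) by simp
      finally show ?thesis using n1' by (simp add: t_def divide_le_eq)
    qed
    have curvature: "except_prob (M n) (4 * e) (regular_curvature k (d0 n) G t)"
      unfolding G_def
    proof (rule regular_curvature_prob[OF _ _ \<kappa>2(1) t tD \<kappa>2(2) C(2)])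
      have "K7\<^sup>2 \<le> n * t\<^sup>2"
      proof -
        have "K7 * sqrt n \<le> n * t" unfolding nt using K7(1) V by (intro mult_left_mono) auto
        then have "(K7 * sqrt n)\<^sup>2 \<le> (n * t)\<^sup>2" using K7(1) by (intro power_mono) auto
        then have "n * K7\<^sup>2 \<le> n * (n * t\<^sup>2)" by (simp add: power_mult_distrib power2_eq_square mult_ac)
        then show ?thesis using n1' by simp
      qed
      moreover have "4 * C\<^sup>2 \<le> e * ((2 * \<eta>)\<^sup>2 * \<kappa>2\<^sup>2) * K7\<^sup>2"
      proof -
        have pos: "0 < 2 * \<eta> * \<kappa>2 * sqrt e" using \<eta> \<kappa>2(1) e by simp
        then have "2 * C \<le> K7 * (2 * \<eta> * \<kappa>2 * sqrt e)" using K7(3) by (simp only: pos_divide_le_eq)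
        then have "(2 * C)\<^sup>2 \<le> (K7 * (2 * \<eta> * \<kappa>2 * sqrt e))\<^sup>2" using C(1) by (intro power_mono) auto
        also have "\<dots> = e * ((2 * \<eta>)\<^sup>2 * \<kappa>2\<^sup>2) * K7\<^sup>2" using e by (simp add: power_mult_distrib)
        finally show ?thesis by (simp add: power_mult_distrib)
      qed
      moreover have "e * ((2 * \<eta>)\<^sup>2 * \<kappa>2\<^sup>2) * K7\<^sup>2 \<le> e * ((2 * \<eta>)\<^sup>2 * \<kappa>2\<^sup>2) * (n * t\<^sup>2)"
        using \<open>K7\<^sup>2 \<le> n * t\<^sup>2\<close> e by (intro mult_left_mono) auto
      moreover have "0 < (2 * \<eta>)\<^sup>2 * \<kappa>2\<^sup>2 * (n * t\<^sup>2)" using \<eta> \<kappa>2(1) n1' t by simp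
      ultimately show "4 * C\<^sup>2 / ((2 * \<eta>)\<^sup>2 * \<kappa>2\<^sup>2 * (n * t\<^sup>2)) \<le> e"
        by (simp only: pos_divide_le_eq)
    next
      show "2 * \<eta> \<le> measure (PX n) (half (d0 n) u)" for u using side_mass[OF n1'] by (simp add: \<eta>_def)
    qed (use \<eta> in simp)
    have consistent: "D * (2 * K1 * sqrt n + 2 * s * n + 2 * K2 * V n) + \<kappa> * K2 * V n < \<kappa> * g * \<eta> * n"
    proof -
      have "2 * D * K1 * sqrt n \<le> 2 * D * K1 * (H / (8 * D * K1) * n)"
        using sqrt_le mult_right_mono[of \<gamma> "H / (8 * D * K1)" "real n"] D K1(1) by (intro mult_left_mono) (auto simp: \<gamma>_def)
      also have "\<dots> = H * n / 4" using D K1(1) by simp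
      finally have a: "2 * D * K1 * sqrt n \<le> H * n / 4" .
      have b: "2 * D * s * n \<le> H * n / 4" using mult_right_mono[OF slack1(2), of "real n"] by simp
      have "Q * V n \<le> Q * (H / (4 * Q) * n)" using V_le[OF \<theta>_le(2)] Q by (intro mult_left_mono) auto
      also have "\<dots> = H * n / 4" using Q by simp
      finally have c: "2 * D * K2 * V n + \<kappa> * K2 * V n \<le> H * n / 4" using V by (simp add: Q_def distrib_right)
      have "0 < H * n" using H n1' by simp
      then show ?thesis using a b c unfolding H_def[symmetric] by (simp add: distrib_left mult_ac)
    qed
    have large: "2 * (2 * K1 * sqrt n + ((s + 4 * C) * K5 + 2 * K2 + 2 * C * K2) * V n) < G * (n * t)"
    proof -
      have "2 * (2 * K1 * sqrt n + W * V n) < (4 * K1 + 2 * W + 1) * (sqrt n + V n)"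
      proof -
        have "0 \<le> K1 * V n" "0 \<le> W * sqrt n" "0 < sqrt n" using K1(1) W V n1' by auto
        moreover have "(4 * K1 + 2 * W + 1) * (sqrt n + V n) = 2 * (2 * K1 * sqrt n + W * V n)
            + (4 * (K1 * V n) + 2 * (W * sqrt n) + sqrt n + V n)" by (simp add: algebra_simps)
        ultimately show ?thesis using V by linarith
      qed
      also have "\<dots> \<le> G * K7 * (sqrt n + V n)" using K7(2) V by (intro mult_right_mono) auto
      finally show ?thesis unfolding nt W_def by (simp add: mult_ac)
    qed
    have "except_prob (M n) (22 * e + 4 * e) (\<lambda>\<omega>. regular_sample k (d0 n) (V n) s K1 K2 \<rho> g \<rho>1 g1 \<omega> \<and> regular_curvature k (d0 n) G t \<omega>)"
      by (rule except_prob_conj[OF reg curvature])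
    then show "except_prob (M n) \<epsilon> (\<lambda>\<omega>. \<forall>ai bi d a b.
       two_step_estimate k \<Omega> (p n) n (\<lambda>i. X n i \<omega>) (\<lambda>i. response (p n) \<alpha>0 \<beta>0 (d0 n) (X n) (\<xi> n) i \<omega>) ai bi d a b \<longrightarrow>
       n * mismatch_prob (p n) (PX n) d (d0 n) \<le> K * V n \<and> n * l2_dist (p n) d (d0 n) \<le> K * V n \<and>
       n * \<bar>a - \<alpha>0\<bar> \<le> K * (sqrt n + V n) \<and> n * \<bar>b - \<beta>0\<bar> \<le> K * (sqrt n + V n))"
    proof (rule except_prob_mono, goal_cases)
      case 1
      show ?case by (simp add: e_def)
    next
      case (2 \<omega>)
      show ?case
      proof (intro allI impI)
        fix ai bi d a b
        assume est: "two_step_estimate k \<Omega> (p n) n (\<lambda>i. X n i \<omega>) (\<lambda>i. response (p n) \<alpha>0 \<beta>0 (d0 n) (X n) (\<xi> n) i \<omega>) ai bi d a b"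
        define m where "m = mismatch_prob (p n) (PX n) d (d0 n)"
        have mass: "2 * \<eta> \<le> measure (PX n) (half (d0 n) u)" for u using side_mass[OF n1'] by (simp add: \<eta>_def)
        have *: "n * m \<le> K5 * V n \<and> \<bar>a - \<alpha>0\<bar> < t \<and> \<bar>b - \<beta>0\<bar> < t"
          unfolding m_def
          by (rule estimate_rates[OF 2(1) est cond_A(3) \<Omega> cond_A(4)[OF n1'] C curv1(1,3) curv(1,3) \<tau> mass
                conjunct1[OF 2(2)] conjunct2[OF 2(2)] g g1 V(2) K2(1) s t consistent slack1(1) slack2 K5_def large])
        have "n * m \<le> K5 * (\<theta> * n)" using * mult_left_mono[OF V\<theta> K5] by linarith
        then have m_le: "m \<le> K5 * \<theta>" using n1' by (simp add: mult.left_commute)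
        have frac: "K5 * \<theta> < b" if "\<theta> \<le> b / (2 * (K5 + 1))" "0 < b" for b
        proof -
          have "K5 * \<theta> \<le> K5 * (b / (2 * (K5 + 1)))" using that K5 by (intro mult_left_mono) auto
          also have "\<dots> < b" using that K5 by (simp add: field_simps add_nonneg_pos)
          finally show ?thesis .
        qed
        have small: "m < C3" "m < c * \<delta>"
          using m_le frac[OF \<theta>_le(4)] frac[OF \<theta>_le(5)] positive_side(1) cond_B(1,2) by auto
        have dS: "d \<in> unit_sphere (p n)"
          using est unfolding two_step_estimate_def is_arg_min_def by auto
        have "c * l2_dist (p n) d (d0 n) \<le> m"
          using distance_le_mismatch[OF dS cond_A(4)[OF n1'] cond_B(5)[OF n1'] cond_B(1) positive_side(2)[OF n1']] small
          by (simp add: m_def)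
        then have "n * (c * l2_dist (p n) d (d0 n)) \<le> n * m" by (intro mult_left_mono) auto
        then have "n * l2_dist (p n) d (d0 n) * c \<le> K5 * V n" using * by (simp add: mult_ac)
        then have "n * l2_dist (p n) d (d0 n) \<le> K5 / c * V n" using cond_B(2) by (simp add: field_simps)
        moreover have "K5 / c * V n \<le> K * V n" "K5 * V n \<le> K * V n"
          by (rule mult_right_mono[OF K(3) V(2)], rule mult_right_mono[OF K(2) V(2)])
        moreover have "K7 * (sqrt n + V n) \<le> K * (sqrt n + V n)" using K V by (intro mult_right_mono) auto
        moreover have "n * \<bar>a - \<alpha>0\<bar> \<le> n * t" "n * \<bar>b - \<beta>0\<bar> \<le> n * t" using * by (auto intro: mult_left_mono)
        ultimately show "n * mismatch_prob (p n) (PX n) d (d0 n) \<le> K * V n \<and> n * l2_dist (p n) d (d0 n) \<le> K * V n \<and>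
           n * \<bar>a - \<alpha>0\<bar> \<le> K * (sqrt n + V n) \<and> n * \<bar>b - \<beta>0\<bar> \<le> K * (sqrt n + V n)"
          using * nt unfolding m_def by linarith
      qed
    qed
  qed
qed

end

section \<open>From exceptional sets to boundedness in probability\<close>

lemma l2_dist_unit_sphere:
  assumes "d \<in> unit_sphere p" "e \<in> unit_sphere p"
  shows "0 \<le> l2_dist p d e" "l2_dist p d e \<le> 2"
proof -
  have "L2_set (\<lambda>j. d j + - e j) {..<p} \<le> L2_set d {..<p} + L2_set (\<lambda>j. - e j) {..<p}"
    by (rule L2_set_triangle_ineq)
  moreover have "L2_set (\<lambda>j. - e j) {..<p} = L2_set e {..<p}" by (simp add: L2_set_def)
  ultimately show "l2_dist p d e \<le> 2" using assms by (simp add: l2_dist_def unit_sphere_def)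
qed (simp add: l2_dist_def L2_set_nonneg)

text \<open>Each part of the minimum meets one summand: times \<open>sqrt n\<close> it is at most
  \<open>n\<close> because of its first entry, times \<open>V\<close> at most \<open>h * n\<close>
  because of its second.\<close>

lemma min_rate_bound:
  fixes n V K w R h :: real
  assumes "0 < n" "0 < V" "n * w \<le> K * (sqrt n + V)" "0 \<le> w" "0 \<le> K" "0 \<le> R" "R \<le> h * (n / V)" "1 \<le> h"
  shows "min (sqrt n) R * w \<le> 2 * h * K"
proof -
  define u where "u = min (sqrt n) R"
  have u: "0 \<le> u" "u \<le> sqrt n" "u \<le> R" using assms by (auto simp: u_def)
  have "u * sqrt n \<le> sqrt n * sqrt n" using u assms(1) by (intro mult_right_mono) auto
  then have a: "u * sqrt n \<le> n" using assms by simp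
  have "u * V \<le> h * (n / V) * V" using u assms by (intro mult_right_mono) auto
  then have b: "u * V \<le> h * n" using assms by simp
  have "n * (u * w) = u * (n * w)" by simp
  also have "\<dots> \<le> u * (K * (sqrt n + V))" using assms u by (intro mult_left_mono) auto
  also have "\<dots> = K * (u * sqrt n + u * V)" by (simp add: algebra_simps)
  also have "\<dots> \<le> K * (h * n + h * n)"
  proof (rule mult_left_mono[OF _ assms(5)])
    have "n \<le> h * n" using mult_right_mono[of 1 h n] assms by simp
    then show "u * sqrt n + u * V \<le> h * n + h * n" using a b by linarith
  qed
  also have "\<dots> = n * (2 * h * K)" by simp
  finally show ?thesis using assms(1) by (simp add: u_def)
qed

context change_plane
begin

lemma bounded_in_probI:
  assumes "\<And>\<epsilon>. 0 < \<epsilon> \<Longrightarrow> \<exists>K n0. \<forall>n\<ge>n0. except_prob (M n) \<epsilon> (\<lambda>\<omega>. \<bar>Z n \<omega>\<bar> \<le> K)"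
  shows "bounded_in_prob M Z"
  unfolding bounded_in_prob_def
proof (intro allI impI)
  fix \<epsilon> :: real assume "0 < \<epsilon>"
  then obtain K n0 where K: "\<And>n. n \<ge> n0 \<Longrightarrow> except_prob (M n) \<epsilon> (\<lambda>\<omega>. \<bar>Z n \<omega>\<bar> \<le> K)" using assms by blast
  have "measure (M n) {\<omega>\<in>space (M n). \<bar>Z n \<omega>\<bar> > K} \<le> \<epsilon>" if "n \<ge> max 1 n0" for n
  proof -
    have "prob_space (M n)" using sample[of n] that by (simp add: iid_sample_def)
    from measure_le_except_prob[OF this K[of n]] that show ?thesis by (simp add: not_le)
  qed
  then show "\<exists>K. \<forall>\<^sub>F n in sequentially. measure (M n) {\<omega>\<in>space (M n). \<bar>Z n \<omega>\<bar> > K} \<le> \<epsilon>"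
    unfolding eventually_sequentially by blast
qed

text \<open>\<open>rest\<close> splits the sample sizes. Where \<open>V n\<close> is small compared
  with \<open>n\<close> the rates apply; elsewhere \<open>R n\<close> is bounded, and so are the
  errors, as \<open>\<Omega>\<close> is compact and the directions are unit vectors.\<close>

proposition bounded_estimators:
  fixes R V :: "nat \<Rightarrow> real" and h K0 :: real
  assumes sq: "integrable P\<xi> (\<lambda>y. (score k y)\<^sup>2)"
    and N: "\<And>n. n \<in> N \<Longrightarrow> 1 \<le> n" "\<And>n. n \<in> N \<Longrightarrow> 1 \<le> V n"
      "\<And>n. n \<in> N \<Longrightarrow> p n * ln (n / p n) + 2 * p n \<le> K0 * V n"
    and control: "score_control k N V"
    and R: "\<And>n. n \<in> N \<Longrightarrow> R n = h * (n / V n)" "1 \<le> h"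
    and rest: "\<And>\<theta> :: real. 0 < \<theta> \<Longrightarrow> \<exists>B. \<forall>\<^sub>F n in sequentially. n \<in> N \<and> V n \<le> \<theta> * n \<or> \<bar>R n\<bar> \<le> B"
    and est: "\<forall>n\<ge>1. two_step_estimator k \<Omega> (p n) n (M n) (X n) (response (p n) \<alpha>0 \<beta>0 (d0 n) (X n) (\<xi> n))
                  (ai n) (bi n) (d n) (a n) (b n)"
  shows "bounded_in_prob M (\<lambda>n \<omega>. min (sqrt (real n)) (R n) * (a n \<omega> - \<alpha>0))"
    and "bounded_in_prob M (\<lambda>n \<omega>. min (sqrt (real n)) (R n) * (b n \<omega> - \<beta>0))"
    and "bounded_in_prob M (\<lambda>n \<omega>. R n * mismatch_prob (p n) (PX n) (d n \<omega>) (d0 n))"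
    and "bounded_in_prob M (\<lambda>n \<omega>. R n * l2_dist (p n) (d n \<omega>) (d0 n))"
proof -
  obtain B0 where B0: "\<And>w. w \<in> \<Omega> \<Longrightarrow> norm w \<le> B0"
    using compact_imp_bounded[OF cond_A(1)] by (auto simp: bounded_iff)
  define D where "D = 2 * \<bar>B0\<bar>"
  have D: "\<bar>x - \<alpha>0\<bar> \<le> D" "\<bar>y - \<beta>0\<bar> \<le> D" if "(x, y) \<in> \<Omega>" for x y
    using B0[OF that] B0[OF cond_A(3)] norm_fst_le[of x y] norm_snd_le[of y x] norm_fst_le[of \<alpha>0 \<beta>0] norm_snd_le[of \<beta>0 \<alpha>0]
    by (simp_all add: D_def)
  have main: "\<exists>K n0. \<forall>n\<ge>n0. except_prob (M n) \<epsilon> (\<lambda>\<omega>.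
      \<bar>min (sqrt (real n)) (R n) * (a n \<omega> - \<alpha>0)\<bar> \<le> K \<and> \<bar>min (sqrt (real n)) (R n) * (b n \<omega> - \<beta>0)\<bar> \<le> K \<and>
      \<bar>R n * mismatch_prob (p n) (PX n) (d n \<omega>) (d0 n)\<bar> \<le> K \<and> \<bar>R n * l2_dist (p n) (d n \<omega>) (d0 n)\<bar> \<le> K)"
    if \<epsilon>: "0 < \<epsilon>" for \<epsilon>
  proof -
    obtain K \<theta> n0 where K: "0 < K" "0 < \<theta>" and rates: "\<And>n. n \<ge> n0 \<Longrightarrow> n \<in> N \<Longrightarrow> V n \<le> \<theta> * n \<Longrightarrow>
      except_prob (M n) \<epsilon> (\<lambda>\<omega>. \<forall>ai bi d a b.
       two_step_estimate k \<Omega> (p n) n (\<lambda>i. X n i \<omega>) (\<lambda>i. response (p n) \<alpha>0 \<beta>0 (d0 n) (X n) (\<xi> n) i \<omega>) ai bi d a b \<longrightarrow>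
       n * mismatch_prob (p n) (PX n) d (d0 n) \<le> K * V n \<and> n * l2_dist (p n) d (d0 n) \<le> K * V n \<and>
       n * \<bar>a - \<alpha>0\<bar> \<le> K * (sqrt n + V n) \<and> n * \<bar>b - \<beta>0\<bar> \<le> K * (sqrt n + V n))"
      using two_step_rates[OF sq N control \<epsilon>] by blast
    obtain B n1 where B: "\<And>n. n \<ge> n1 \<Longrightarrow> n \<in> N \<and> V n \<le> \<theta> * n \<or> \<bar>R n\<bar> \<le> B"
      using rest[OF K(2)] unfolding eventually_sequentially by blast
    define K' where "K' = 2 * h * K + \<bar>B\<bar> * (D + 2)"
    have D0: "0 \<le> D" by (simp add: D_def)
    have K': "h * K \<le> K'" "2 * h * K \<le> K'" "\<bar>B\<bar> * (D + 2) \<le> K'"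
      using K R(2) D0 by (auto simp: K'_def intro: add_nonneg_nonneg)
    have "except_prob (M n) \<epsilon> (\<lambda>\<omega>.
      \<bar>min (sqrt (real n)) (R n) * (a n \<omega> - \<alpha>0)\<bar> \<le> K' \<and> \<bar>min (sqrt (real n)) (R n) * (b n \<omega> - \<beta>0)\<bar> \<le> K' \<and>
      \<bar>R n * mismatch_prob (p n) (PX n) (d n \<omega>) (d0 n)\<bar> \<le> K' \<and> \<bar>R n * l2_dist (p n) (d n \<omega>) (d0 n)\<bar> \<le> K')"
      if n: "n \<ge> max (max 1 n0) n1" for n
    proof -
      have n1: "1 \<le> n" and n0: "n0 \<le> n" and n1': "n1 \<le> n" using n by auto
      have e: "two_step_estimate k \<Omega> (p n) n (\<lambda>i. X n i \<omega>) (\<lambda>i. response (p n) \<alpha>0 \<beta>0 (d0 n) (X n) (\<xi> n) i \<omega>)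
          (ai n \<omega>) (bi n \<omega>) (d n \<omega>) (a n \<omega>) (b n \<omega>)" if "\<omega> \<in> space (M n)" for \<omega>
        using est n1 that unfolding two_step_estimator_def by blast
      interpret iid_model "p n" n "M n" "X n" "\<xi> n" "PX n" P\<xi> by (rule model[OF n1])
      have mis: "0 \<le> mismatch_prob (p n) (PX n) x y" "mismatch_prob (p n) (PX n) x y \<le> 1" for x y
        by (simp_all add: mismatch_prob_def)
      show ?thesis
      proof (cases "n \<in> N \<and> V n \<le> \<theta> * n")
        case True
        then have nN: "n \<in> N" and V\<theta>: "V n \<le> \<theta> * n" by auto
        have V: "0 < V n" using N(2)[OF nN] by simp
        have Rn: "R n = h * (n / V n)" "0 \<le> R n" using R(1)[OF nN] R(2) V by auto
        have scale: "R n * w \<le> h * K" if "n * w \<le> K * V n" for w :: real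
        proof -
          have "R n * w = h / V n * (n * w)" by (simp add: Rn)
          also have "\<dots> \<le> h / V n * (K * V n)" using that V R(2) by (intro mult_left_mono) auto
          finally show ?thesis using V by simp
        qed
        show ?thesis
        proof (rule except_prob_mono[OF rates[OF n0 nN V\<theta>]], goal_cases)
          case (2 \<omega>)
          note r = 2(2)[rule_format, OF e[OF 2(1)]]
          have "0 \<le> l2_dist (p n) (d n \<omega>) (d0 n)" by (simp add: l2_dist_def L2_set_nonneg)
          moreover have "min (sqrt n) (R n) * \<bar>a n \<omega> - \<alpha>0\<bar> \<le> 2 * h * K" "min (sqrt n) (R n) * \<bar>b n \<omega> - \<beta>0\<bar> \<le> 2 * h * K"
            using r K Rn R(2) V n1 by (auto intro!: min_rate_bound[of "real n" "V n"])
          moreover have "R n * mismatch_prob (p n) (PX n) (d n \<omega>) (d0 n) \<le> h * K" "R n * l2_dist (p n) (d n \<omega>) (d0 n) \<le> h * K"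
            using r by (auto intro: scale)
          ultimately show ?case using K' mis[of "d n \<omega>" "d0 n"] Rn(2) by (auto simp: abs_mult)
        qed simp
      next
        case False
        then have RB: "\<bar>R n\<bar> \<le> \<bar>B\<bar>" using B[OF n1'] by auto
        have mR: "\<bar>min (sqrt n) (R n)\<bar> \<le> \<bar>R n\<bar>" by (auto simp: min_def)
        have bnd: "\<bar>x * y\<bar> \<le> K'" if "\<bar>x\<bar> \<le> \<bar>R n\<bar>" "\<bar>y\<bar> \<le> D + 2" for x y
        proof -
          have "\<bar>x * y\<bar> \<le> \<bar>B\<bar> * (D + 2)" unfolding abs_mult using that RB by (intro mult_mono) auto
          then show ?thesis using K'(3) by simp
        qed
        show ?thesis
          unfolding except_prob_def
        proof (intro bexI[of _ "{}"] conjI ballI)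
          fix \<omega> assume "\<omega> \<in> space (M n) - {}"
          then have w: "\<omega> \<in> space (M n)" by simp
          have "(a n \<omega>, b n \<omega>) \<in> \<Omega>" and dS: "d n \<omega> \<in> unit_sphere (p n)"
            using e[OF w] unfolding two_step_estimate_def is_arg_min_def by auto
          note ab = D[OF this(1)]
          note l2 = l2_dist_unit_sphere[OF dS cond_A(4)[OF n1]]
          show "\<bar>min (sqrt (real n)) (R n) * (a n \<omega> - \<alpha>0)\<bar> \<le> K'" "\<bar>min (sqrt (real n)) (R n) * (b n \<omega> - \<beta>0)\<bar> \<le> K'"
            using ab mR by (auto intro!: bnd)
          show "\<bar>R n * mismatch_prob (p n) (PX n) (d n \<omega>) (d0 n)\<bar> \<le> K'"
            using mis[of "d n \<omega>" "d0 n"] D0 by (intro bnd) auto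
          show "\<bar>R n * l2_dist (p n) (d n \<omega>) (d0 n)\<bar> \<le> K'"
            using l2 D0 by (intro bnd) auto
        qed (use \<epsilon> in auto)
      qed
    qed
    then show ?thesis by blast
  qed
  have part: "\<exists>K n0. \<forall>n\<ge>n0. except_prob (M n) \<epsilon> (P K n)"
    if "0 < \<epsilon>" and "\<And>K n \<omega>. \<bar>min (sqrt (real n)) (R n) * (a n \<omega> - \<alpha>0)\<bar> \<le> K \<and> \<bar>min (sqrt (real n)) (R n) * (b n \<omega> - \<beta>0)\<bar> \<le> K \<and>
      \<bar>R n * mismatch_prob (p n) (PX n) (d n \<omega>) (d0 n)\<bar> \<le> K \<and> \<bar>R n * l2_dist (p n) (d n \<omega>) (d0 n)\<bar> \<le> K \<Longrightarrow> P K n \<omega>" for \<epsilon> P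
  proof -
    from main[OF that(1)] obtain K n0 where K: "\<forall>n\<ge>n0. except_prob (M n) \<epsilon> (\<lambda>\<omega>.
      \<bar>min (sqrt (real n)) (R n) * (a n \<omega> - \<alpha>0)\<bar> \<le> K \<and> \<bar>min (sqrt (real n)) (R n) * (b n \<omega> - \<beta>0)\<bar> \<le> K \<and>
      \<bar>R n * mismatch_prob (p n) (PX n) (d n \<omega>) (d0 n)\<bar> \<le> K \<and> \<bar>R n * l2_dist (p n) (d n \<omega>) (d0 n)\<bar> \<le> K)"
      by (elim exE)
    show ?thesis
      by (intro exI[of _ K] exI[of _ n0] allI impI, rule except_prob_mono[OF K[rule_format] order_refl that(2)])
  qed
  show "bounded_in_prob M (\<lambda>n \<omega>. min (sqrt (real n)) (R n) * (a n \<omega> - \<alpha>0))"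
    by (rule bounded_in_probI, erule part, elim conjE)
  show "bounded_in_prob M (\<lambda>n \<omega>. min (sqrt (real n)) (R n) * (b n \<omega> - \<beta>0))"
    by (rule bounded_in_probI, erule part, elim conjE)
  show "bounded_in_prob M (\<lambda>n \<omega>. R n * mismatch_prob (p n) (PX n) (d n \<omega>) (d0 n))"
    by (rule bounded_in_probI, erule part, elim conjE)
  show "bounded_in_prob M (\<lambda>n \<omega>. R n * l2_dist (p n) (d n \<omega>) (d0 n))"
    by (rule bounded_in_probI, erule part, elim conjE)
qed

text \<open>A bounded score enters untruncated. On the chosen \<open>n\<close> the logarithm is at
  least one, so \<open>p n\<close> and the confidence term are at most multiples of the
  scale.\<close>

lemma score_control_finite:
  assumes k: "k < \<infinity>"
  shows "score_control k {n. 1 \<le> n \<and> exp 1 \<le> n / p n} (\<lambda>n. p n * ln (n / p n))"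
  unfolding score_control_def
proof (intro allI impI)
  fix s e :: real assume s: "0 < s" and e: "0 < e"
  obtain L where L: "0 < L" "\<And>x. \<bar>score k x\<bar> \<le> L" using score_bounded[OF k] by blast
  define s' where "s' = min (1/2) (s / (2 * L))"
  have s': "0 < s'" "s' \<le> 1/2" "2 * s' * L \<le> s"
  proof -
    show "0 < s'" "s' \<le> 1/2" using s L(1) by (auto simp: s'_def)
    have "2 * s' * L \<le> 2 * (s / (2 * L)) * L" using L(1) by (intro mult_right_mono mult_left_mono) (auto simp: s'_def)
    then show "2 * s' * L \<le> s" using L(1) by simp
  qed
  define K where "K = L / s' * (3 + \<bar>ln (2 / e)\<bar>)"
  have K: "0 < K" using L(1) s'(1) by (simp add: K_def add_pos_nonneg)
  show "\<exists>K>0. \<exists>\<theta>>0. \<forall>n\<in>{n. 1 \<le> n \<and> exp 1 \<le> n / p n}. p n \<le> n \<longrightarrow> p n * ln (n / p n) \<le> \<theta> * real n \<longrightarrow> (\<forall>u.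
     except_prob (M n) e (\<lambda>\<omega>. \<forall>d. \<bar>\<Sum>i\<in>iid_model.cell (p n) n (X n) (iid_model.half (p n) (d0 n) u) (\<not> u) d \<omega>. score k (\<xi> n i \<omega>)\<bar>
        \<le> s * real n * iid_model.cell_prob (p n) (PX n) (iid_model.half (p n) (d0 n) u) (\<not> u) d + K * (p n * ln (n / p n))))"
  proof (rule exI[of _ K], rule conjI[OF K], rule exI[of _ 1], rule conjI[OF zero_less_one], intro ballI allI impI)
    fix n u assume hn: "n \<in> {n. 1 \<le> n \<and> exp 1 \<le> real n / real (p n)}" and pn: "p n \<le> n"
    have n1: "1 \<le> n" using hn by simp
    interpret iid_model "p n" n "M n" "X n" "\<xi> n" "PX n" P\<xi> by (rule model[OF n1])
    have p1: "1 \<le> p n" using dim_pos[OF n1] .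
    define V where "V = p n * ln (n / p n)"
    have "1 \<le> ln (n / p n)" using hn p1 n1 by (subst ln_ge_iff) auto
    then have pV: "p n \<le> V" using mult_left_mono[of 1 "ln (n / p n)" "real (p n)"] by (simp add: V_def)
    then have V1: "1 \<le> V" using p1 by simp
    have "entropy (e / 2) \<le> (3 + \<bar>ln (2 / e)\<bar>) * V"
    proof -
      have "ln (1 / (e / 2)) \<le> \<bar>ln (2 / e)\<bar> * V" using mult_left_mono[OF V1, of "\<bar>ln (2 / e)\<bar>"] by simp
      then show ?thesis using pV by (simp add: entropy_def V_def[symmetric] distrib_right)
    qed
    then have "L / s' * entropy (e / 2) \<le> L / s' * ((3 + \<bar>ln (2 / e)\<bar>) * V)"
      using L(1) s'(1) by (intro mult_left_mono) auto
    then have ent: "L / s' * entropy (e / 2) \<le> K * V" by (simp add: K_def mult.assoc)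
    show "except_prob (M n) e (\<lambda>\<omega>. \<forall>d. \<bar>\<Sum>i\<in>cell (half (d0 n) u) (\<not> u) d \<omega>. score k (\<xi> n i \<omega>)\<bar>
        \<le> s * real n * cell_prob (half (d0 n) u) (\<not> u) d + K * (p n * ln (n / p n)))"
    proof (rule except_prob_mono[OF bounded_noise[OF p1 pn sets_half measurable_score score_odd L(2) L(1) s'(1,2) e, of "d0 n" u "\<not> u"]], simp)
      fix \<omega>
      assume *: "\<forall>d. \<bar>\<Sum>i\<in>cell (half (d0 n) u) (\<not> u) d \<omega>. score k (\<xi> n i \<omega>)\<bar>
          \<le> 2 * s' * n * L * cell_prob (half (d0 n) u) (\<not> u) d + L / s' * entropy (e / 2)"
      show "\<forall>d. \<bar>\<Sum>i\<in>cell (half (d0 n) u) (\<not> u) d \<omega>. score k (\<xi> n i \<omega>)\<bar>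
        \<le> s * real n * cell_prob (half (d0 n) u) (\<not> u) d + K * (p n * ln (n / p n))"
      proof
        fix d
        have "(2 * s' * L) * (n * cell_prob (half (d0 n) u) (\<not> u) d) \<le> s * (n * cell_prob (half (d0 n) u) (\<not> u) d)"
          using s'(3) cell_prob_range by (intro mult_right_mono) auto
        then show "\<bar>\<Sum>i\<in>cell (half (d0 n) u) (\<not> u) d \<omega>. score k (\<xi> n i \<omega>)\<bar>
          \<le> s * real n * cell_prob (half (d0 n) u) (\<not> u) d + K * (p n * ln (n / p n))"
          using *[rule_format, of d] ent by (simp add: V_def mult_ac)
      qed
    qed
  qed
qed

end

section \<open>Scores of the squared loss and the final rates\<close>

context change_plane
begin

definition aspect :: "nat \<Rightarrow> real" where
  "aspect n = n / (p n * max_abs_mean n (M n) (\<xi> n))"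

lemma square_noise:
  assumes sq: "integrable P\<xi> (\<lambda>y. y\<^sup>2)"
  shows "integrable P\<xi> (\<lambda>y. \<bar>y\<bar>)" "0 < (\<integral>y. \<bar>y\<bar> \<partial>P\<xi>)"
    and "1 \<le> n \<Longrightarrow> (\<integral>y. \<bar>y\<bar> \<partial>P\<xi>) \<le> max_abs_mean n (M n) (\<xi> n)"
proof -
  interpret P: prob_space P\<xi> by (rule prob_noise)
  have "(\<lambda>y. y) \<in> borel_measurable P\<xi>" by (simp add: measurable_cong_sets[OF prob_noise(2) refl])
  from P.square_integrable_imp_integrable[OF this sq] show int: "integrable P\<xi> (\<lambda>y. \<bar>y\<bar>)"
    by (rule integrable_abs)
  show "0 < (\<integral>y. \<bar>y\<bar> \<partial>P\<xi>)"
  proof (rule ccontr)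
    assume "\<not> 0 < (\<integral>y. \<bar>y\<bar> \<partial>P\<xi>)"
    moreover have "0 \<le> (\<integral>y. \<bar>y\<bar> \<partial>P\<xi>)" by simp
    ultimately have "(\<integral>y. \<bar>y\<bar> \<partial>P\<xi>) = 0" by linarith
    then have ae: "AE y in P\<xi>. \<bar>y\<bar> = 0" using integral_nonneg_eq_0_iff_AE[OF int] by simp
    have S: "{y. 0 < \<bar>y\<bar> \<and> \<bar>y\<bar> < 1} \<in> sets P\<xi>" unfolding prob_noise(2) by measurable
    have "measure P\<xi> {y. 0 < \<bar>y\<bar> \<and> \<bar>y\<bar> < 1} = 0"
      unfolding P.prob_eq_0[OF S] using ae by eventually_elim auto
    then show False using noise_near_zero_pos[of 1] by simp
  qed
  show "(\<integral>y. \<bar>y\<bar> \<partial>P\<xi>) \<le> max_abs_mean n (M n) (\<xi> n)" if "1 \<le> n"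
    using iid_model.max_noise(1)[OF model[OF that] int] .
qed

text \<open>The score is the noise itself, truncated at a multiple of its mean maximum. Dividing by
  \<open>m\<close> guards against a small mean maximum: the scale then dominates \<open>p n\<close>
  and \<open>p n * ln (aspect n)\<close>, as the entropy bound requires.\<close>

lemma score_control_square:
  assumes sq: "integrable P\<xi> (\<lambda>y. y\<^sup>2)"
  defines "m \<equiv> min 1 (\<integral>y. \<bar>y\<bar> \<partial>P\<xi>)"
  shows "score_control \<infinity> {n. 1 \<le> n \<and> exp 1 \<le> aspect n} (\<lambda>n. p n * max_abs_mean n (M n) (\<xi> n) * ln (aspect n) / m)"
  unfolding score_control_def
proof (intro allI impI)
  fix s e :: real assume s: "0 < s" and e: "0 < e"
  define m1 where "m1 = (\<integral>y. \<bar>y\<bar> \<partial>P\<xi>)"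
  note int = square_noise(1)[OF sq]
  have m1: "0 < m1" using square_noise(2)[OF sq] by (simp add: m1_def)
  have m: "0 < m" "m \<le> 1" using m1 by (auto simp: m_def m1_def)
  define e1 where "e1 = min e 1 / 2"
  have e1: "0 < e1" "e1 \<le> 1" "e1 + e1 \<le> e" using e by (auto simp: e1_def)
  \<comment> \<open>Markov's inequality: some noise reaches \<open>h\<close> times the mean maximum
    with probability at most \<open>e1\<close>.\<close>
  define h where "h = 1 / e1"
  have h: "1 \<le> h" "0 < h" using e1 by (auto simp: h_def)
  have \<theta>: "0 < 1 / h" using h by simp
  define s' where "s' = min (1/2) (s / (2 * (2 * m1 + 1)))"
  have s': "0 < s'" "s' \<le> 1/2" "2 * s' * (2 * m1 + 1) \<le> s"
  proof -
    show "0 < s'" using s m1 by (simp add: s'_def)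
    show "s' \<le> 1/2" unfolding s'_def by (rule min.cobounded1)
    have "2 * s' * (2 * m1 + 1) \<le> 2 * (s / (2 * (2 * m1 + 1))) * (2 * m1 + 1)"
      using m1 by (intro mult_right_mono mult_left_mono) (auto simp: s'_def)
    also have "\<dots> = s" using m1 by (simp add: field_simps)
    finally show "2 * s' * (2 * m1 + 1) \<le> s" .
  qed
  define A where "A = 4 * m1 + 3 * ln (1 / e1) + 15"
  have A: "0 \<le> A" using m1 e1 by (simp add: A_def)
  define K where "K = h / s' * (A + 3)"
  have K: "0 < K" using h s'(1) A by (simp add: K_def)
  show "\<exists>K>0. \<exists>\<theta>>0. \<forall>n\<in>{n. 1 \<le> n \<and> exp 1 \<le> aspect n}. p n \<le> n \<longrightarrow>
     p n * max_abs_mean n (M n) (\<xi> n) * ln (aspect n) / m \<le> \<theta> * real n \<longrightarrow> (\<forall>u.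
     except_prob (M n) e (\<lambda>\<omega>. \<forall>d. \<bar>\<Sum>i\<in>iid_model.cell (p n) n (X n) (iid_model.half (p n) (d0 n) u) (\<not> u) d \<omega>. score \<infinity> (\<xi> n i \<omega>)\<bar>
        \<le> s * real n * iid_model.cell_prob (p n) (PX n) (iid_model.half (p n) (d0 n) u) (\<not> u) d
          + K * (p n * max_abs_mean n (M n) (\<xi> n) * ln (aspect n) / m)))"
  proof (rule exI[of _ K], rule conjI[OF K], rule exI[of _ "1 / h"], rule conjI[OF \<theta>], intro ballI allI impI)
    fix n u assume hn: "n \<in> {n. 1 \<le> n \<and> exp 1 \<le> aspect n}"
      and V\<theta>: "p n * max_abs_mean n (M n) (\<xi> n) * ln (aspect n) / m \<le> 1 / h * real n"
    have n1: "1 \<le> n" using hn by simp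
    interpret iid_model "p n" n "M n" "X n" "\<xi> n" "PX n" P\<xi> by (rule model[OF n1])
    have p1: "1 \<le> p n" using dim_pos[OF n1] .
    define \<mu> where "\<mu> = max_abs_mean n (M n) (\<xi> n)"
    have \<mu>: "0 < \<mu>" using square_noise(3)[OF sq n1] m1 by (simp add: \<mu>_def m1_def)
    define x where "x = aspect n"
    have x: "exp 1 \<le> x" using hn by (simp add: x_def)
    then have x0: "0 < x" using exp_gt_zero[of "1::real"] by linarith
    have lx: "1 \<le> ln x" using x x0 by (subst ln_ge_iff) auto
    have nx: "n = p n * \<mu> * x" using p1 \<mu> n1 by (simp add: x_def aspect_def \<mu>_def)
    have P0: "0 < p n * \<mu>" using p1 \<mu> by simp
    define V where "V = p n * \<mu> * ln x / m"
    have plV: "p n * \<mu> * ln x \<le> V"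
    proof -
      have "p n * \<mu> * ln x * m \<le> p n * \<mu> * ln x * 1" using m P0 lx by (intro mult_left_mono) auto
      then show ?thesis using m by (simp add: V_def pos_le_divide_eq)
    qed
    have pV: "p n * \<mu> \<le> V" using mult_left_mono[OF lx, of "p n * \<mu>"] P0 plV by linarith
    \<comment> \<open>The threshold \<open>1 / h\<close> turns smallness of \<open>V\<close> into
      \<open>h \<le> x\<close>, that is \<open>p n * (\<mu> * h) \<le> n\<close>, the condition for
      the dyadic bound at the truncation level.\<close>
    have hx: "h \<le> x"
    proof -
      have "V \<le> 1 / h * (p n * \<mu> * x)" using V\<theta> nx by (simp add: V_def x_def \<mu>_def)
      then have "p n * \<mu> * 1 \<le> p n * \<mu> * (x / h)" using pV by simp
      then have "1 \<le> x / h" using P0 by (simp only: mult_le_cancel_left_pos)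
      then show ?thesis using h by (simp add: le_divide_eq)
    qed
    have pK: "p n * (\<mu> * h) \<le> n" using mult_left_mono[OF hx, of "p n * \<mu>"] P0 nx by (simp add: mult.assoc)
    have \<mu>h: "0 < \<mu> * h" using \<mu> h by simp
    have ev: "except_prob (M n) (e1 + e1) (\<lambda>\<omega>. (\<forall>i\<in>{1..n}. \<bar>\<xi> n i \<omega>\<bar> < \<mu> * h) \<and>
       (\<forall>d. \<bar>\<Sum>i | i \<in> cell (half (d0 n) u) (\<not> u) d \<omega> \<and> \<bar>\<xi> n i \<omega>\<bar> \<le> \<mu> * h. \<xi> n i \<omega>\<bar>
        \<le> 2 * s' * n * (2 * m1 + 1) * cell_prob (half (d0 n) u) (\<not> u) d
          + p n * (\<mu> * h) / s' * (4 * m1 + 3 * ln (n / (p n * (\<mu> * h))) + 3 * ln (1 / e1) + 15)))"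
    proof (rule except_prob_conj)
      have "max_abs_mean n (M n) (\<xi> n) / (\<mu> * h) = e1" using \<mu> e1 by (simp add: h_def \<mu>_def)
      then show "except_prob (M n) e1 (\<lambda>\<omega>. \<forall>i\<in>{1..n}. \<bar>\<xi> n i \<omega>\<bar> < \<mu> * h)"
        using max_noise(2)[OF int \<mu>h] by simp
    qed (unfold m1_def, rule truncated_noise[OF p1 pK sets_half int \<mu>h s'(1,2) e1(1,2)])
    have fin: "p n * (\<mu> * h) / s' * (4 * m1 + 3 * ln (n / (p n * (\<mu> * h))) + 3 * ln (1 / e1) + 15) \<le> K * V"
    proof -
      have "n / (p n * (\<mu> * h)) = x / h" using p1 \<mu> h by (subst nx) simp
      moreover have "ln (x / h) \<le> ln x" using h x0 by (simp add: ln_div)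
      ultimately have "p n * \<mu> * (4 * m1 + 3 * ln (n / (p n * (\<mu> * h))) + 3 * ln (1 / e1) + 15) \<le> p n * \<mu> * (A + 3 * ln x)"
        using P0 by (intro mult_left_mono) (auto simp: A_def)
      also have "\<dots> = A * (p n * \<mu>) + 3 * (p n * \<mu> * ln x)" by (simp add: algebra_simps)
      also have "\<dots> \<le> A * V + 3 * V" using A pV plV by (intro add_mono mult_left_mono) auto
      finally have "h / s' * (p n * \<mu> * (4 * m1 + 3 * ln (n / (p n * (\<mu> * h))) + 3 * ln (1 / e1) + 15)) \<le> h / s' * (A * V + 3 * V)"
        using h s'(1) by (intro mult_left_mono) auto
      then show ?thesis by (simp add: K_def algebra_simps)
    qed
    show "except_prob (M n) e (\<lambda>\<omega>. \<forall>d. \<bar>\<Sum>i\<in>cell (half (d0 n) u) (\<not> u) d \<omega>. score \<infinity> (\<xi> n i \<omega>)\<bar>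
        \<le> s * real n * cell_prob (half (d0 n) u) (\<not> u) d + K * (p n * max_abs_mean n (M n) (\<xi> n) * ln (aspect n) / m))"
    proof (rule except_prob_mono[OF ev e1(3)], intro allI)
      fix \<omega> d
      assume *: "(\<forall>i\<in>{1..n}. \<bar>\<xi> n i \<omega>\<bar> < \<mu> * h) \<and>
       (\<forall>d. \<bar>\<Sum>i | i \<in> cell (half (d0 n) u) (\<not> u) d \<omega> \<and> \<bar>\<xi> n i \<omega>\<bar> \<le> \<mu> * h. \<xi> n i \<omega>\<bar>
        \<le> 2 * s' * n * (2 * m1 + 1) * cell_prob (half (d0 n) u) (\<not> u) d
          + p n * (\<mu> * h) / s' * (4 * m1 + 3 * ln (n / (p n * (\<mu> * h))) + 3 * ln (1 / e1) + 15))"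
      define c where "c = cell (half (d0 n) u) (\<not> u) d \<omega>"
      define P where "P = cell_prob (half (d0 n) u) (\<not> u) d"
      have all: "{i. i \<in> c \<and> \<bar>\<xi> n i \<omega>\<bar> \<le> \<mu> * h} = c"
        using conjunct1[OF *] by (auto simp: c_def cell_def less_imp_le)
      have score: "score \<infinity> y = y" for y by (simp add: score_def)
      have "0 \<le> P" by (simp add: P_def cell_prob_def)
      then have "(2 * s' * (2 * m1 + 1)) * (n * P) \<le> s * (n * P)"
        using s'(3) by (intro mult_right_mono) auto
      then have main: "2 * s' * n * (2 * m1 + 1) * P \<le> s * real n * P" by (simp only: mult_ac)
      have "\<bar>\<Sum>i | i \<in> c \<and> \<bar>\<xi> n i \<omega>\<bar> \<le> \<mu> * h. \<xi> n i \<omega>\<bar>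
        \<le> 2 * s' * n * (2 * m1 + 1) * P
          + p n * (\<mu> * h) / s' * (4 * m1 + 3 * ln (n / (p n * (\<mu> * h))) + 3 * ln (1 / e1) + 15)"
        unfolding c_def P_def using conjunct2[OF *] by (rule spec)
      then have "\<bar>\<Sum>i\<in>c. \<xi> n i \<omega>\<bar> \<le> s * real n * P + K * V" using main fin unfolding all by linarith
      then show "\<bar>\<Sum>i\<in>cell (half (d0 n) u) (\<not> u) d \<omega>. score \<infinity> (\<xi> n i \<omega>)\<bar>
        \<le> s * real n * cell_prob (half (d0 n) u) (\<not> u) d + K * (p n * max_abs_mean n (M n) (\<xi> n) * ln (aspect n) / m)"
        unfolding score c_def P_def V_def x_def \<mu>_def .
    qed
  qed
qed

lemma ratio_at_top: "filterlim (\<lambda>n. real n / real (p n)) at_top sequentially"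
proof -
  have "\<forall>\<^sub>F n in sequentially. 0 < real (p n) / real n"
    unfolding eventually_sequentially using dim_pos by (intro exI[of _ 1]) (auto simp: zero_less_divide_iff Suc_le_eq One_nat_def)
  then have "filterlim (\<lambda>n. inverse (real (p n) / real n)) at_top sequentially"
    using dim_growth by (intro filterlim_inverse_at_top)
  then show ?thesis by simp
qed

text \<open>As \<open>n / p n\<close> diverges and \<open>ln x / x\<close> tends to zero, all large
  \<open>n\<close> lie in \<open>N\<close> with \<open>V n\<close> an arbitrarily small fraction of
  \<open>n\<close>.\<close>

theorem finite_loss_rates:
  assumes k: "k < \<infinity>"
    and est: "\<forall>n\<ge>1. two_step_estimator k \<Omega> (p n) n (M n) (X n) (response (p n) \<alpha>0 \<beta>0 (d0 n) (X n) (\<xi> n))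
                  (ai n) (bi n) (d n) (a n) (b n)"
  defines "R \<equiv> \<lambda>n. log_rate (real n / real (p n))"
  shows "bounded_in_prob M (\<lambda>n \<omega>. min (sqrt (real n)) (R n) * (a n \<omega> - \<alpha>0)) \<and>
    bounded_in_prob M (\<lambda>n \<omega>. min (sqrt (real n)) (R n) * (b n \<omega> - \<beta>0)) \<and>
    bounded_in_prob M (\<lambda>n \<omega>. R n * mismatch_prob (p n) (PX n) (d n \<omega>) (d0 n)) \<and>
    bounded_in_prob M (\<lambda>n \<omega>. R n * l2_dist (p n) (d n \<omega>) (d0 n))"
proof -
  interpret P: prob_space P\<xi> by (rule prob_noise)
  define V where "V n = p n * ln (n / p n)" for n
  define N where "N = {n. 1 \<le> n \<and> exp 1 \<le> n / p n}"
  obtain L where L: "0 < L" "\<And>x. \<bar>score k x\<bar> \<le> L" using score_bounded[OF k] by blast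
  have "(\<lambda>y. (score k y)\<^sup>2) \<in> borel_measurable P\<xi>" by (simp add: measurable_cong_sets[OF prob_noise(2) refl])
  moreover have "(score k y)\<^sup>2 \<le> L\<^sup>2" for y using power_mono[OF L(2)[of y], of 2] by simp
  ultimately have sq: "integrable P\<xi> (\<lambda>y. (score k y)\<^sup>2)" by (intro P.integrable_const_bound[of _ "L\<^sup>2"]) auto
  have NV: "1 \<le> n" "1 \<le> p n" "p n \<le> V n" if "n \<in> N" for n
  proof -
    show n: "1 \<le> n" using that by (simp add: N_def)
    show p: "1 \<le> p n" by (rule dim_pos[OF n])
    have "1 \<le> ln (n / p n)" using that n p by (subst ln_ge_iff) (auto simp: N_def)
    then show "p n \<le> V n" using mult_left_mono[of 1 "ln (n / p n)" "real (p n)"] by (simp add: V_def)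
  qed
  have control: "score_control k N V" using score_control_finite[OF k] by (simp add: N_def V_def[abs_def])
  have V1: "1 \<le> V n" if "n \<in> N" for n using NV(2,3)[OF that] by simp
  have V3: "p n * ln (n / p n) + 2 * p n \<le> 3 * V n" if "n \<in> N" for n using NV(3)[OF that] by (simp add: V_def)
  have Rn: "R n = 1 * (n / V n)" if "n \<in> N" for n by (simp add: R_def V_def log_rate_def field_simps)
  have rest: "\<exists>B. \<forall>\<^sub>F n in sequentially. n \<in> N \<and> V n \<le> \<theta> * n \<or> \<bar>R n\<bar> \<le> B" if \<theta>: "0 < \<theta>" for \<theta> :: real
  proof -
    have "\<forall>\<^sub>F x in at_top. ln x / x < \<theta>" using order_tendstoD(2)[OF ln_x_over_x_tendsto_0 \<theta>] .
    then have "\<forall>\<^sub>F x in at_top. ln x / x < \<theta> \<and> exp 1 \<le> x" using eventually_ge_at_top[of "exp 1"] by eventually_elim simp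
    then have "\<forall>\<^sub>F n in sequentially. ln (real n / real (p n)) / (real n / real (p n)) < \<theta> \<and> exp 1 \<le> real n / real (p n)"
      using ratio_at_top by (rule eventually_compose_filterlim)
    then have "\<forall>\<^sub>F n in sequentially. n \<in> N \<and> V n \<le> \<theta> * n \<or> \<bar>R n\<bar> \<le> 0"
      using eventually_ge_at_top[of 1]
    proof eventually_elim
      case (elim n)
      have p: "1 \<le> p n" using dim_pos elim by blast
      have "V n = n * (ln (real n / real (p n)) / (real n / real (p n)))" using elim p by (simp add: V_def)
      also have "\<dots> \<le> n * \<theta>" using elim by (intro mult_left_mono) auto
      finally show ?case using elim by (simp add: N_def mult.commute)
    qed
    then show ?thesis by blast
  qed
  from bounded_estimators[OF sq NV(1) V1 V3 control Rn order_refl rest est] show ?thesis by blast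
qed

text \<open>\<open>p n / n\<close> may vanish while \<open>aspect n\<close> stays bounded, even
  close to one, where its logarithm vanishes and \<open>R\<close> explodes. \<open>away\<close>
  excludes this, and outside \<open>N\<close> it gives
  \<open>\<bar>R n\<bar> \<le> exp 1 / \<eta>\<close>.\<close>

theorem square_loss_rates:
  assumes sq: "integrable P\<xi> (\<lambda>y. y\<^sup>2)"
    and away: "\<exists>\<eta>>0. \<forall>\<^sub>F n in sequentially. \<bar>ln (real n / (real (p n) * max_abs_mean n (M n) (\<xi> n)))\<bar> \<ge> \<eta>"
    and est: "\<forall>n\<ge>1. two_step_estimator \<infinity> \<Omega> (p n) n (M n) (X n) (response (p n) \<alpha>0 \<beta>0 (d0 n) (X n) (\<xi> n))
                  (ai n) (bi n) (d n) (a n) (b n)"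
  defines "R \<equiv> \<lambda>n. log_rate (real n / (real (p n) * max_abs_mean n (M n) (\<xi> n)))"
  shows "bounded_in_prob M (\<lambda>n \<omega>. min (sqrt (real n)) (R n) * (a n \<omega> - \<alpha>0)) \<and>
    bounded_in_prob M (\<lambda>n \<omega>. min (sqrt (real n)) (R n) * (b n \<omega> - \<beta>0)) \<and>
    bounded_in_prob M (\<lambda>n \<omega>. R n * l2_dist (p n) (d n \<omega>) (d0 n))"
proof -
  define m where "m = min 1 (\<integral>y. \<bar>y\<bar> \<partial>P\<xi>)"
  define \<mu> where "\<mu> n = max_abs_mean n (M n) (\<xi> n)" for n
  define V where "V n = p n * \<mu> n * ln (aspect n) / m" for n
  define N where "N = {n. 1 \<le> n \<and> exp 1 \<le> aspect n}"
  have m: "0 < m" "m \<le> 1" using square_noise(2)[OF sq] by (auto simp: m_def)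
  have \<mu>: "m \<le> \<mu> n" if "1 \<le> n" for n using square_noise(3)[OF sq that] by (simp add: m_def \<mu>_def min.coboundedI2)
  have asp: "0 < aspect n" "n = p n * \<mu> n * aspect n" "0 < \<mu> n" "1 \<le> real (p n)" if "1 \<le> n" for n
  proof -
    show p: "1 \<le> real (p n)" using dim_pos[OF that] by simp
    show \<mu>0: "0 < \<mu> n" using \<mu>[OF that] m by simp
    show "0 < aspect n" using p \<mu>0 that by (simp add: aspect_def \<mu>_def)
    show "n = p n * \<mu> n * aspect n" using p \<mu>0 by (simp add: aspect_def \<mu>_def)
  qed
  have N1: "1 \<le> n" if "n \<in> N" for n using that by (simp add: N_def)
  have ln1: "1 \<le> ln (aspect n)" if "n \<in> N" for n
    using that asp(1)[OF N1[OF that]] by (subst ln_ge_iff) (auto simp: N_def)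
  have Vm: "V n * m = p n * \<mu> n * ln (aspect n)" for n using m by (simp add: V_def)
  have pV: "p n * ln (aspect n) \<le> V n" "p n * \<mu> n \<le> V n" "p n \<le> V n" if n: "n \<in> N" for n
  proof -
    note n1 = N1[OF n]
    have "p n * ln (aspect n) * m \<le> p n * ln (aspect n) * \<mu> n"
      using \<mu>[OF n1] ln1[OF n] asp(4)[OF n1] by (intro mult_left_mono mult_nonneg_nonneg) auto
    then have "p n * ln (aspect n) * m \<le> V n * m" unfolding Vm by (simp add: mult_ac)
    then show a: "p n * ln (aspect n) \<le> V n" using m by (simp only: mult_le_cancel_right_pos)
    then show "p n \<le> V n" using mult_left_mono[OF ln1[OF n], of "real (p n)"] by simp
    have "p n * \<mu> n * m \<le> p n * \<mu> n * ln (aspect n)"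
      using ln1[OF n] m asp(3)[OF n1] by (intro mult_left_mono) auto
    then have "p n * \<mu> n * m \<le> V n * m" unfolding Vm .
    then show "p n * \<mu> n \<le> V n" using m by (simp only: mult_le_cancel_right_pos)
  qed
  have V1: "1 \<le> V n" if "n \<in> N" for n using pV(3)[OF that] asp(4)[OF N1[OF that]] by linarith
  \<comment> \<open>\<open>n / p n\<close> is \<open>aspect n\<close> times \<open>\<mu> n\<close>,
    and \<open>ln (\<mu> n)\<close> is at most \<open>\<mu> n\<close>; each of the resulting terms
    is at most a multiple of \<open>V n\<close>.\<close>
  have V4: "p n * ln (n / p n) + 2 * p n \<le> 4 * V n" if n: "n \<in> N" for n
  proof -
    note n1 = N1[OF n]
    have "n / p n = aspect n * \<mu> n" using asp(2,4)[OF n1] by (simp add: field_simps)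
    then have "ln (n / p n) = ln (aspect n) + ln (\<mu> n)" using asp(1,3)[OF n1] by (simp add: ln_mult)
    also have "\<dots> \<le> ln (aspect n) + \<mu> n" using ln_le_minus_one[OF asp(3)[OF n1]] by simp
    finally have "p n * ln (n / p n) \<le> p n * (ln (aspect n) + \<mu> n)" by (intro mult_left_mono) auto
    then show ?thesis using pV[OF n] by (simp add: distrib_left)
  qed
  have control: "score_control \<infinity> N V"
    using score_control_square[OF sq] by (simp add: N_def V_def[abs_def] m_def \<mu>_def)
  have score: "score \<infinity> y = y" for y by (simp add: score_def)
  have sq': "integrable P\<xi> (\<lambda>y. (score \<infinity> y)\<^sup>2)" using sq by (simp only: score)
  have Ra: "R n = aspect n / ln (aspect n)" for n
    by (simp add: R_def aspect_def log_rate_def divide_inverse)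
  have Rn: "R n = 1 / m * (n / V n)" if n: "n \<in> N" for n
  proof -
    note n1 = N1[OF n]
    have "n / V n = p n * \<mu> n * aspect n / V n" using asp(2)[OF n1] by simp
    also have "\<dots> = m * (aspect n / ln (aspect n))"
      using asp(3,4)[OF n1] m by (simp add: V_def)
    finally show ?thesis using m by (simp add: Ra)
  qed
  obtain \<eta> where \<eta>: "0 < \<eta>" "\<forall>\<^sub>F n in sequentially. \<eta> \<le> \<bar>ln (aspect n)\<bar>"
    using away unfolding aspect_def by auto
  \<comment> \<open>The first bound is for \<open>n\<close> in \<open>N\<close> with
    \<open>V n\<close> above \<open>\<theta> * n\<close>, the second for \<open>n\<close> outside
    \<open>N\<close>.\<close>
  have rest: "\<exists>B. \<forall>\<^sub>F n in sequentially. n \<in> N \<and> V n \<le> \<theta> * n \<or> \<bar>R n\<bar> \<le> B" if \<theta>: "0 < \<theta>" for \<theta> :: real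
  proof (rule exI[of _ "max (1 / (m * \<theta>)) (exp 1 / \<eta>)"])
    show "\<forall>\<^sub>F n in sequentially. n \<in> N \<and> V n \<le> \<theta> * n \<or> \<bar>R n\<bar> \<le> max (1 / (m * \<theta>)) (exp 1 / \<eta>)"
      using \<eta>(2) eventually_ge_at_top[of 1]
    proof eventually_elim
      case (elim n)
      show ?case
      proof (cases "n \<in> N")
        case True
        have V: "0 < V n" using V1[OF True] by simp
        show ?thesis
        proof (cases "V n \<le> \<theta> * n")
          case False
          have "n / V n \<le> 1 / \<theta>" using False V \<theta> by (simp add: field_simps)
          then have "1 / m * (n / V n) \<le> 1 / m * (1 / \<theta>)" using m by (intro mult_left_mono) auto
          moreover have "0 \<le> 1 / m * (n / V n)" using m V by simp
          ultimately have "\<bar>R n\<bar> \<le> 1 / (m * \<theta>)" unfolding Rn[OF True] by simp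
          then show ?thesis by (simp add: le_max_iff_disj)
        qed (use True in simp)
      next
        case False
        have "aspect n \<le> exp 1" using False elim(2) by (simp add: N_def)
        then have "\<bar>R n\<bar> \<le> exp 1 / \<eta>"
          unfolding Ra abs_divide using asp(1)[OF elim(2)] elim(1) \<eta>(1) by (intro frac_le) auto
        then show ?thesis by (simp add: le_max_iff_disj)
      qed
    qed
  qed
  have "1 \<le> 1 / m" using m by simp
  from bounded_estimators[OF sq' N1 V1 V4 control Rn this rest est] show ?thesis by blast
qed

end

theorem theorem3p6:
  fixes p :: "nat \<Rightarrow> nat"
    and M :: "nat \<Rightarrow> 'a measure"
    and X :: "nat \<Rightarrow> nat \<Rightarrow> 'a \<Rightarrow> nat \<Rightarrow> real"
    and \<xi> :: "nat \<Rightarrow> nat \<Rightarrow> 'a \<Rightarrow> real"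
    and PX :: "nat \<Rightarrow> (nat \<Rightarrow> real) measure"
    and P\<xi> :: "real measure"
    and f :: "real \<Rightarrow> real"
    and \<Omega> :: "(real \<times> real) set"
    and \<alpha>\<^sub>0 \<beta>\<^sub>0 :: real
    and d\<^sub>0 :: "nat \<Rightarrow> nat \<Rightarrow> real"
    and \<delta> c C1 C2 C3 :: real
  defines "Y \<equiv> \<lambda>n. response (p n) \<alpha>\<^sub>0 \<beta>\<^sub>0 (d\<^sub>0 n) (X n) (\<xi> n)"
    and "rate \<equiv> \<lambda>n. log_rate (real n / real (p n))"
    and "r \<equiv> \<lambda>n. log_rate (real n / (real (p n) * max_abs_mean n (M n) (\<xi> n)))"
  assumes dim_pos: "\<And>n. n \<ge> 1 \<Longrightarrow> p n \<ge> 1"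
    and dim_growth: "(\<lambda>n. real (p n) / real n) \<longlonglongrightarrow> 0"
    and sample: "\<And>n. n \<ge> 1 \<Longrightarrow> iid_sample (p n) n (M n) (X n) (\<xi> n) (PX n) P\<xi>"
    and noise_symmetric: "distr P\<xi> borel uminus = P\<xi>"
    and noise_density: "P\<xi> = density lborel (\<lambda>x. ennreal (f x))"
      "\<And>x. f x \<ge> 0" "continuous_on UNIV f" "f 0 > 0"
    and cond_A: "compact \<Omega>" "\<And>\<alpha> \<beta>. (\<alpha>, \<beta>) \<in> \<Omega> \<Longrightarrow> \<alpha> > \<beta>" "(\<alpha>\<^sub>0, \<beta>\<^sub>0) \<in> \<Omega>"
      "\<And>n. n \<ge> 1 \<Longrightarrow> d\<^sub>0 n \<in> unit_sphere (p n)"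
    and cond_B: "\<delta> > 0" "c > 0" "C1 > 0" "C2 > 0"
      "\<And>n. n \<ge> 1 \<Longrightarrow> wedge_condition (p n) (PX n) (d\<^sub>0 n) \<delta> c C1 C2"
    and positive_side: "C3 > 0"
      "\<And>n. n \<ge> 1 \<Longrightarrow> measure (PX n) {x \<in> space (PX n). dot (p n) x (d\<^sub>0 n) > 0} \<ge> C3"
  shows
    "(\<forall>k a_init b_init d a b.
        k < \<infinity> \<longrightarrow>
        (\<forall>n\<ge>1. two_step_estimator k \<Omega> (p n) n (M n) (X n) (Y n)
                  (a_init n) (b_init n) (d n) (a n) (b n)) \<longrightarrow>
        bounded_in_prob M (\<lambda>n \<omega>. min (sqrt (real n)) (rate n) * (a n \<omega> - \<alpha>\<^sub>0)) \<and>
        bounded_in_prob M (\<lambda>n \<omega>. min (sqrt (real n)) (rate n) * (b n \<omega> - \<beta>\<^sub>0)) \<and>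
        bounded_in_prob M (\<lambda>n \<omega>. rate n * mismatch_prob (p n) (PX n) (d n \<omega>) (d\<^sub>0 n)) \<and>
        bounded_in_prob M (\<lambda>n \<omega>. rate n * l2_dist (p n) (d n \<omega>) (d\<^sub>0 n)))
   \<and> (\<forall>a_init b_init d a b.
        integrable P\<xi> (\<lambda>x. x\<^sup>2) \<longrightarrow>
        (\<exists>\<eta>>0. \<forall>\<^sub>F n in sequentially.
           \<bar>ln (real n / (real (p n) * max_abs_mean n (M n) (\<xi> n)))\<bar> \<ge> \<eta>) \<longrightarrow>
        (\<forall>n\<ge>1. two_step_estimator \<infinity> \<Omega> (p n) n (M n) (X n) (Y n)
                  (a_init n) (b_init n) (d n) (a n) (b n)) \<longrightarrow>
        bounded_in_prob M (\<lambda>n \<omega>. min (sqrt (real n)) (r n) * (a n \<omega> - \<alpha>\<^sub>0)) \<and>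
        bounded_in_prob M (\<lambda>n \<omega>. min (sqrt (real n)) (r n) * (b n \<omega> - \<beta>\<^sub>0)) \<and>
        bounded_in_prob M (\<lambda>n \<omega>. r n * l2_dist (p n) (d n \<omega>) (d\<^sub>0 n)))"
proof -
  interpret change_plane p M X \<xi> PX P\<xi> f \<Omega> \<alpha>\<^sub>0 \<beta>\<^sub>0 d\<^sub>0 \<delta> c C1 C2 C3
    by (rule change_plane.intro) (fact assms)+
  show ?thesis
    unfolding Y_def rate_def r_def
    using finite_loss_rates square_loss_rates by blast
qed

end
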